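(* Let $\Lambda$ be an admissible sequence. For $n\in\mathbb{N}$ let $\alpha=\alpha(n)>0$ be the solution of $n=\sum_{\lambda\in\Lambda}\frac{\lambda}{e^{\alpha\lambda}-1}$. Then the expected number of summands $m_\Lambda(n)=t_\Lambda^1(n)/t_\Lambda^0(n)$ satisfies, as $n\to\infty$: (i) If $\mu_0<1$, then $m_\Lambda(n)=\dfrac{\zeta_\Lambda(1)}{\alpha}[1+o(1)]$. (ii) If $\mu_0=1$, then $m_\Lambda(n)=\dfrac1\alpha\Bigl(\mathrm{FP}_{t=1}\zeta_\Lambda(t)-A_{-1}\log\alpha\Bigr)[1+o(1)]$. (iii) If $\mu_0>1$, then $m_\Lambda(n)=\dfrac{\zeta_R(\mu_0)A_{-\mu_0}}{\alpha^{\mu_0}}[1+o(1)]$.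
   Context: A sequence $\Lambda$ is called admissible if it is a nondecreasing sequence of positive integers (the same integer may occur finitely many times; all sums and products over $\lambda\in\Lambda$ count multiplicity) such that: (i) $1\in\Lambda$; (ii) $\Theta(t)=\sum_{\lambda\in\Lambda}e^{-\lambda t}$ converges for all $t>0$; (iii) as $t\to0^+$, $\Theta$ admits a full asymptotic expansion $\Theta(t)\sim\sum_{n\ge0}A_{i_n}t^{i_n}$ with real exponents $i_0<i_1<i_2<\cdots$, $i_n\to\infty$, $i_0<0$ and $A_{i_0}\neq0$. Thus $A_x$ is the coefficient of $t^x$ in the expansion. Write $\mu_0=-i_0$. Let $\zeta_\Lambda(s)=\sum_{\lambda\in\Lambda}\lambda^{-s}$ for $\Re s>\mu_0$, also denoting its meromorphic continuation to $\mathbb{C}$; $\mathrm{FP}_{t=1}\zeta_\Lambda(t)$ is the constant term of the Laurent expansion of $\zeta_\Lambda(t)$ about $t=1$. $\zeta_R$ is the Riemann zeta-function. Let $p_\Lambda(n,m)$ be the number of partitions of $n$ into $m$ summands from $\Lambda$, where repetition of summands is allowed and equal integers occupying different positions of $\Lambda$ are regarded as different; that is, $\prod_{\lambda\in\Lambda}(1-zx^\lambda)^{-1}=\sum_{n,m\ge0}p_\Lambda(n,m)x^nz^m$. For $n\ge1$ and $k\ge0$, $t_\Lambda^k(n)=\sum_{m\ge0}m^kp_\Lambda(n,m)$ (the $k$ in $t_\Lambda^k$ is an index; $t_\Lambda^0(n)=\sum_m p_\Lambda(n,m)$). *)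

theory Defs
  imports
    "HOL-Analysis.Analysis"
    "HOL-Library.Landau_Symbols"
    "HOL-Library.Multiset"
    "HOL-Complex_Analysis.Complex_Analysis"
begin

definition theta_sum :: "(nat \<Rightarrow> nat) \<Rightarrow> real \<Rightarrow> real" where
  "theta_sum \<Lambda> t = (\<Sum>k. exp (- (real (\<Lambda> k) * t)))"

(* The sequence of positions is indexed by nat, so multiplicities are built into the sums over k.
   Admissibility forces the sequence to be infinite: a finite one has a bounded theta sum, whereas
   the leading term has a negative exponent.  The exponents are e 0 < e 1 < ..., and A x is the
   coefficient of t powr x; A is only relevant on range e.  Only the leading coefficient is required
   to be nonzero, so an expansion with finitely many terms is covered by padding with zeros. *)
definition admissible :: "(nat \<Rightarrow> nat) \<Rightarrow> (nat \<Rightarrow> real) \<Rightarrow> (real \<Rightarrow> real) \<Rightarrow> bool" where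
  "admissible \<Lambda> e A \<longleftrightarrow>
     mono \<Lambda> \<and> (\<forall>k. 0 < \<Lambda> k) \<and> 1 \<in> range \<Lambda> \<and>
     (\<forall>t>0. summable (\<lambda>k. exp (- (real (\<Lambda> k) * t)))) \<and>
     strict_mono e \<and> filterlim e at_top sequentially \<and> e 0 < 0 \<and> A (e 0) \<noteq> 0 \<and>
     (\<forall>N. (\<lambda>t. theta_sum \<Lambda> t - (\<Sum>n\<le>N. A (e n) * t powr e n)) \<in> o[at_right 0](\<lambda>t. t powr e N))"

(* The meromorphic continuation to the whole plane of the Dirichlet series, which is given on
   Re s > \<mu>.  "Nicely meromorphic" fixes the values at poles (to 0) and at removable singularities,
   which makes the continuation unique as a total function. *)
definition zeta_seq :: "(nat \<Rightarrow> nat) \<Rightarrow> real \<Rightarrow> complex \<Rightarrow> complex" where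
  "zeta_seq \<Lambda> \<mu> = (THE Z. Z nicely_meromorphic_on UNIV \<and>
     (\<forall>s. \<mu> < Re s \<longrightarrow> (\<lambda>k. of_nat (\<Lambda> k) powr (- s)) sums Z s))"

(* The constant term of the Laurent expansion of f about z. *)
definition finite_part :: "(complex \<Rightarrow> complex) \<Rightarrow> complex \<Rightarrow> complex" where
  "finite_part f z = fls_nth (laurent_expansion f z) 0"

(* The Riemann zeta function on the half-line s > 1; it is not needed elsewhere. *)
definition riemann_zeta :: "real \<Rightarrow> real" where
  "riemann_zeta s = (\<Sum>n. 1 / real (Suc n) powr s)"

(* A partition is a multiset of positions, so equal integers at different positions count as
   different summands. *)
definition partitions_into :: "(nat \<Rightarrow> nat) \<Rightarrow> nat \<Rightarrow> nat \<Rightarrow> nat multiset set" where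
  "partitions_into \<Lambda> n m = {M. size M = m \<and> (\<Sum>k\<in>#M. \<Lambda> k) = n}"

definition num_partitions :: "(nat \<Rightarrow> nat) \<Rightarrow> nat \<Rightarrow> nat \<Rightarrow> nat" where
  "num_partitions \<Lambda> n m = card (partitions_into \<Lambda> n m)"

lemma finite_partitions_into:
  assumes "admissible \<Lambda> e A"
  shows "finite (partitions_into \<Lambda> n m)"
proof -
  have "(\<lambda>k. exp (- (real (\<Lambda> k) * 1))) \<longlonglongrightarrow> 0"
    using assms unfolding admissible_def by (intro summable_LIMSEQ_zero) (meson zero_less_one)
  then have "\<forall>\<^sub>F k in sequentially. exp (- (real (\<Lambda> k) * 1)) < exp (- real n)"
    by (rule order_tendstoD) simp
  then obtain K where K: "\<And>k. k \<ge> K \<Longrightarrow> n < \<Lambda> k"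
    by (auto simp: eventually_sequentially)
  have "partitions_into \<Lambda> n m \<subseteq> mset ` {xs. set xs \<subseteq> {..<K} \<and> length xs = m}"
  proof
    fix M assume M: "M \<in> partitions_into \<Lambda> n m"
    obtain xs where xs: "M = mset xs" by (metis ex_mset)
    have "k < K" if "k \<in># M" for k
    proof -
      have "\<Lambda> k \<le> (\<Sum>k\<in>#M. \<Lambda> k)"
        using that by (metis image_eqI set_image_mset sum_mset.remove le_add1)
      then show ?thesis using M K[of k] by (force simp: partitions_into_def)
    qed
    then show "M \<in> mset ` {xs. set xs \<subseteq> {..<K} \<and> length xs = m}"
      using M xs by (auto simp: partitions_into_def)
  qed
  moreover have "finite {xs. set xs \<subseteq> {..<K} \<and> length xs = m}"
    by (rule finite_lists_length_eq) simp
  ultimately show ?thesis by (meson finite_imageI finite_subset)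
qed

(* Only terms with m \<le> n contribute, since all summands are positive. *)
definition partition_moment :: "(nat \<Rightarrow> nat) \<Rightarrow> nat \<Rightarrow> nat \<Rightarrow> real" where
  "partition_moment \<Lambda> k n = (\<Sum>m. real m ^ k * real (num_partitions \<Lambda> n m))"

definition mean_summands :: "(nat \<Rightarrow> nat) \<Rightarrow> nat \<Rightarrow> real" where
  "mean_summands \<Lambda> n = partition_moment \<Lambda> 1 n / partition_moment \<Lambda> 0 n"

(* Well defined for n \<ge> 1: the series is a continuous, strictly decreasing function of \<alpha> > 0 with
   limits infinity at 0 and 0 at infinity. *)
definition saddle_point :: "(nat \<Rightarrow> nat) \<Rightarrow> nat \<Rightarrow> real" where
  "saddle_point \<Lambda> n = (THE \<alpha>. 0 < \<alpha> \<and>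
     (\<lambda>k. real (\<Lambda> k) / (exp (\<alpha> * real (\<Lambda> k)) - 1)) sums real n)"

end

theory Submission
  imports Defs "HOL-Real_Asymp.Real_Asymp"
begin

text \<open>
  Write \<open>p n\<close> for the number of partitions of \<open>n\<close>; it is nondecreasing because \<open>1\<close> is a part, so the
  differences of \<open>l \<mapsto> p (n - l) / p n\<close> are the weights of a random variable \<open>L\<close>. Counting
  occurrences of parts gives \<open>n * p n = (\<Sum>l. s l * p (n - l))\<close> and
  \<open>t\<^sup>1 n = (\<Sum>l. d l * p (n - l))\<close>, where \<open>s l\<close> and \<open>d l\<close> are the sum and the number of the parts dividing
  \<open>l\<close>. Hence the mean number of summands is the average of \<open>p (n - l) / p n\<close> against \<open>d\<close>, and the saddle point
  equation says that the Laplace transform of \<open>s\<close>, which is asymptotic to \<open>C * t powr (- a)\<close> with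
  \<open>a = \<mu>\<^sub>0 + 1 > 1\<close>, takes the value \<open>n\<close> at \<open>\<alpha>\<close>.

  No local limit theorem is needed. Convolving a sequence \<open>g\<close> with \<open>s\<close> multiplies its average by \<open>n\<close>, up to
  lower order terms. If the Laplace transform of \<open>g\<close> is asymptotic to \<open>c * t powr (- b)\<close>, Karamata's Tauberian
  theorem for the \<open>k\<close>-fold convolutions therefore determines the moments of \<open>L\<close> of orders \<open>k * a\<close>, and those of orders
  \<open>b + k * a\<close> in terms of the average of \<open>g\<close>. Moments are log-convex in their order, and \<open>Gamma\<close> is
  asymptotically log-linear, so as \<open>k\<close> grows the interpolation leaves only one possible value, as in the
  Bohr-Mollerup theorem: the average of \<open>g\<close> is asymptotic to \<open>c * \<alpha> powr (- b)\<close>.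

  For \<open>\<mu>\<^sub>0 < 1\<close> and \<open>\<mu>\<^sub>0 > 1\<close> this applies to \<open>g = d\<close>. For \<open>\<mu>\<^sub>0 = 1\<close> the
  partial sums of \<open>d\<close> grow like \<open>A (-1) * x * ln x\<close>, and the first moment of \<open>L\<close> suffices; the finite part
  is of lower order than \<open>ln \<alpha>\<close>.
\<close>

section \<open>Asymptotics of the Gamma function and Laplace transforms\<close>

text \<open>After scaling by \<open>n powr (1 / a)\<close> the moments of orders
  \<open>k * a\<close> tend to \<open>Gamma (k * a + 1) / C ^ k\<close>, those of an exponential
  variable. This does not simply identify the law: they are integer moments of the
  \<open>a\<close>-th power of that variable, and for \<open>a > 2\<close> such a power is not
  determined by its integer moments. The way out is that the moments of orders
  \<open>b + k * a\<close> all carry the same unknown factor, the normalised average of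
  \<open>g\<close>. Log-convexity between \<open>k * a\<close> and \<open>(k + 1) * a\<close> bounds
  this factor above, and log-convexity between \<open>b + k * a\<close> and
  \<open>b + (k + 1) * a\<close> bounds it below. The bounds meet as \<open>k\<close> grows, so
  \<open>n\<close> tends to infinity first and \<open>k\<close> afterwards.

  The later terms of the theta expansion serve to continue the Dirichlet series. As
  \<open>zeta_seq\<close> is a definite description, existence and uniqueness of the continuation
  have to be established before its value at 1 can be identified with a convergent sum.\<close>

lemma tendsto_at_right_0_cong:
  fixes f g :: "real \<Rightarrow> 'a :: topological_space"
  assumes "(f \<longlongrightarrow> l) (at_right 0)" "\<And>t. t > 0 \<Longrightarrow> f t = g t"
  shows "(g \<longlongrightarrow> l) (at_right 0)"
  by (rule Lim_transform_eventually[OF assms(1)])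
     (use eventually_at_right_less[of "0::real"] assms(2) in \<open>auto elim!: eventually_mono\<close>)

lemma tendsto_powr_rescale:
  fixes f :: "real \<Rightarrow> real"
  assumes "((\<lambda>t. t powr b * f t) \<longlongrightarrow> c) (at_right 0)" and q: "q > 0"
  shows "((\<lambda>t. t powr b * f (q * t)) \<longlongrightarrow> q powr (- b) * c) (at_right 0)"
proof (rule tendsto_at_right_0_cong)
  have "filterlim (\<lambda>t. q * t) (at_right 0) (at_right 0)" using q by real_asymp
  from filterlim_compose[OF assms(1) this]
  show "((\<lambda>t. q powr (- b) * ((q * t) powr b * f (q * t))) \<longlongrightarrow> q powr (- b) * c) (at_right 0)"
    by (intro tendsto_mult_left)
  show "q powr (- b) * ((q * t) powr b * f (q * t)) = t powr b * f (q * t)" if "t > 0" for t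
    using that q by (simp add: powr_mult powr_minus)
qed

lemma Gamma_real_log_convex:
  fixes x y u :: real
  assumes "x > 0" "y > 0" "0 \<le> u" "u \<le> 1"
  shows "Gamma ((1 - u) * x + u * y) \<le> Gamma x powr (1 - u) * Gamma y powr u"
proof -
  have convex: "ln (Gamma ((1 - u) * x + u * y)) \<le> (1 - u) * ln (Gamma x) + u * ln (Gamma y)"
    using convex_onD[OF log_convex_Gamma_real, of u x y] assms by simp
  have "(1 - u) * x + u * y > 0"
    using assms by (cases "u = 0") (auto intro: add_nonneg_pos)
  then have "Gamma ((1 - u) * x + u * y) > 0" by (rule Gamma_real_pos)
  then have "Gamma ((1 - u) * x + u * y) = exp (ln (Gamma ((1 - u) * x + u * y)))" by simp
  also have "\<dots> \<le> exp ((1 - u) * ln (Gamma x) + u * ln (Gamma y))"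
    using convex by (simp only: exp_le_cancel_iff)
  also have "\<dots> = Gamma x powr (1 - u) * Gamma y powr u"
    using Gamma_real_pos[OF assms(1)] Gamma_real_pos[OF assms(2)] by (simp add: powr_def exp_add)
  finally show ?thesis .
qed

text \<open>Wendel's squeeze. Log-convexity between \<open>z\<close> and \<open>z + 1\<close> gives
  the upper bound; between \<open>z + x\<close> and \<open>z + x + 1\<close>, with
  \<open>z + 1\<close> as the intermediate point, it gives the lower bound
  \<open>(z / (z + x)) powr (1 - x)\<close>, which tends to 1.\<close>

lemma tendsto_Gamma_ratio_unit:
  fixes x :: real
  assumes x: "0 \<le> x" "x \<le> 1"
  shows "((\<lambda>z. Gamma (z + x) / (Gamma z * z powr x)) \<longlongrightarrow> 1) at_top"
proof (rule tendsto_sandwich)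
  show "\<forall>\<^sub>F z in at_top. (z + x) powr (x - 1) * z powr (1 - x) \<le> Gamma (z + x) / (Gamma z * z powr x)"
    using eventually_gt_at_top[of 0]
  proof eventually_elim
    case (elim z)
    have pos: "Gamma z > 0" "Gamma (z + x) > 0" using elim x by (auto intro!: Gamma_real_pos)
    have "z * Gamma z = Gamma ((1 - (1 - x)) * (z + x) + (1 - x) * (z + x + 1))"
      using elim Gamma_plus1[of z] by (simp add: algebra_simps nonpos_Ints_def)
    also have "\<dots> \<le> Gamma (z + x) powr (1 - (1 - x)) * Gamma (z + x + 1) powr (1 - x)"
      using x elim by (intro Gamma_real_log_convex) auto
    also have "Gamma (z + x + 1) = (z + x) * Gamma (z + x)"
      using elim x by (intro Gamma_plus1) (auto simp: nonpos_Ints_def)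
    also have "Gamma (z + x) powr (1 - (1 - x)) * ((z + x) * Gamma (z + x)) powr (1 - x)
       = Gamma (z + x) * (z + x) powr (1 - x)"
      using elim x pos by (simp add: powr_mult powr_diff)
    finally have "z * Gamma z \<le> Gamma (z + x) * (z + x) powr (1 - x)" .
    moreover have one: "(z + x) powr (x - 1) * (z + x) powr (1 - x) = 1"
      using elim x by (simp flip: powr_add)
    moreover have "z powr (1 - x) * z powr x = z"
      using elim by (simp flip: powr_add)
    ultimately have "(z + x) powr (x - 1) * z powr (1 - x) * (Gamma z * z powr x)
        \<le> (z + x) powr (x - 1) * (Gamma (z + x) * (z + x) powr (1 - x))"
      using mult_left_mono[of "z * Gamma z" "Gamma (z + x) * (z + x) powr (1 - x)" "(z + x) powr (x - 1)"]
      by (subst mult.commute[of "Gamma z"], subst mult.assoc, subst mult.assoc[symmetric, of "z powr (1 - x)"])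
         (simp add: mult_ac)
    also have "\<dots> = Gamma (z + x)" using one by (simp add: mult_ac)
    finally show ?case using pos elim by (simp add: pos_le_divide_eq)
  qed
  show "\<forall>\<^sub>F z in at_top. Gamma (z + x) / (Gamma z * z powr x) \<le> 1"
    using eventually_gt_at_top[of 0]
  proof eventually_elim
    case (elim z)
    have pos: "Gamma z > 0" using elim by auto
    have "Gamma (z + x) = Gamma ((1 - x) * z + x * (z + 1))" by (simp add: algebra_simps)
    also have "\<dots> \<le> Gamma z powr (1 - x) * Gamma (z + 1) powr x"
      using x elim by (intro Gamma_real_log_convex) auto
    also have "Gamma (z + 1) = z * Gamma z"
      using elim by (intro Gamma_plus1) (auto simp: nonpos_Ints_def)
    also have "Gamma z powr (1 - x) * (z * Gamma z) powr x = Gamma z * z powr x"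
      using elim pos by (simp add: powr_mult powr_diff)
    finally show ?case using pos elim by simp
  qed
  show "((\<lambda>z. (z + x) powr (x - 1) * z powr (1 - x)) \<longlongrightarrow> 1) at_top"
    by real_asymp
qed auto

text \<open>Integer shifts follow from the functional equation: raising the exponent from
  \<open>y\<close> to \<open>y + 1\<close> multiplies the ratio by \<open>(z + y) / z\<close>, which
  tends to 1. The induction starts from the fractional part of \<open>x\<close>.\<close>

lemma tendsto_Gamma_ratio:
  fixes x :: real
  assumes "0 \<le> x"
  shows "((\<lambda>z. Gamma (z + x) / (Gamma z * z powr x)) \<longlongrightarrow> 1) at_top"
proof -
  have "((\<lambda>z. Gamma (z + (x + real k)) / (Gamma z * z powr (x + real k))) \<longlongrightarrow> 1) at_top"
    if x: "0 \<le> x" "x \<le> 1" for x :: real and k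
  proof (induction k)
    case 0
    show ?case using tendsto_Gamma_ratio_unit[OF x] by simp
  next
    case (Suc k)
    have "((\<lambda>z. (z + (x + real k)) / z) \<longlongrightarrow> 1) at_top" by real_asymp
    from tendsto_mult[OF Suc this]
    have "((\<lambda>z. Gamma (z + (x + real k)) / (Gamma z * z powr (x + real k)) * ((z + (x + real k)) / z)) \<longlongrightarrow> 1) at_top"
      by simp
    moreover have "\<forall>\<^sub>F z in at_top. Gamma (z + (x + real k)) / (Gamma z * z powr (x + real k)) * ((z + (x + real k)) / z)
       = Gamma (z + (x + real (Suc k))) / (Gamma z * z powr (x + real (Suc k)))"
      using eventually_gt_at_top[of 0]
    proof eventually_elim
      case (elim z)
      have eq: "z + (x + real (Suc k)) = (z + (x + real k)) + 1" by simp
      have "Gamma (z + (x + real (Suc k))) = (z + (x + real k)) * Gamma (z + (x + real k))"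
        unfolding eq using elim x by (intro Gamma_plus1) (auto simp: nonpos_Ints_def)
      moreover have "z powr (x + real (Suc k)) = z powr (x + real k) * z"
        using elim by (simp add: powr_add algebra_simps powr_mult_base)
      ultimately show ?case by (simp add: field_simps)
    qed
    ultimately show ?case by (rule Lim_transform_eventually)
  qed
  from this[of "frac x" "nat \<lfloor>x\<rfloor>"] have
    "((\<lambda>z. Gamma (z + (frac x + real (nat \<lfloor>x\<rfloor>))) / (Gamma z * z powr (frac x + real (nat \<lfloor>x\<rfloor>)))) \<longlongrightarrow> 1) at_top"
    by (simp add: frac_ge_0 frac_lt_1 less_imp_le)
  moreover have "frac x + real (nat \<lfloor>x\<rfloor>) = x" using assms by (simp add: frac_def)
  ultimately show ?thesis by simp
qed


section \<open>Laplace transforms of nonnegative sequences\<close>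

definition laplace :: "(nat \<Rightarrow> real) \<Rightarrow> real \<Rightarrow> real" where
  "laplace g t = (\<Sum>l. g l * exp (- (t * real l)))"

definition laplace_asymp :: "(nat \<Rightarrow> real) \<Rightarrow> real \<Rightarrow> real \<Rightarrow> bool" where
  "laplace_asymp g c b \<longleftrightarrow> (\<forall>l. 0 \<le> g l) \<and>
     (\<forall>t>0. summable (\<lambda>l. g l * exp (- (t * real l)))) \<and>
     ((\<lambda>t. t powr b * laplace g t) \<longlongrightarrow> c) (at_right 0)"

definition gamma_kernel :: "real \<Rightarrow> real \<Rightarrow> real" where
  "gamma_kernel b v = indicator {0<..} v * (v powr (b - 1) * exp (- v))"

lemma gamma_kernel_nonneg: "gamma_kernel b v \<ge> 0"
  by (simp add: gamma_kernel_def)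

lemma gamma_kernel_measurable [measurable]: "gamma_kernel b \<in> borel_measurable borel"
  unfolding gamma_kernel_def by measurable

lemma has_bochner_integral_gamma_kernel:
  assumes "b > 0"
  shows "has_bochner_integral lborel (gamma_kernel b) (Gamma b)"
proof (rule has_bochner_integral_nn_integral)
  have "(\<integral>\<^sup>+v. ennreal (gamma_kernel b v) \<partial>lborel) =
      (\<integral>\<^sup>+v. ennreal (indicator {0..} v * v powr (b - 1) / exp v) \<partial>lborel)"
    by (intro nn_integral_cong arg_cong[of _ _ ennreal])
       (auto simp: gamma_kernel_def indicator_def exp_minus field_simps)
  then show "(\<integral>\<^sup>+v. ennreal (gamma_kernel b v) \<partial>lborel) = ennreal (Gamma b)"
    using Gamma_conv_nn_integral_real[OF assms] by simp
  show "0 \<le> Gamma b" using assms by (simp add: Gamma_real_pos less_imp_le)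
qed (auto simp: gamma_kernel_nonneg)

text \<open>Substituting \<open>(m + 1) * v\<close> for \<open>v\<close> absorbs the power of
  \<open>exp (- v)\<close>. The factor \<open>(m + 1) powr (- b)\<close> is the one that appears
  when a Laplace transform is evaluated at \<open>(m + 1) * t\<close>.\<close>

lemma has_bochner_integral_gamma_kernel_power:
  assumes "b > 0"
  shows "has_bochner_integral lborel (\<lambda>v. gamma_kernel b v * exp (- v) ^ m)
           (Gamma b * real (m + 1) powr (- b))"
proof -
  define q where "q = real (m + 1)"
  have q: "q > 0" by (simp add: q_def)
  have "has_bochner_integral lborel (\<lambda>v. gamma_kernel b (0 + q * v)) (Gamma b /\<^sub>R \<bar>q\<bar>)"
    using has_bochner_integral_gamma_kernel[OF assms] q
    by (subst (asm) lborel_has_bochner_integral_real_affine_iff[of q _ _ 0]) auto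
  from has_bochner_integral_mult_right[OF this, of "q powr (1 - b)"]
  have "has_bochner_integral lborel (\<lambda>v. q powr (1 - b) * gamma_kernel b (q * v))
      (q powr (1 - b) * (Gamma b / q))"
    using q by (simp add: divide_inverse_commute)
  moreover have "q powr (1 - b) * (Gamma b / q) = Gamma b * real (m + 1) powr (- b)"
    using q unfolding q_def[symmetric] by (simp add: powr_diff powr_minus field_simps)
  moreover have "q powr (1 - b) * gamma_kernel b (q * v) = gamma_kernel b v * exp (- v) ^ m" for v
  proof (cases "v > 0")
    case True
    have "q powr (1 - b) * q powr (b - 1) = 1" using q by (simp flip: powr_add)
    then have "q powr (1 - b) * (q * v) powr (b - 1) = v powr (b - 1)"
      using q True by (simp add: powr_mult)
    moreover have "exp (- (q * v)) = exp (- v) * exp (- v) ^ m"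
      by (simp add: q_def flip: exp_of_nat_mult exp_add) (simp add: algebra_simps)
    ultimately show ?thesis using q True by (simp add: gamma_kernel_def mult_ac)
  next
    case False
    then show ?thesis using q by (auto simp: gamma_kernel_def zero_less_mult_iff)
  qed
  ultimately show ?thesis by simp
qed

context
  fixes g :: "nat \<Rightarrow> real" and b c :: real
  assumes g: "laplace_asymp g c b" and b: "b > 0"
begin

text \<open>Integral of \<open>H\<close> against the measure with mass
  \<open>t powr b * g l * exp (- (t * real l))\<close> at the point
  \<open>exp (- (t * real l))\<close>. The substitution \<open>y = exp (- v)\<close> moves the
  half-line into a compact interval, where polynomials are dense; \<open>gamma_test\<close> is the
  limit integral up to the factor \<open>c / Gamma b\<close>.\<close>

definition laplace_test :: "(real \<Rightarrow> real) \<Rightarrow> real \<Rightarrow> real" where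
  "laplace_test H t = t powr b * (\<Sum>l. g l * exp (- (t * real l)) * H (exp (- (t * real l))))"

definition gamma_test :: "(real \<Rightarrow> real) \<Rightarrow> real" where
  "gamma_test H = (\<integral>v. gamma_kernel b v * H (exp (- v)) \<partial>lborel)"

lemma laplace_summable: "t > 0 \<Longrightarrow> summable (\<lambda>l. g l * exp (- (t * real l)))"
  and g_nonneg: "g l \<ge> 0"
  and laplace_limit: "((\<lambda>t. t powr b * laplace g t) \<longlongrightarrow> c) (at_right 0)"
  using g by (auto simp: laplace_asymp_def)

lemma laplace_test_summable:
  assumes "t > 0" "\<And>y. y \<in> {0..1} \<Longrightarrow> \<bar>H y\<bar> \<le> B"
  shows "summable (\<lambda>l. g l * exp (- (t * real l)) * H (exp (- (t * real l))))"
proof (rule summable_comparison_test', rule summable_mult)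
  show "summable (\<lambda>l. g l * exp (- (t * real l)))" using laplace_summable assms by simp
  show "norm (g l * exp (- (t * real l)) * H (exp (- (t * real l)))) \<le> B * (g l * exp (- (t * real l)))" for l
    using assms(2)[of "exp (- (t * real l))"] assms(1) g_nonneg[of l]
    by (simp add: abs_mult) (smt (verit) mult_left_mono exp_ge_zero mult_nonneg_nonneg mult.commute)
qed

text \<open>The measure behind \<open>laplace_test\<close> has total mass
  \<open>t powr b * laplace g t\<close>, which converges as \<open>t\<close> tends to 0, so a
  uniformly small error in \<open>H\<close> stays small.\<close>

lemma laplace_test_diff:
  assumes "t > 0" "\<And>y. y \<in> {0..1} \<Longrightarrow> \<bar>H y\<bar> \<le> B" "\<And>y. y \<in> {0..1} \<Longrightarrow> \<bar>H' y\<bar> \<le> B'"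
    and "\<And>y. y \<in> {0..1} \<Longrightarrow> \<bar>H y - H' y\<bar> \<le> d"
  shows "\<bar>laplace_test H t - laplace_test H' t\<bar> \<le> d * (t powr b * laplace g t)"
proof -
  let ?e = "\<lambda>l. exp (- (t * real l))"
  have s: "summable (\<lambda>l. g l * ?e l * (H (?e l) - H' (?e l)))"
    using summable_diff[OF laplace_test_summable[OF assms(1,2)] laplace_test_summable[OF assms(1,3)]]
    by (simp add: right_diff_distrib)
  have b: "\<bar>g l * ?e l * (H (?e l) - H' (?e l))\<bar> \<le> d * (g l * ?e l)" for l
    using assms(4)[of "?e l"] assms(1) g_nonneg[of l]
    by (simp add: abs_mult) (smt (verit) mult_left_mono exp_ge_zero mult_nonneg_nonneg mult.commute)
  have s': "summable (\<lambda>l. \<bar>g l * ?e l * (H (?e l) - H' (?e l))\<bar>)"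
    by (rule summable_comparison_test', rule summable_mult[OF laplace_summable[OF assms(1)], of d])
       (use b in simp)
  have "(\<Sum>l. g l * ?e l * H (?e l)) - (\<Sum>l. g l * ?e l * H' (?e l)) = (\<Sum>l. g l * ?e l * (H (?e l) - H' (?e l)))"
    using suminf_diff[OF laplace_test_summable[OF assms(1,2)] laplace_test_summable[OF assms(1,3)]]
    by (simp add: right_diff_distrib)
  moreover have "\<bar>\<Sum>l. g l * ?e l * (H (?e l) - H' (?e l))\<bar> \<le> (\<Sum>l. \<bar>g l * ?e l * (H (?e l) - H' (?e l))\<bar>)"
    by (rule summable_rabs[OF s'])
  moreover have "\<dots> \<le> (\<Sum>l. d * (g l * ?e l))"
    by (intro suminf_le b s' summable_mult laplace_summable assms(1))
  moreover have "\<dots> = d * laplace g t"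
    unfolding laplace_def by (rule suminf_mult[OF laplace_summable[OF assms(1)]])
  ultimately have "\<bar>(\<Sum>l. g l * ?e l * H (?e l)) - (\<Sum>l. g l * ?e l * H' (?e l))\<bar> \<le> d * laplace g t" by linarith
  from mult_left_mono[OF this, of "t powr b"] show ?thesis
    by (simp add: laplace_test_def abs_mult mult_ac flip: right_diff_distrib)
qed

lemma gamma_test_integrable:
  assumes [measurable]: "H \<in> borel_measurable borel" and "\<And>y. y \<in> {0..1} \<Longrightarrow> \<bar>H y\<bar> \<le> B"
  shows "integrable lborel (\<lambda>v. gamma_kernel b v * H (exp (- v)))"
proof (rule Bochner_Integration.integrable_bound)
  show "integrable lborel (\<lambda>v. B * gamma_kernel b v)"
    using has_bochner_integral_gamma_kernel[OF b] by (auto simp: has_bochner_integral_iff)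
  show "AE v in lborel. norm (gamma_kernel b v * H (exp (- v))) \<le> norm (B * gamma_kernel b v)"
  proof (rule AE_I2)
    fix v :: real
    have "\<bar>H (exp (- v))\<bar> \<le> B" if "v > 0" using assms(2)[of "exp (- v)"] that by simp
    moreover have "B \<ge> 0" using assms(2)[of 0] by simp
    moreover have "gamma_kernel b v = 0" if "\<not> v > 0" using that by (simp add: gamma_kernel_def)
    ultimately show "norm (gamma_kernel b v * H (exp (- v))) \<le> norm (B * gamma_kernel b v)"
      using mult_left_mono[of "\<bar>H (exp (- v))\<bar>" B "gamma_kernel b v"] gamma_kernel_nonneg[of b v]
      by (cases "v > 0") (simp_all add: abs_mult mult.commute)
  qed
qed measurable

lemma gamma_test_diff:
  assumes [measurable]: "H \<in> borel_measurable borel" "H' \<in> borel_measurable borel"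
    and "\<And>y. y \<in> {0..1} \<Longrightarrow> \<bar>H y\<bar> \<le> B" "\<And>y. y \<in> {0..1} \<Longrightarrow> \<bar>H' y\<bar> \<le> B'"
    and "\<And>y. y \<in> {0..1} \<Longrightarrow> \<bar>H y - H' y\<bar> \<le> d"
  shows "\<bar>gamma_test H - gamma_test H'\<bar> \<le> d * Gamma b"
proof -
  note i = gamma_test_integrable[OF assms(1,3)] gamma_test_integrable[OF assms(2,4)]
  have "gamma_test H - gamma_test H' = (\<integral>v. gamma_kernel b v * H (exp (- v)) - gamma_kernel b v * H' (exp (- v)) \<partial>lborel)"
    unfolding gamma_test_def using i by simp
  also have "\<bar>\<dots>\<bar> \<le> (\<integral>v. d * gamma_kernel b v \<partial>lborel)"
  proof (rule integral_abs_bound_integral)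
    show "integrable lborel (\<lambda>v. d * gamma_kernel b v)"
      using has_bochner_integral_gamma_kernel[OF b] by (auto simp: has_bochner_integral_iff)
    fix v :: real
    show "\<bar>gamma_kernel b v * H (exp (- v)) - gamma_kernel b v * H' (exp (- v))\<bar> \<le> d * gamma_kernel b v"
    proof (cases "v > 0")
      case True
      then have "\<bar>H (exp (- v)) - H' (exp (- v))\<bar> \<le> d" using assms(5)[of "exp (- v)"] by simp
      from mult_left_mono[OF this gamma_kernel_nonneg[of b v]] show ?thesis
        by (simp add: abs_mult gamma_kernel_nonneg mult.commute flip: right_diff_distrib)
    qed (simp add: gamma_kernel_def)
  qed (use i in simp)
  also have "\<dots> = d * Gamma b"
    using has_bochner_integral_gamma_kernel[OF b] by (auto simp: has_bochner_integral_iff)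
  finally show ?thesis .
qed

text \<open>The factor \<open>exp (- (t * real l))\<close> in the measure makes the test with
  \<open>y ^ m\<close> a Laplace transform at \<open>(m + 1) * t\<close>. The single limit
  hypothesis thus yields all moments of the measures.\<close>

lemma laplace_test_power:
  "((\<lambda>t. laplace_test (\<lambda>y. y ^ m) t) \<longlongrightarrow> c / Gamma b * gamma_test (\<lambda>y. y ^ m)) (at_right 0)"
proof -
  define q where "q = real (m + 1)"
  have q: "q > 0" by (simp add: q_def)
  have "((\<lambda>t. laplace_test (\<lambda>y. y ^ m) t) \<longlongrightarrow> q powr (- b) * c) (at_right 0)"
  proof (rule tendsto_at_right_0_cong[OF tendsto_powr_rescale[OF laplace_limit q]])
    fix t :: real
    have "exp (- (q * t * real l)) = exp (- (t * real l)) * exp (- (t * real l)) ^ m" for l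
      by (simp add: q_def flip: exp_of_nat_mult exp_add) (simp add: algebra_simps)
    then show "t powr b * laplace g (q * t) = laplace_test (\<lambda>y. y ^ m) t"
      unfolding laplace_test_def laplace_def by (simp add: mult.assoc[symmetric])
  qed
  moreover have "gamma_test (\<lambda>y. y ^ m) = Gamma b * q powr (- b)"
    using has_bochner_integral_gamma_kernel_power[OF b, of m]
    by (auto simp: has_bochner_integral_iff gamma_test_def q_def)
  ultimately show ?thesis using Gamma_real_pos[OF b] by (simp add: mult.commute)
qed

lemma laplace_test_poly:
  "((\<lambda>t. laplace_test (\<lambda>y. \<Sum>i\<le>n. a i * y ^ i) t) \<longlongrightarrow> c / Gamma b * gamma_test (\<lambda>y. \<Sum>i\<le>n. a i * y ^ i)) (at_right 0)"
proof -
  have pow: "\<bar>y ^ i\<bar> \<le> 1" if "y \<in> {0..1}" for y :: real and i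
    using that by (simp add: power_le_one)
  have "gamma_test (\<lambda>y. \<Sum>i\<le>n. a i * y ^ i) = (\<integral>v. (\<Sum>i\<le>n. a i * (gamma_kernel b v * exp (- v) ^ i)) \<partial>lborel)"
    unfolding gamma_test_def by (simp add: sum_distrib_left mult_ac)
  also have "\<dots> = (\<Sum>i\<le>n. a i * gamma_test (\<lambda>y. y ^ i))"
    unfolding gamma_test_def
    by (subst Bochner_Integration.integral_sum) (auto intro!: integrable_mult_right gamma_test_integrable[OF _ pow])
  finally have 1: "gamma_test (\<lambda>y. \<Sum>i\<le>n. a i * y ^ i) = (\<Sum>i\<le>n. a i * gamma_test (\<lambda>y. y ^ i))" .
  have 2: "\<forall>\<^sub>F t in at_right 0. (\<Sum>i\<le>n. a i * laplace_test (\<lambda>y. y ^ i) t) = laplace_test (\<lambda>y. \<Sum>i\<le>n. a i * y ^ i) t"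
    using eventually_at_right_less[of "0::real"]
  proof eventually_elim
    case (elim t)
    let ?e = "\<lambda>l. exp (- (t * real l))"
    have "(\<Sum>l. g l * ?e l * (\<Sum>i\<le>n. a i * ?e l ^ i)) = (\<Sum>l. \<Sum>i\<le>n. a i * (g l * ?e l * ?e l ^ i))"
      by (simp add: sum_distrib_left mult_ac)
    also have "\<dots> = (\<Sum>i\<le>n. \<Sum>l. a i * (g l * ?e l * ?e l ^ i))"
      by (intro suminf_sum summable_mult laplace_test_summable[OF elim pow])
    also have "\<dots> = (\<Sum>i\<le>n. a i * (\<Sum>l. g l * ?e l * ?e l ^ i))"
      by (intro sum.cong refl suminf_mult laplace_test_summable[OF elim pow])
    finally show ?case by (simp add: laplace_test_def sum_distrib_left mult_ac)
  qed
  have "((\<lambda>t. \<Sum>i\<le>n. a i * laplace_test (\<lambda>y. y ^ i) t) \<longlongrightarrow> (\<Sum>i\<le>n. a i * (c / Gamma b * gamma_test (\<lambda>y. y ^ i)))) (at_right 0)"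
    by (intro tendsto_sum tendsto_mult_left laplace_test_power)
  from Lim_transform_eventually[OF this 2] show ?thesis
    by (simp add: 1 sum_distrib_left mult_ac)
qed

end

section \<open>Karamata's Tauberian theorem\<close>

lemma continuous_on_unit_interval_bounded:
  fixes H :: "real \<Rightarrow> real"
  assumes "continuous_on {0..1} H"
  obtains B where "\<And>y. y \<in> {0..1} \<Longrightarrow> \<bar>H y\<bar> \<le> B"
proof -
  have "bounded (H ` {0..1})"
    using assms by (intro compact_imp_bounded compact_continuous_image) auto
  then obtain B where "\<forall>y\<in>H ` {0..1}. norm y \<le> B" unfolding bounded_iff by blast
  then show ?thesis by (intro that[of B]) auto
qed

lemma has_bochner_integral_powr:
  fixes r b :: real
  assumes b: "b > 0" and r: "r > 0"
  shows "has_bochner_integral lborel (\<lambda>v. indicator {0<..r} v * v powr (b - 1)) (r powr b / b)"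
proof (rule has_bochner_integral_nn_integral)
  have "((\<lambda>v. v powr (b - 1)) has_integral (r powr b / b)) {0..r}"
    using has_integral_powr_from_0[of "b - 1" r] b r by simp
  then have "(\<integral>\<^sup>+v. ennreal (indicator {0..r} v * v powr (b - 1)) \<partial>lborel) = ennreal (r powr b / b)"
    by (intro nn_integral_has_integral_lebesgue) auto
  moreover have "(\<integral>\<^sup>+v. ennreal (indicator {0<..r} v * v powr (b - 1)) \<partial>lborel)
      = (\<integral>\<^sup>+v. ennreal (indicator {0..r} v * v powr (b - 1)) \<partial>lborel)"
    by (intro nn_integral_cong arg_cong[of _ _ ennreal]) (auto simp: indicator_def)
  ultimately show "(\<integral>\<^sup>+v. ennreal (indicator {0<..r} v * v powr (b - 1)) \<partial>lborel) = ennreal (r powr b / b)" by simp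
qed (use b r in auto)

context
  fixes g :: "nat \<Rightarrow> real" and b c :: real
  assumes g: "laplace_asymp g c b" and b: "b > 0"
begin

lemma laplace_asymp_const_nonneg: "c \<ge> 0"
proof (rule tendsto_lowerbound[OF laplace_limit[OF g b]])
  show "\<forall>\<^sub>F t in at_right 0. 0 \<le> t powr b * laplace g t"
    unfolding laplace_def
    using eventually_at_right_less[of "0::real"]
    by eventually_elim (intro mult_nonneg_nonneg suminf_nonneg laplace_summable[OF g b] g_nonneg[OF g b], auto)
qed simp

lemma laplace_test_continuous:
  assumes [measurable]: "H \<in> borel_measurable borel" and H: "continuous_on {0..1} H"
  shows "((\<lambda>t. laplace_test g b H t) \<longlongrightarrow> c / Gamma b * gamma_test b H) (at_right 0)"
proof (rule tendstoI)
  fix \<epsilon> :: real assume \<epsilon>: "\<epsilon> > 0"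
  \<comment> \<open>A third of \<open>\<epsilon>\<close> is allotted to each of three errors: the
    limit for the polynomial \<open>q\<close>, and the replacement of \<open>H\<close> by
    \<open>q\<close> on either side, bounded by \<open>d * c\<close> or by a quantity tending to it.
    The summand 3 covers \<open>c = 0\<close>.\<close>
  define d where "d = \<epsilon> / (3 * c + 3)"
  have d: "d > 0" "d * c < \<epsilon> / 3" using \<epsilon> laplace_asymp_const_nonneg by (auto simp: d_def field_simps)
  obtain q where q: "real_polynomial_function q" "\<And>y. y \<in> {0..1} \<Longrightarrow> \<bar>H y - q y\<bar> < d"
    using Stone_Weierstrass_real_polynomial_function[of "{0..1::real}" H d] H d by auto
  obtain a n where an: "q = (\<lambda>y. \<Sum>i\<le>n. a i * y ^ i)"
    using q(1) by (auto simp: real_polynomial_function_iff_sum)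
  have cq: "continuous_on UNIV q" unfolding an by (intro continuous_intros)
  then have [measurable]: "q \<in> borel_measurable borel" by (rule borel_measurable_continuous_onI)
  obtain B where B: "\<And>y. y \<in> {0..1} \<Longrightarrow> \<bar>H y\<bar> \<le> B"
    using continuous_on_unit_interval_bounded[OF H] by blast
  obtain B' where B': "\<And>y. y \<in> {0..1} \<Longrightarrow> \<bar>q y\<bar> \<le> B'"
    using continuous_on_unit_interval_bounded[OF continuous_on_subset[OF cq]] by blast
  have le: "\<bar>H y - q y\<bar> \<le> d" if "y \<in> {0..1}" for y using q(2)[OF that] by simp
  have "\<bar>gamma_test b H - gamma_test b q\<bar> \<le> d * Gamma b"
    by (rule gamma_test_diff[OF g b _ _ B B' le]) auto
  moreover have cG: "c / Gamma b \<ge> 0"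
    using laplace_asymp_const_nonneg Gamma_real_pos[OF b] by simp
  ultimately have "c / Gamma b * \<bar>gamma_test b H - gamma_test b q\<bar> \<le> c / Gamma b * (d * Gamma b)"
    by (rule mult_left_mono)
  moreover have cancel: "c / Gamma b * (d * Gamma b) = d * c"
    using Gamma_real_pos[OF b] by simp
  ultimately have 1: "\<bar>c / Gamma b * gamma_test b H - c / Gamma b * gamma_test b q\<bar> \<le> d * c"
    using cG by (metis abs_mult abs_of_nonneg right_diff_distrib mult.commute cancel)
  have "\<forall>\<^sub>F t in at_right 0. dist (laplace_test g b q t) (c / Gamma b * gamma_test b q) < \<epsilon> / 3"
    using laplace_test_poly[OF g b, of a n] \<epsilon> unfolding an[symmetric] by (intro tendstoD) auto
  moreover have "((\<lambda>t. d * (t powr b * laplace g t)) \<longlongrightarrow> d * c) (at_right 0)"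
    by (intro tendsto_mult_left laplace_limit[OF g b])
  then have "\<forall>\<^sub>F t in at_right 0. d * (t powr b * laplace g t) < \<epsilon> / 3"
    using d(2) by (rule order_tendstoD)
  ultimately show "\<forall>\<^sub>F t in at_right 0. dist (laplace_test g b H t) (c / Gamma b * gamma_test b H) < \<epsilon>"
    using eventually_at_right_less[of "0::real"]
  proof eventually_elim
    case (elim t)
    have "\<bar>laplace_test g b H t - laplace_test g b q t\<bar> \<le> d * (t powr b * laplace g t)"
      by (rule laplace_test_diff[OF g b _ B B' le]) (use elim in auto)
    with elim(1,2) 1 d(2) show ?case unfolding dist_real_def by linarith
  qed
qed

text \<open>A continuous majorant of the indicator function of \<open>{0..1}\<close> that vanishes beyond \<open>1 + d\<close>,
  divided by \<open>exp (- v)\<close> and written in the variable \<open>y = exp (- v)\<close>.\<close>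

definition cutoff :: "real \<Rightarrow> real \<Rightarrow> real" where
  "cutoff d v = max 0 (min 1 ((1 + d - v) / d))"

definition cutoff_exp :: "real \<Rightarrow> real \<Rightarrow> real" where
  "cutoff_exp d y = cutoff d (- ln (max y (exp (- (1 + d))))) / max y (exp (- (1 + d)))"

text \<open>Clamping \<open>y\<close> at \<open>exp (- (1 + d))\<close> keeps the logarithm and the
  quotient continuous at \<open>y = 0\<close>. It does no harm, because the cutoff already vanishes
  for \<open>v\<close> beyond \<open>1 + d\<close>.\<close>

lemma cutoff_exp_eq: "d > 0 \<Longrightarrow> exp (- v) * cutoff_exp d (exp (- v)) = cutoff d v"
  by (cases "v \<le> 1 + d") (auto simp: cutoff_exp_def max_def cutoff_def zero_le_divide_iff)

lemma cutoff_bounds: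
  assumes "d > 0"
  shows "0 \<le> cutoff d v" "cutoff d v \<le> 1" "v \<le> 1 \<Longrightarrow> cutoff d v = 1" "v \<ge> 1 + d \<Longrightarrow> cutoff d v = 0"
  using assms by (auto simp: cutoff_def divide_nonpos_pos field_simps min_def max_def)

lemma continuous_cutoff_exp: "d > 0 \<Longrightarrow> continuous_on UNIV (cutoff_exp d)"
proof -
  assume "d > 0"
  moreover have "max y (exp (- (1 + d))) > 0" for y by (simp add: less_max_iff_disj)
  then have "max y (exp (- (1 + d))) \<noteq> 0" for y by (metis less_irrefl)
  ultimately show ?thesis unfolding cutoff_exp_def cutoff_def by (intro continuous_intros) auto
qed

text \<open>The division by \<open>y\<close> in \<open>cutoff_exp\<close> cancels the exponential in
  the Gamma kernel, which leaves integrals of \<open>v powr (b - 1)\<close> over bounded intervals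
  for comparison.\<close>

lemma gamma_test_cutoff:
  assumes d: "d > 0"
  shows "1 / b \<le> gamma_test b (cutoff_exp d)" "gamma_test b (cutoff_exp d) \<le> (1 + d) powr b / b"
proof -
  note [measurable] = borel_measurable_continuous_onI[OF continuous_cutoff_exp[OF d]]
  obtain B where B: "\<And>y. y \<in> {0..1} \<Longrightarrow> \<bar>cutoff_exp d y\<bar> \<le> B"
    using continuous_on_unit_interval_bounded[OF continuous_on_subset[OF continuous_cutoff_exp[OF d]]] by blast
  have i: "integrable lborel (\<lambda>v. gamma_kernel b v * cutoff_exp d (exp (- v)))"
    by (rule gamma_test_integrable[OF g b _ B]) auto
  have eq: "gamma_kernel b v * cutoff_exp d (exp (- v)) = indicator {0<..} v * v powr (b - 1) * cutoff d v" for v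
    using cutoff_exp_eq[OF d, of v] by (simp add: gamma_kernel_def mult.assoc)
  have "1 / b = (\<integral>v. indicator {0<..1} v * v powr (b - 1) \<partial>lborel)"
    using has_bochner_integral_powr[OF b, of 1] by (simp add: has_bochner_integral_iff)
  also have "\<dots> \<le> (\<integral>v. gamma_kernel b v * cutoff_exp d (exp (- v)) \<partial>lborel)"
  proof (rule integral_mono[OF _ i])
    show "integrable lborel (\<lambda>v. indicator {0<..1} v * v powr (b - 1))"
      using has_bochner_integral_powr[OF b, of 1] by (simp add: has_bochner_integral_iff)
    show "indicator {0<..1} v * v powr (b - 1) \<le> gamma_kernel b v * cutoff_exp d (exp (- v))" for v
      unfolding eq using cutoff_bounds[OF d, of v] by (auto simp: indicator_def)
  qed
  finally show "1 / b \<le> gamma_test b (cutoff_exp d)" unfolding gamma_test_def[OF g b] .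
  have "(\<integral>v. gamma_kernel b v * cutoff_exp d (exp (- v)) \<partial>lborel) \<le> (\<integral>v. indicator {0<..1 + d} v * v powr (b - 1) \<partial>lborel)"
  proof (rule integral_mono[OF i])
    show "integrable lborel (\<lambda>v. indicator {0<..1 + d} v * v powr (b - 1))"
      using has_bochner_integral_powr[OF b, of "1 + d"] d by (simp add: has_bochner_integral_iff)
    show "gamma_kernel b v * cutoff_exp d (exp (- v)) \<le> indicator {0<..1 + d} v * v powr (b - 1)" for v
      unfolding eq using cutoff_bounds[OF d, of v] mult_left_mono[of "cutoff d v" 1 "v powr (b - 1)"] by (auto simp: indicator_def)
  qed
  also have "\<dots> = (1 + d) powr b / b"
    using has_bochner_integral_powr[OF b, of "1 + d"] d by (simp add: has_bochner_integral_iff)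
  finally show "gamma_test b (cutoff_exp d) \<le> (1 + d) powr b / b" unfolding gamma_test_def[OF g b] .
qed

text \<open>At \<open>v = t * l\<close> the cutoff is 1 for \<open>l\<close> up to
  \<open>1 / t\<close> and 0 from \<open>(1 + d) / t\<close> on, so the smoothed sum lies between
  the corresponding sharp partial sums.\<close>

lemma laplace_test_cutoff:
  assumes d: "d > 0" and t: "t > 0"
  shows "real n \<le> 1 / t \<Longrightarrow> t powr b * (\<Sum>l\<le>n. g l) \<le> laplace_test g b (cutoff_exp d) t"
    and "real n \<ge> (1 + d) / t \<Longrightarrow> laplace_test g b (cutoff_exp d) t \<le> t powr b * (\<Sum>l\<le>n. g l)"
proof -
  have eq: "g l * exp (- (t * real l)) * cutoff_exp d (exp (- (t * real l))) = g l * cutoff d (t * real l)" for l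
    using cutoff_exp_eq[OF d, of "t * real l"] by (simp add: mult.assoc)
  obtain B where B: "\<And>y. y \<in> {0..1} \<Longrightarrow> \<bar>cutoff_exp d y\<bar> \<le> B"
    using continuous_on_unit_interval_bounded[OF continuous_on_subset[OF continuous_cutoff_exp[OF d]]] by blast
  have s: "summable (\<lambda>l. g l * cutoff d (t * real l))"
    using laplace_test_summable[OF g b t, of "cutoff_exp d" B] B unfolding eq by blast
  {
    assume n: "real n \<le> 1 / t"
    have "(\<Sum>l\<le>n. g l) = (\<Sum>l\<le>n. g l * cutoff d (t * real l))"
    proof (intro sum.cong refl)
      fix l assume "l \<in> {..n}"
      then have "t * real l \<le> t * (1 / t)" using n t by (intro mult_left_mono) auto
      then show "g l = g l * cutoff d (t * real l)" using t cutoff_bounds(3)[OF d, of "t * real l"] by simp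
    qed
    also have "\<dots> \<le> (\<Sum>l. g l * cutoff d (t * real l))"
      by (rule sum_le_suminf[OF s]) (auto intro!: mult_nonneg_nonneg g_nonneg[OF g b] cutoff_bounds[OF d])
    finally show "t powr b * (\<Sum>l\<le>n. g l) \<le> laplace_test g b (cutoff_exp d) t"
      unfolding laplace_test_def[OF g b] eq by (intro mult_left_mono) auto
  }
  {
    assume n: "real n \<ge> (1 + d) / t"
    have "(\<Sum>l. g l * cutoff d (t * real l)) = (\<Sum>l\<le>n. g l * cutoff d (t * real l))"
    proof (rule suminf_finite)
      fix l assume "l \<notin> {..n}"
      then have "t * ((1 + d) / t) \<le> t * real l" using n t by (intro mult_left_mono) auto
      then show "g l * cutoff d (t * real l) = 0" using t cutoff_bounds(4)[OF d, of "t * real l"] by simp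
    qed auto
    also have "\<dots> \<le> (\<Sum>l\<le>n. g l)"
      using cutoff_bounds[OF d] g_nonneg[OF g b] by (intro sum_mono mult_left_le) auto
    finally show "laplace_test g b (cutoff_exp d) t \<le> t powr b * (\<Sum>l\<le>n. g l)"
      unfolding laplace_test_def[OF g b] eq by (intro mult_left_mono) auto
  }
qed

text \<open>The choices \<open>t = 1 / n\<close> and \<open>t = (1 + d) / n\<close> bound the
  partial sum up to \<open>n\<close> from above and from below. In the limit each bound misses
  \<open>\<kappa>\<close> by at most a factor \<open>(1 + d) powr b\<close>, and \<open>d\<close> is
  arbitrary.\<close>

theorem karamata: "(\<lambda>n. (\<Sum>l\<le>n. g l) / real n powr b) \<longlonglongrightarrow> c / Gamma (b + 1)"
proof -
  define \<kappa> where "\<kappa> = c / Gamma (b + 1)"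
  have Gb: "Gamma (b + 1) = b * Gamma b" using b Gamma_plus1[of b] by (simp add: nonpos_Ints_def)
  have \<kappa>: "\<kappa> = c / Gamma b * (1 / b)" by (simp add: \<kappa>_def Gb mult.commute)
  have cG: "c / Gamma b \<ge> 0" using laplace_asymp_const_nonneg Gamma_real_pos[OF b] by simp
  define U where "U n = (\<Sum>l\<le>n. g l)" for n
  have lim: "((\<lambda>n. laplace_test g b (cutoff_exp d) (r / real n)) \<longlongrightarrow> c / Gamma b * gamma_test b (cutoff_exp d)) sequentially"
    if "d > 0" "r > 0" for d r
  proof (rule filterlim_compose[OF laplace_test_continuous])
    show "filterlim (\<lambda>n. r / real n) (at_right 0) sequentially" using that by real_asymp
  qed (use borel_measurable_continuous_onI[OF continuous_cutoff_exp[OF that(1)]]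
         continuous_on_subset[OF continuous_cutoff_exp[OF that(1)]] in auto)
  have upper: "\<forall>\<^sub>F n in sequentially. U n / real n powr b < u" if u: "u > \<kappa>" for u
  proof -
    have "((\<lambda>d. \<kappa> * (1 + d) powr b) \<longlongrightarrow> \<kappa> * (1 + 0) powr b) (at_right 0)"
      by (intro tendsto_intros) auto
    then have "\<forall>\<^sub>F d in at_right 0. \<kappa> * (1 + d) powr b < u"
      using u by (intro order_tendstoD(2)) auto
    with eventually_at_right_less[of "0::real"] have "\<forall>\<^sub>F d in at_right 0. d > 0 \<and> \<kappa> * (1 + d) powr b < u"
      by eventually_elim auto
    then obtain d where d: "d > 0" "\<kappa> * (1 + d) powr b < u"
      by (metis (mono_tags, lifting) eventually_happens' trivial_limit_at_right_real)
    have "c / Gamma b * gamma_test b (cutoff_exp d) \<le> c / Gamma b * ((1 + d) powr b / b)"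
      using gamma_test_cutoff(2)[OF d(1)] cG by (rule mult_left_mono)
    also have "\<dots> < u" using d(2) by (simp add: \<kappa>)
    finally have "\<forall>\<^sub>F n in sequentially. laplace_test g b (cutoff_exp d) (1 / real n) < u"
      using lim[OF d(1), of 1] by (intro order_tendstoD(2)[where y = "c / Gamma b * gamma_test b (cutoff_exp d)"]) auto
    with eventually_gt_at_top[of 0] show ?thesis
    proof eventually_elim
      case (elim n)
      have "(1 / real n) powr b * U n \<le> laplace_test g b (cutoff_exp d) (1 / real n)"
        unfolding U_def by (rule laplace_test_cutoff(1)[OF d(1)]) (use elim in auto)
      with elim show ?case by (simp add: powr_divide)
    qed
  qed
  have lower: "\<forall>\<^sub>F n in sequentially. U n / real n powr b > u" if u: "u < \<kappa>" for u
  proof -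
    have "((\<lambda>d. \<kappa> * (1 + d) powr (-b)) \<longlongrightarrow> \<kappa> * (1 + 0) powr (-b)) (at_right 0)"
      by (intro tendsto_intros) auto
    then have "\<forall>\<^sub>F d in at_right 0. \<kappa> * (1 + d) powr (-b) > u"
      using u by (intro order_tendstoD(1)) auto
    with eventually_at_right_less[of "0::real"] have "\<forall>\<^sub>F d in at_right 0. d > 0 \<and> \<kappa> * (1 + d) powr (-b) > u"
      by eventually_elim auto
    then obtain d where d: "d > 0" "\<kappa> * (1 + d) powr (-b) > u"
      by (metis (mono_tags, lifting) eventually_happens' trivial_limit_at_right_real)
    have "\<kappa> \<le> c / Gamma b * gamma_test b (cutoff_exp d)"
      unfolding \<kappa> using gamma_test_cutoff(1)[OF d(1)] cG by (rule mult_left_mono)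
    moreover have "u * (1 + d) powr b < \<kappa>" using d by (simp add: powr_minus field_simps)
    ultimately have "u * (1 + d) powr b < c / Gamma b * gamma_test b (cutoff_exp d)" by linarith
    then have "\<forall>\<^sub>F n in sequentially. laplace_test g b (cutoff_exp d) ((1 + d) / real n) > u * (1 + d) powr b"
      using lim[OF d(1), of "1 + d"] d by (intro order_tendstoD(1)[where y = "c / Gamma b * gamma_test b (cutoff_exp d)"]) auto
    with eventually_gt_at_top[of 0] show ?thesis
    proof eventually_elim
      case (elim n)
      have "laplace_test g b (cutoff_exp d) ((1 + d) / real n) \<le> ((1 + d) / real n) powr b * U n"
        unfolding U_def by (rule laplace_test_cutoff(2)[OF d(1)]) (use elim d in auto)
      also have "\<dots> = (1 + d) powr b * (U n / real n powr b)" using elim d by (simp add: powr_divide)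
      finally have "(1 + d) powr b * u < (1 + d) powr b * (U n / real n powr b)"
        using elim by (simp add: mult.commute)
      then show ?case using d by (subst (asm) mult_less_cancel_left_pos) auto
    qed
  qed
  show ?thesis
    unfolding \<kappa>_def[symmetric] U_def[symmetric] by (rule order_tendstoI) (use upper lower in auto)
qed

end

text \<open>At \<open>t = 1 / n\<close> every factor \<open>exp (- (t * l))\<close> with
  \<open>l \<le> n\<close> is at least \<open>exp (- 1)\<close>. This crude bound, unlike Karamata's
  theorem, covers \<open>b = 0\<close> and holds for every \<open>n\<close>.\<close>

lemma laplace_asymp_partial_sum_bound:
  assumes "laplace_asymp g c b"
  obtains K where "K \<ge> 0" "\<And>n. (\<Sum>l\<le>n. g l) \<le> K * (1 + real n powr b)"
proof -
  have inv: "filterlim (\<lambda>n. 1 / real n) (at_right 0) sequentially" by real_asymp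
  have lim: "(\<lambda>n. (1 / real n) powr b * laplace g (1 / real n)) \<longlonglongrightarrow> c"
    using filterlim_compose[of "\<lambda>t. t powr b * laplace g t" "nhds c" "at_right 0" "\<lambda>n. 1 / real n" sequentially] inv assms
    by (simp add: laplace_asymp_def)
  then have "Bseq (\<lambda>n. (1 / real n) powr b * laplace g (1 / real n))" by (intro convergent_imp_Bseq convergentI)
  then obtain B where B: "B > 0" "\<And>n. \<bar>(1 / real n) powr b * laplace g (1 / real n)\<bar> \<le> B"
    by (auto elim!: BseqE)
  \<comment> \<open>For \<open>n = 0\<close> the scale \<open>1 / real n\<close> degenerates to 0;
    the partial sum is then \<open>g 0\<close>, which therefore enters the constant.\<close>
  define K where "K = max (exp 1 * B) (g 0)"
  show ?thesis
  proof (rule that)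
    show "K \<ge> 0" using B(1) by (simp add: K_def le_max_iff_disj)
    show "(\<Sum>l\<le>n. g l) \<le> K * (1 + real n powr b)" for n
    proof (cases "n = 0")
      case True
      then show ?thesis using assms by (auto simp: K_def laplace_asymp_def le_max_iff_disj)
    next
      case False
      have "1 / real n > 0" using False by simp
      then have s: "summable (\<lambda>l. g l * exp (- (1 / real n * real l)))" and g: "\<And>l. g l \<ge> 0"
        using assms unfolding laplace_asymp_def by blast+
      have "(\<Sum>l\<le>n. g l) \<le> (\<Sum>l\<le>n. exp 1 * (g l * exp (- (1 / real n * real l))))"
      proof (rule sum_mono)
        fix l assume "l \<in> {..n}"
        then have "1 \<le> exp (1 + (- (1 / real n * real l)))" using False by (simp add: field_simps)
        then have "g l * 1 \<le> g l * exp (1 + (- (1 / real n * real l)))" using g by (intro mult_left_mono)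
        then show "g l \<le> exp 1 * (g l * exp (- (1 / real n * real l)))" unfolding exp_add by (simp add: mult_ac)
      qed
      also have "\<dots> \<le> exp 1 * laplace g (1 / real n)"
        unfolding laplace_def sum_distrib_left[symmetric] by (intro mult_left_mono sum_le_suminf s) (use g in auto)
      also have "laplace g (1 / real n) = real n powr b * ((1 / real n) powr b * laplace g (1 / real n))"
        using False by (simp add: powr_divide)
      also have "\<dots> \<le> real n powr b * B" using B(2)[of n] by (intro mult_left_mono) auto
      finally have "(\<Sum>l\<le>n. g l) \<le> exp 1 * B * real n powr b" by (simp add: mult_ac)
      also have "\<dots> \<le> K * real n powr b" by (intro mult_right_mono) (auto simp: K_def)
      also have "\<dots> \<le> K * (1 + real n powr b)" using B(1) by (intro mult_left_mono) (auto simp: K_def le_max_iff_disj)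
      finally show ?thesis .
    qed
  qed
qed

lemma laplace_asymp_convolution:
  assumes "laplace_asymp g c b" "laplace_asymp h c' b'"
  shows "laplace_asymp (\<lambda>n. \<Sum>i\<le>n. g i * h (n - i)) (c * c') (b + b')"
proof -
  have eq: "(\<Sum>i\<le>n. g i * h (n - i)) * exp (- (t * real n))
      = (\<Sum>i\<le>n. (g i * exp (- (t * real i))) * (h (n - i) * exp (- (t * real (n - i)))))" for n t
    unfolding sum_distrib_right
  proof (intro sum.cong refl)
    fix i assume "i \<in> {..n}"
    then have "exp (- (t * real n)) = exp (- (t * real i)) * exp (- (t * real (n - i)))"
      by (simp flip: exp_add add: of_nat_diff algebra_simps)
    then show "g i * h (n - i) * exp (- (t * real n)) = (g i * exp (- (t * real i))) * (h (n - i) * exp (- (t * real (n - i))))"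
      by (simp add: mult_ac)
  qed
  have nn: "\<And>l. g l \<ge> 0" "\<And>l. h l \<ge> 0" using assms by (auto simp: laplace_asymp_def)
  have s: "summable (\<lambda>l. norm (g l * exp (- (t * real l))))" "summable (\<lambda>l. norm (h l * exp (- (t * real l))))" if "t > 0" for t
    using assms that by (auto simp: laplace_asymp_def)
  have cauchy: "laplace (\<lambda>n. \<Sum>i\<le>n. g i * h (n - i)) t = laplace g t * laplace h t" if "t > 0" for t
    unfolding laplace_def eq using Cauchy_product[OF s[OF that]] by simp
  have "((\<lambda>t. (t powr b * laplace g t) * (t powr b' * laplace h t)) \<longlongrightarrow> c * c') (at_right 0)"
    using assms by (intro tendsto_mult) (auto simp: laplace_asymp_def)
  then have "((\<lambda>t. t powr (b + b') * laplace (\<lambda>n. \<Sum>i\<le>n. g i * h (n - i)) t) \<longlongrightarrow> c * c') (at_right 0)"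
    by (rule tendsto_at_right_0_cong) (simp add: cauchy powr_add mult_ac)
  moreover have "summable (\<lambda>l. (\<Sum>i\<le>l. g i * h (l - i)) * exp (- (t * real l)))" if "t > 0" for t
    unfolding eq by (rule summable_Cauchy_product[OF s[OF that]])
  ultimately show ?thesis using nn by (auto simp: laplace_asymp_def intro!: sum_nonneg mult_nonneg_nonneg)
qed

section \<open>Averages governed by a convolution recurrence\<close>

text \<open>The logarithm of \<open>Gamma\<close> is asymptotically linear on intervals of bounded
  length: relative to \<open>Gamma z\<close>, the powers of \<open>z\<close> in numerator and
  denominator cancel. Hence interpolation by log-convexity loses nothing in the limit.\<close>

lemma Gamma_interpolation:
  fixes a b :: real
  assumes "a > 0" "0 \<le> b" "b \<le> a"
  shows "((\<lambda>z. Gamma z powr (1 - b / a) * Gamma (z + a) powr (b / a) / Gamma (z + b)) \<longlongrightarrow> 1) at_top"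
proof -
  let ?H = "\<lambda>x z :: real. Gamma (z + x) / (Gamma z * z powr x)"
  have "((\<lambda>z. ?H a z powr (b / a) / ?H b z) \<longlongrightarrow> 1 powr (b / a) / 1) at_top"
    by (intro tendsto_intros tendsto_Gamma_ratio) (use assms in auto)
  moreover have "\<forall>\<^sub>F z in at_top. ?H a z powr (b / a) / ?H b z
      = Gamma z powr (1 - b / a) * Gamma (z + a) powr (b / a) / Gamma (z + b)"
    using eventually_gt_at_top[of 0]
  proof eventually_elim
    case (elim z)
    have pos: "Gamma z > 0" "Gamma (z + a) > 0" "Gamma (z + b) > 0" using elim assms by (auto intro!: Gamma_real_pos)
    have eq1: "?H a z powr (b / a) = Gamma (z + a) powr (b / a) / (Gamma z powr (b / a) * z powr b)"
      using pos elim assms by (simp add: powr_divide powr_mult powr_powr)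
    have eq2: "Gamma z powr (1 - b / a) = Gamma z / Gamma z powr (b / a)"
      using pos by (simp add: powr_diff)
    show ?case unfolding eq1 eq2 using pos elim by (simp add: field_simps)
  qed
  ultimately have "((\<lambda>z. Gamma z powr (1 - b / a) * Gamma (z + a) powr (b / a) / Gamma (z + b)) \<longlongrightarrow> 1 powr (b / a) / 1) at_top"
    by (rule Lim_transform_eventually)
  then show ?thesis by simp
qed

lemma young_powr:
  fixes x y u :: real
  assumes "x \<ge> 0" "y \<ge> 0" "0 < u" "u < 1"
  shows "x powr u * y powr (1 - u) \<le> u * x + (1 - u) * y"
proof (cases "x = 0 \<or> y = 0")
  case True
  then show ?thesis using assms by auto
next
  case False
  then have "exp (u * ln x + (1 - u) * ln y) \<le> u * exp (ln x) + (1 - u) * exp (ln y)"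
    using convex_onD[OF exp_convex, of "1 - u" "ln x" "ln y"] assms by simp
  then show ?thesis using False assms by (simp add: powr_def exp_add)
qed

text \<open>After both sums are normalised to 1, \<open>young_powr\<close> is applied term by
  term.\<close>

lemma holder_sum:
  fixes w x y :: "'a \<Rightarrow> real"
  assumes "finite I" and nn: "\<And>i. i \<in> I \<Longrightarrow> w i \<ge> 0" "\<And>i. i \<in> I \<Longrightarrow> x i \<ge> 0" "\<And>i. i \<in> I \<Longrightarrow> y i \<ge> 0"
    and u: "0 < u" "u < 1"
  shows "(\<Sum>i\<in>I. w i * (x i powr u * y i powr (1 - u)))
    \<le> (\<Sum>i\<in>I. w i * x i) powr u * (\<Sum>i\<in>I. w i * y i) powr (1 - u)"
proof -
  define X where "X = (\<Sum>i\<in>I. w i * x i)"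
  define Y where "Y = (\<Sum>i\<in>I. w i * y i)"
  have "X \<ge> 0" "Y \<ge> 0" using nn by (auto simp: X_def Y_def intro!: sum_nonneg)
  show ?thesis
  proof (cases "X = 0 \<or> Y = 0")
    case True
    \<comment> \<open>Normalisation is impossible if one of the sums is 0, but then nonnegativity
      makes every term vanish.\<close>
    have "w i * (x i powr u * y i powr (1 - u)) = 0" if "i \<in> I" for i
    proof -
      have "w i * x i = 0 \<or> w i * y i = 0"
        using True that nn assms(1) unfolding X_def Y_def
        by (subst (asm) (1 2) sum_nonneg_eq_0_iff) auto
      then show ?thesis by auto
    qed
    then have "(\<Sum>i\<in>I. w i * (x i powr u * y i powr (1 - u))) = 0" by (intro sum.neutral ballI)
    then show ?thesis by (simp del: mult_eq_0_iff)
  next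
    case False
    then have pos: "X > 0" "Y > 0" using \<open>X \<ge> 0\<close> \<open>Y \<ge> 0\<close> by auto
    have "(\<Sum>i\<in>I. w i * (x i powr u * y i powr (1 - u)))
        = (\<Sum>i\<in>I. X powr u * Y powr (1 - u) * (w i * ((x i / X) powr u * (y i / Y) powr (1 - u))))"
      using pos nn by (intro sum.cong refl) (simp add: powr_divide)
    also have "\<dots> \<le> (\<Sum>i\<in>I. X powr u * Y powr (1 - u) * (w i * (u * (x i / X) + (1 - u) * (y i / Y))))"
      using pos nn u by (intro sum_mono mult_left_mono young_powr) auto
    also have "\<dots> = X powr u * Y powr (1 - u) * (\<Sum>i\<in>I. u / X * (w i * x i) + (1 - u) / Y * (w i * y i))"
      unfolding sum_distrib_left by (intro sum.cong refl) (simp add: algebra_simps)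
    also have "(\<Sum>i\<in>I. u / X * (w i * x i) + (1 - u) / Y * (w i * y i)) = u / X * X + (1 - u) / Y * Y"
      unfolding sum.distrib sum_distrib_left[symmetric] X_def Y_def ..
    also have "\<dots> = 1" using pos by simp
    finally show ?thesis by (simp add: X_def Y_def)
  qed
qed

text \<open>A limit turned into an estimate for every \<open>l\<close>, the finitely many exceptions
  being absorbed by \<open>B\<close>. When it is averaged against weights of total mass 1, the
  additive part costs only \<open>B\<close>.\<close>

lemma powr_ratio_bound:
  fixes f :: "nat \<Rightarrow> real"
  assumes "(\<lambda>l. f l / real l powr z) \<longlonglongrightarrow> \<kappa>" and d: "d > 0"
  obtains B where "\<And>l. \<bar>f l - \<kappa> * real l powr z\<bar> \<le> d * real l powr z + B"
proof -
  have "\<forall>\<^sub>F l in sequentially. dist (f l / real l powr z) \<kappa> < d"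
    using assms by (rule tendstoD)
  then obtain m where m: "\<And>l. l \<ge> m \<Longrightarrow> \<bar>f l / real l powr z - \<kappa>\<bar> < d"
    by (auto simp: eventually_sequentially dist_real_def)
  define B where "B = (\<Sum>l\<le>m. \<bar>f l - \<kappa> * real l powr z\<bar>)"
  have B: "B \<ge> 0" by (simp add: B_def sum_nonneg)
  show ?thesis
  proof (rule that[of B])
    fix l
    show "\<bar>f l - \<kappa> * real l powr z\<bar> \<le> d * real l powr z + B"
    proof (cases "l \<le> m")
      case True
      then have "\<bar>f l - \<kappa> * real l powr z\<bar> \<le> B" unfolding B_def by (intro member_le_sum) auto
      moreover have "d * real l powr z \<ge> 0" using d by simp
      ultimately show ?thesis by linarith
    next
      case False
      then have "f l - \<kappa> * real l powr z = (f l / real l powr z - \<kappa>) * real l powr z" by (simp add: field_simps)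
      then have "\<bar>f l - \<kappa> * real l powr z\<bar> = \<bar>f l / real l powr z - \<kappa>\<bar> * real l powr z" by (simp add: abs_mult)
      also have "\<dots> \<le> d * real l powr z" using m[of l] False by (intro mult_right_mono) auto
      finally show ?thesis using B by linarith
    qed
  qed
qed

lemma sum_by_parts:
  fixes g r :: "nat \<Rightarrow> real"
  shows "(\<Sum>l\<le>n. g l * r l) = (\<Sum>l\<le>n. (\<Sum>i\<le>l. g i) * (r l - r (Suc l))) + (\<Sum>i\<le>n. g i) * r (Suc n)"
  by (induction n) (simp_all add: algebra_simps)

section \<open>Sequences with a convolution recurrence and the moments of the random index\<close>

locale partition_recurrence =
  fixes p s :: "nat \<Rightarrow> real" and C a :: real
  assumes p_pos: "p n > 0" and p_mono: "mono p"
    and recurrence: "real n * p n = (\<Sum>l\<le>n. s l * p (n - l))"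
    and s: "laplace_asymp s C a" and C_pos: "C > 0" and a_gt_1: "a > 1"
begin

text \<open>The value 0 beyond \<open>n\<close> closes the telescoping sum: the weights up to
  \<open>n\<close> add up to exactly 1, the last one being \<open>p 0 / p n\<close>.\<close>

definition ratio :: "nat \<Rightarrow> nat \<Rightarrow> real" where
  "ratio n l = (if l \<le> n then p (n - l) / p n else 0)"

definition weight :: "nat \<Rightarrow> nat \<Rightarrow> real" where
  "weight n l = ratio n l - ratio n (Suc l)"

text \<open>The factors \<open>ratio n l\<close> need not sum to 1. The quantity becomes a mean
  after summation by parts, namely the mean of the partial sums of \<open>g\<close> up to the random
  index with law \<open>weight n\<close>.\<close>

definition avg :: "(nat \<Rightarrow> real) \<Rightarrow> nat \<Rightarrow> real" where
  "avg g n = (\<Sum>l\<le>n. g l * ratio n l)"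

definition moment :: "real \<Rightarrow> nat \<Rightarrow> real" where
  "moment z n = (\<Sum>l\<le>n. weight n l * real l powr z)"

definition conv_pow :: "(nat \<Rightarrow> real) \<Rightarrow> nat \<Rightarrow> nat \<Rightarrow> real" where
  "conv_pow g k = ((\<lambda>h n. \<Sum>i\<le>n. h i * s (n - i)) ^^ k) g"

lemma conv_pow_simps: "conv_pow g 0 = g" "conv_pow g (Suc k) = (\<lambda>n. \<Sum>i\<le>n. conv_pow g k i * s (n - i))"
  by (simp_all add: conv_pow_def)

lemma laplace_asymp_conv_pow:
  assumes "laplace_asymp g c b"
  shows "laplace_asymp (conv_pow g k) (c * C ^ k) (b + real k * a)"
proof (induction k)
  case (Suc k)
  from laplace_asymp_convolution[OF this s] show ?case
    by (simp add: conv_pow_simps algebra_simps)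
qed (use assms in \<open>simp add: conv_pow_simps\<close>)

lemma conv_pow_nonneg: "laplace_asymp g c b \<Longrightarrow> conv_pow g k l \<ge> 0"
  using laplace_asymp_conv_pow[of g c b k] by (simp add: laplace_asymp_def)

lemma ratio_nonneg: "ratio n l \<ge> 0"
  using p_pos by (auto simp: ratio_def less_imp_le)

lemma weight_nonneg: "weight n l \<ge> 0"
  using p_pos[of n] p_pos[of "n - l"] monoD[OF p_mono, of "n - Suc l" "n - l"]
  by (auto simp: weight_def ratio_def divide_right_mono)

lemma sum_weight: "(\<Sum>l\<le>n. weight n l) = 1"
  unfolding weight_def sum_telescope using p_pos[of n] by (simp add: ratio_def)

lemma avg_by_parts: "avg g n = (\<Sum>l\<le>n. weight n l * (\<Sum>i\<le>l. g i))"
  using sum_by_parts[of g "ratio n" n] by (simp add: avg_def weight_def ratio_def mult.commute)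

lemma moment_nonneg: "moment z n \<ge> 0"
  unfolding moment_def by (intro sum_nonneg mult_nonneg_nonneg weight_nonneg) auto

text \<open>For fixed \<open>i\<close>, the recurrence at \<open>n - i\<close> collapses the inner
  sum over \<open>j\<close> to \<open>(n - i) * p (n - i)\<close>. The \<open>n\<close> in this
  factor gives the main term and the \<open>i\<close> gives the correction.\<close>

lemma avg_convolution:
  "avg (\<lambda>n. \<Sum>i\<le>n. g i * s (n - i)) n = real n * avg g n - avg (\<lambda>l. real l * g l) n"
proof -
  have "avg (\<lambda>n. \<Sum>i\<le>n. g i * s (n - i)) n = (\<Sum>m\<le>n. \<Sum>i\<le>m. g i * s (m - i) * p (n - (i + (m - i))) / p n)"
    unfolding avg_def ratio_def by (intro sum.cong refl) (simp add: sum_distrib_right sum_divide_distrib)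
  also have "\<dots> = (\<Sum>(i, j)\<in>{(i, j). i + j \<le> n}. g i * s j * p (n - (i + j)) / p n)"
    by (rule sum.triangle_reindex_eq[symmetric])
  also have "{(i, j). i + j \<le> n} = Sigma {..n} (\<lambda>i. {..n - i})" by auto
  also have "(\<Sum>(i, j)\<in>Sigma {..n} (\<lambda>i. {..n - i}). g i * s j * p (n - (i + j)) / p n)
      = (\<Sum>i\<le>n. \<Sum>j\<le>n - i. g i * s j * p (n - (i + j)) / p n)"
    by (rule sum.Sigma[symmetric]) auto
  also have "\<dots> = (\<Sum>i\<le>n. g i * (real (n - i) * p (n - i)) / p n)"
    unfolding recurrence by (simp add: sum_distrib_left sum_divide_distrib mult.assoc)
  also have "\<dots> = (\<Sum>i\<le>n. real n * (g i * ratio n i) - real i * g i * ratio n i)"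
    by (intro sum.cong refl) (simp add: ratio_def of_nat_diff algebra_simps diff_divide_distrib)
  finally show ?thesis by (simp add: sum_subtractf sum_distrib_left avg_def)
qed

lemma moment_holder:
  assumes "u > 0" "v > 0" "0 < \<theta>" "\<theta> < 1"
  shows "moment (\<theta> * u + (1 - \<theta>) * v) n \<le> moment u n powr \<theta> * moment v n powr (1 - \<theta>)"
proof -
  have "moment (\<theta> * u + (1 - \<theta>) * v) n
      = (\<Sum>l\<le>n. weight n l * ((real l powr u) powr \<theta> * (real l powr v) powr (1 - \<theta>)))"
    unfolding moment_def by (intro sum.cong refl) (simp add: powr_powr mult.commute flip: powr_add)
  also have "\<dots> \<le> moment u n powr \<theta> * moment v n powr (1 - \<theta>)"
    unfolding moment_def using assms by (intro holder_sum weight_nonneg) auto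
  finally show ?thesis .
qed

lemma moment_lyapunov:
  assumes "0 < z" "z < u"
  shows "moment z n \<le> moment u n powr (z / u)"
proof -
  have "moment z n = (\<Sum>l\<le>n. weight n l * ((real l powr u) powr (z / u) * 1 powr (1 - z / u)))"
    unfolding moment_def using assms by (intro sum.cong refl) (simp add: powr_powr)
  also have "\<dots> \<le> (\<Sum>l\<le>n. weight n l * real l powr u) powr (z / u) * (\<Sum>l\<le>n. weight n l * 1) powr (1 - z / u)"
    using assms by (intro holder_sum weight_nonneg) auto
  finally show ?thesis by (simp add: moment_def sum_weight)
qed

text \<open>The neutral element of convolution: \<open>conv_pow unit_seq k\<close> is the
  \<open>k\<close>-fold convolution power of \<open>s\<close>, and the average of
  \<open>unit_seq\<close> is exactly 1, so no unknown quantity enters.\<close>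

definition unit_seq :: "nat \<Rightarrow> real" where
  "unit_seq l = (if l = 0 then 1 else 0)"

lemma laplace_asymp_unit_seq: "laplace_asymp unit_seq 1 0"
proof -
  have sums: "(\<lambda>l. unit_seq l * exp (- (t * real l))) sums 1" for t
    using sums_single[of 0 "\<lambda>l. exp (- (t * real l))"] by (simp add: unit_seq_def if_distrib[of "\<lambda>x. x * _"] cong: if_cong)
  then have "laplace unit_seq t = 1" for t by (simp add: laplace_def sums_iff)
  moreover have "\<forall>\<^sub>F t in at_right 0. t powr 0 = (1::real)"
    using eventually_at_right_less[of "0::real"] by eventually_elim simp
  then have "((\<lambda>t. t powr 0) \<longlongrightarrow> (1::real)) (at_right 0)" by (rule tendsto_eventually)
  ultimately show ?thesis using sums by (auto simp: laplace_asymp_def unit_seq_def sums_iff)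
qed

lemma avg_unit_seq: "avg unit_seq n = 1"
proof -
  have "avg unit_seq n = (\<Sum>l\<le>n. if l = 0 then ratio n 0 else 0)"
    unfolding avg_def by (intro sum.cong) (auto simp: unit_seq_def)
  then show ?thesis using p_pos[of n] by (simp add: ratio_def)
qed

lemma avg_nonneg: "(\<And>l. g l \<ge> 0) \<Longrightarrow> avg g n \<ge> 0"
  unfolding avg_def by (intro sum_nonneg mult_nonneg_nonneg ratio_nonneg) auto

text \<open>The correction subtracted in \<open>avg_convolution\<close> is nonnegative; dropping it
  leaves a factor \<open>n\<close> per convolution.\<close>

lemma avg_conv_pow_unit_seq_le: "avg (conv_pow unit_seq k) n \<le> real n ^ k"
proof (induction k)
  case (Suc k)
  have "avg (\<lambda>l. real l * conv_pow unit_seq k l) n \<ge> 0"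
    by (intro avg_nonneg mult_nonneg_nonneg conv_pow_nonneg[OF laplace_asymp_unit_seq]) auto
  then have "avg (conv_pow unit_seq (Suc k)) n \<le> real n * avg (conv_pow unit_seq k) n"
    using avg_convolution[of "conv_pow unit_seq k" n] by (simp add: conv_pow_simps)
  also have "\<dots> \<le> real n * real n ^ k" by (intro mult_left_mono Suc) auto
  finally show ?case by simp
qed (simp add: conv_pow_simps avg_unit_seq)

text \<open>By Karamata, the partial sums of the \<open>k\<close>-fold convolution power of
  \<open>s\<close> dominate a multiple of \<open>l powr (k * a)\<close> for large \<open>l\<close>,
  while their mean is at most \<open>n ^ k\<close> by the recurrence. This a priori bound has the
  right order and is what later allows error terms to be discarded.\<close>

lemma moment_bound_multiple:
  assumes "k \<ge> 1"
  obtains K where "K \<ge> 0" "\<And>n. n \<ge> 1 \<Longrightarrow> moment (real k * a) n \<le> K * real n ^ k"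
proof -
  define \<kappa> where "\<kappa> = C ^ k / Gamma (real k * a + 1)"
  have z: "real k * a > 0" using assms a_gt_1 by simp
  have \<kappa>: "\<kappa> > 0" unfolding \<kappa>_def using C_pos z by (auto intro!: Gamma_real_pos divide_pos_pos)
  define U where "U l = (\<Sum>i\<le>l. conv_pow unit_seq k i)" for l
  have U: "U l \<ge> 0" for l unfolding U_def by (intro sum_nonneg conv_pow_nonneg[OF laplace_asymp_unit_seq])
  have "(\<lambda>l. U l / real l powr (real k * a)) \<longlonglongrightarrow> \<kappa>"
    using karamata[of "conv_pow unit_seq k" "C ^ k" "real k * a"] laplace_asymp_conv_pow[OF laplace_asymp_unit_seq, of k] z
    by (simp add: U_def \<kappa>_def)
  then have "\<forall>\<^sub>F l in sequentially. U l / real l powr (real k * a) > \<kappa> / 2"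
    using \<kappa> by (intro order_tendstoD(1)) auto
  then obtain m where m: "\<And>l. l \<ge> m \<Longrightarrow> U l / real l powr (real k * a) > \<kappa> / 2"
    by (auto simp: eventually_sequentially)
  have bound: "real l powr (real k * a) \<le> 2 / \<kappa> * U l + real m powr (real k * a)" for l
  proof (cases "l \<ge> m")
    case True
    show ?thesis
    proof (cases "l = 0")
      case False
      have "\<kappa> / 2 * real l powr (real k * a) \<le> U l" using m[OF True] False by (simp add: field_simps)
      then have "real l powr (real k * a) \<le> 2 / \<kappa> * U l" using \<kappa> by (simp add: field_simps)
      then show ?thesis by (smt (verit) powr_ge_zero)
    qed (use U \<kappa> in simp)
  next
    case False
    then have "real l powr (real k * a) \<le> real m powr (real k * a)" using z by (intro powr_mono2) auto
    moreover have "2 / \<kappa> * U l \<ge> 0" using U \<kappa> by simp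
    ultimately show ?thesis by linarith
  qed
  show ?thesis
  proof (rule that[of "2 / \<kappa> + real m powr (real k * a)"])
    fix n :: nat assume n: "n \<ge> 1"
    have "moment (real k * a) n \<le> (\<Sum>l\<le>n. weight n l * (2 / \<kappa> * U l + real m powr (real k * a)))"
      unfolding moment_def by (intro sum_mono mult_left_mono bound weight_nonneg)
    also have "\<dots> = 2 / \<kappa> * (\<Sum>l\<le>n. weight n l * U l) + real m powr (real k * a) * (\<Sum>l\<le>n. weight n l)"
      unfolding distrib_left sum.distrib sum_distrib_left by (simp add: mult_ac)
    also have "\<dots> = 2 / \<kappa> * avg (conv_pow unit_seq k) n + real m powr (real k * a) * 1"
      unfolding avg_by_parts U_def sum_weight ..
    also have "\<dots> \<le> 2 / \<kappa> * real n ^ k + real m powr (real k * a) * real n ^ k"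
      using n \<kappa> by (intro add_mono mult_left_mono avg_conv_pow_unit_seq_le one_le_power) auto
    finally show "moment (real k * a) n \<le> (2 / \<kappa> + real m powr (real k * a)) * real n ^ k"
      by (simp add: algebra_simps)
  qed (use \<kappa> in simp)
qed

text \<open>Lyapunov's inequality carries the bound from a multiple \<open>k * a\<close> above
  \<open>z\<close> down to \<open>z\<close>, with exactly the exponent \<open>z / a\<close>.\<close>

lemma moment_bound:
  assumes "z \<ge> 0"
  obtains K where "K \<ge> 0" "\<And>n. n \<ge> 1 \<Longrightarrow> moment z n \<le> K * real n powr (z / a)"
proof (cases "z = 0")
  case True
  show ?thesis
  proof (rule that[of 1])
    fix n :: nat assume "n \<ge> 1"
    \<comment> \<open>Only an inequality, since the term \<open>l = 0\<close> contributes
      \<open>0 powr 0 = 0\<close>.\<close>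
    have "moment 0 n \<le> (\<Sum>l\<le>n. weight n l * 1)"
      unfolding moment_def by (intro sum_mono mult_left_mono weight_nonneg) (auto simp: powr_def)
    then show "moment z n \<le> 1 * real n powr (z / a)" using True \<open>n \<ge> 1\<close> by (simp add: sum_weight)
  qed simp
next
  case False
  then have z: "z > 0" using assms by simp
  obtain k where k: "real k * a > z" using reals_Archimedean3[of a] a_gt_1 by (metis less_trans zero_less_one)
  have k1: "k \<ge> 1" using k z by (cases k) auto
  obtain K where K: "K \<ge> 0" "\<And>n. n \<ge> 1 \<Longrightarrow> moment (real k * a) n \<le> K * real n ^ k"
    using moment_bound_multiple[OF k1] by blast
  show ?thesis
  proof (rule that[of "K powr (z / (real k * a))"])
    fix n :: nat assume n: "n \<ge> 1"
    have "moment z n \<le> moment (real k * a) n powr (z / (real k * a))" by (rule moment_lyapunov) (use k z in auto)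
    also have "\<dots> \<le> (K * real n ^ k) powr (z / (real k * a))"
      using K(2)[OF n] z k by (intro powr_mono2 moment_nonneg) auto
    also have "\<dots> = K powr (z / (real k * a)) * real n powr (z / a)"
      using K(1) n k1 by (simp add: powr_mult powr_powr flip: powr_realpow)
    finally show "moment z n \<le> K powr (z / (real k * a)) * real n powr (z / a)" .
  qed simp
qed

text \<open>An extra factor \<open>l\<close> costs \<open>n powr (1 / a)\<close>, which for
  \<open>a > 1\<close> is less than the factor \<open>n\<close> gained by a convolution with
  \<open>s\<close>.\<close>

lemma avg_bound:
  assumes g: "laplace_asymp g c b" and b: "b \<ge> 0"
  obtains K where "K \<ge> 0" "\<And>n. n \<ge> 1 \<Longrightarrow> avg g n \<le> K * real n powr (b / a)"
    "\<And>n. n \<ge> 1 \<Longrightarrow> avg (\<lambda>l. real l * g l) n \<le> K * real n powr ((b + 1) / a)"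
proof -
  obtain K where K: "K \<ge> 0" "\<And>n. (\<Sum>l\<le>n. g l) \<le> K * (1 + real n powr b)"
    using laplace_asymp_partial_sum_bound[OF g] by blast
  obtain K0 where K0: "K0 \<ge> 0" "\<And>n. n \<ge> 1 \<Longrightarrow> moment b n \<le> K0 * real n powr (b / a)"
    using moment_bound[OF b] by blast
  obtain K1 where K1: "K1 \<ge> 0" "\<And>n. n \<ge> 1 \<Longrightarrow> moment 1 n \<le> K1 * real n powr (1 / a)"
    using moment_bound[of 1] by auto
  obtain K2 where K2: "K2 \<ge> 0" "\<And>n. n \<ge> 1 \<Longrightarrow> moment (b + 1) n \<le> K2 * real n powr ((b + 1) / a)"
    using moment_bound[of "b + 1"] b by auto
  have g0: "g l \<ge> 0" for l using g by (simp add: laplace_asymp_def)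
  define M where "M = K * (1 + K0) + K * (K1 + K2)"
  have M: "K * (1 + K0) \<le> M" "K * (K1 + K2) \<le> M" using K(1) K0(1) K1(1) K2(1) by (auto simp: M_def)
  show ?thesis
  proof (rule that[of M])
    show "M \<ge> 0" using K(1) K0(1) K1(1) K2(1) by (auto simp: M_def)
    fix n :: nat assume n: "n \<ge> 1"
    have n1: "1 \<le> real n powr (b / a)" using n b a_gt_1 by (intro ge_one_powr_ge_zero) auto
    have "avg g n \<le> (\<Sum>l\<le>n. weight n l * (K * (1 + real l powr b)))"
      unfolding avg_by_parts by (intro sum_mono mult_left_mono K(2) weight_nonneg)
    also have "\<dots> = K * ((\<Sum>l\<le>n. weight n l) + moment b n)"
      by (simp add: moment_def sum_distrib_left sum.distrib algebra_simps)
    also have "\<dots> \<le> K * (1 * real n powr (b / a) + K0 * real n powr (b / a))"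
      using n1 K0(2)[OF n] K(1) by (intro mult_left_mono add_mono) (auto simp: sum_weight)
    also have "\<dots> = K * (1 + K0) * real n powr (b / a)" by (simp add: algebra_simps)
    also have "\<dots> \<le> M * real n powr (b / a)" using M(1) by (intro mult_right_mono) auto
    finally show "avg g n \<le> M * real n powr (b / a)" .
    have lb: "(\<Sum>i\<le>l. real i * g i) \<le> K * (real l powr 1 + real l powr (b + 1))" for l
    proof -
      have "(\<Sum>i\<le>l. real i * g i) \<le> (\<Sum>i\<le>l. real l * g i)"
        using g0 by (intro sum_mono mult_right_mono) auto
      also have "\<dots> \<le> real l * (K * (1 + real l powr b))"
        unfolding sum_distrib_left[symmetric] by (intro mult_left_mono K(2)) auto
      also have "\<dots> = K * (real l powr 1 + real l powr (b + 1))" by (cases "l = 0") (auto simp: powr_add algebra_simps)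
      finally show ?thesis .
    qed
    have "avg (\<lambda>l. real l * g l) n \<le> (\<Sum>l\<le>n. weight n l * (K * (real l powr 1 + real l powr (b + 1))))"
      unfolding avg_by_parts by (intro sum_mono mult_left_mono lb weight_nonneg)
    also have "\<dots> = K * (moment 1 n + moment (b + 1) n)"
      unfolding moment_def by (simp add: sum_distrib_left sum.distrib algebra_simps)
    also have "\<dots> \<le> K * (K1 * real n powr ((b + 1) / a) + K2 * real n powr ((b + 1) / a))"
    proof (intro mult_left_mono add_mono K2 n K(1))
      have "real n powr (1 / a) \<le> real n powr ((b + 1) / a)"
        using n b a_gt_1 by (intro powr_mono divide_right_mono) auto
      then have "K1 * real n powr (1 / a) \<le> K1 * real n powr ((b + 1) / a)" using K1(1) by (rule mult_left_mono)
      then show "moment 1 n \<le> K1 * real n powr ((b + 1) / a)" using K1(2)[OF n] by linarith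
    qed
    also have "\<dots> = K * (K1 + K2) * real n powr ((b + 1) / a)" by (simp add: algebra_simps)
    also have "\<dots> \<le> M * real n powr ((b + 1) / a)" using M(2) by (intro mult_right_mono) auto
    finally show "avg (\<lambda>l. real l * g l) n \<le> M * real n powr ((b + 1) / a)" .
  qed
qed

text \<open>Each convolution with \<open>s\<close> multiplies the average by \<open>n\<close>; after
  normalisation the correction in \<open>avg_convolution\<close> is of order
  \<open>n powr (1 / a - 1)\<close>, which tends to 0.\<close>

lemma avg_conv_pow_limit:
  assumes g: "laplace_asymp g c b" and b: "b \<ge> 0"
  shows "(\<lambda>n. avg (conv_pow g k) n / real n powr (real k + b / a) - avg g n / real n powr (b / a)) \<longlonglongrightarrow> 0"
proof (induction k)
  case 0
  show ?case by (simp add: conv_pow_simps)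
next
  case (Suc k)
  let ?h = "conv_pow g k"
  obtain K where K: "K \<ge> 0" "\<And>n. n \<ge> 1 \<Longrightarrow> avg (\<lambda>l. real l * ?h l) n \<le> K * real n powr ((b + real k * a + 1) / a)"
    using avg_bound[OF laplace_asymp_conv_pow[OF g, of k]] a_gt_1 b by (metis add_nonneg_nonneg mult_nonneg_nonneg of_nat_0_le_iff less_eq_real_def less_trans zero_less_one)
  define E where "E n = avg (\<lambda>l. real l * ?h l) n / real n powr (real (Suc k) + b / a)" for n
  have "E \<longlonglongrightarrow> 0"
  proof (rule tendsto_sandwich)
    show "\<forall>\<^sub>F n in sequentially. 0 \<le> E n"
      unfolding E_def by (intro always_eventually allI divide_nonneg_nonneg avg_nonneg mult_nonneg_nonneg conv_pow_nonneg[OF g]) auto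
    show "\<forall>\<^sub>F n in sequentially. E n \<le> K * real n powr (1 / a - 1)"
      using eventually_ge_at_top[of 1]
    proof eventually_elim
      case (elim n)
      have "(b + real k * a + 1) / a = (1 / a - 1) + (real (Suc k) + b / a)" using a_gt_1 by (simp add: field_simps)
      then have "real n powr ((b + real k * a + 1) / a) = real n powr (1 / a - 1) * real n powr (real (Suc k) + b / a)"
        by (simp only: powr_add)
      then show ?case using K(2)[OF elim] elim by (simp add: E_def field_simps)
    qed
    have "1 / a - 1 < 0" using a_gt_1 by simp
    then have "(\<lambda>n. real n powr (1 / a - 1)) \<longlonglongrightarrow> 0"
      by (intro tendsto_neg_powr filterlim_real_sequentially)
    then show "(\<lambda>n. K * real n powr (1 / a - 1)) \<longlonglongrightarrow> 0" by (rule tendsto_mult_right_zero)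
  qed auto
  from tendsto_diff[OF Suc this]
  have "(\<lambda>n. avg ?h n / real n powr (real k + b / a) - avg g n / real n powr (b / a) - E n) \<longlonglongrightarrow> 0" by simp
  moreover have "\<forall>\<^sub>F n in sequentially. avg ?h n / real n powr (real k + b / a) - avg g n / real n powr (b / a) - E n
      = avg (conv_pow g (Suc k)) n / real n powr (real (Suc k) + b / a) - avg g n / real n powr (b / a)"
    using eventually_ge_at_top[of 1]
  proof eventually_elim
    case (elim n)
    have "real (Suc k) + b / a = 1 + (real k + b / a)" by simp
    then have *: "real n powr (real (Suc k) + b / a) = real n * real n powr (real k + b / a)"
      using elim by (simp only: powr_add) simp
    have "avg (conv_pow g (Suc k)) n / real n powr (real (Suc k) + b / a)
        = real n * avg ?h n / real n powr (real (Suc k) + b / a) - E n"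
      by (simp add: conv_pow_simps avg_convolution E_def diff_divide_distrib)
    also have "real n * avg ?h n / real n powr (real (Suc k) + b / a) = avg ?h n / real n powr (real k + b / a)"
      unfolding * using elim by simp
    finally show ?case by simp
  qed
  ultimately show ?case by (rule Lim_transform_eventually)
qed

text \<open>The asymptotics of the partial sums are averaged: the a priori moment bound controls the
  relative error \<open>d\<close>, and the total weight 1 controls the additive error
  \<open>B\<close>.\<close>

lemma avg_moment_limit:
  assumes U: "(\<lambda>l. (\<Sum>i\<le>l. g i) / real l powr z) \<longlonglongrightarrow> \<kappa>" and z: "z > 0"
  shows "(\<lambda>n. avg g n / real n powr (z / a) - \<kappa> * (moment z n / real n powr (z / a))) \<longlonglongrightarrow> 0"
proof (rule tendstoI)
  fix \<epsilon> :: real assume \<epsilon>: "\<epsilon> > 0"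
  define U where "U l = (\<Sum>i\<le>l. g i)" for l
  obtain K where K: "K \<ge> 0" "\<And>n. n \<ge> 1 \<Longrightarrow> moment z n \<le> K * real n powr (z / a)"
    using moment_bound[of z] z by auto
  define d where "d = \<epsilon> / (2 * (K + 1))"
  have d: "d > 0" "d * K < \<epsilon> / 2" using \<epsilon> K(1) by (auto simp: d_def field_simps)
  obtain B where bound: "\<And>l. \<bar>U l - \<kappa> * real l powr z\<bar> \<le> d * real l powr z + B"
    using powr_ratio_bound[OF U d(1)] unfolding U_def by blast
  have "(\<lambda>n. B * real n powr (- (z / a))) \<longlonglongrightarrow> 0"
    using z a_gt_1 by (intro tendsto_mult_right_zero tendsto_neg_powr filterlim_real_sequentially) auto
  then have "\<forall>\<^sub>F n in sequentially. B * real n powr (- (z / a)) < \<epsilon> / 2"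
    using \<epsilon> by (intro order_tendstoD(2)) auto
  then show "\<forall>\<^sub>F n in sequentially. dist (avg g n / real n powr (z / a) - \<kappa> * (moment z n / real n powr (z / a))) 0 < \<epsilon>"
    using eventually_ge_at_top[of 1]
  proof eventually_elim
    case (elim n)
    have "avg g n - \<kappa> * moment z n = (\<Sum>l\<le>n. weight n l * (U l - \<kappa> * real l powr z))"
      by (simp add: avg_by_parts moment_def U_def sum_distrib_left sum_subtractf algebra_simps)
    also have "\<bar>\<dots>\<bar> \<le> (\<Sum>l\<le>n. weight n l * (d * real l powr z + B))"
      by (rule order_trans[OF sum_abs]) (auto simp: abs_mult weight_nonneg intro!: sum_mono mult_left_mono bound)
    also have "\<dots> = d * moment z n + B * (\<Sum>l\<le>n. weight n l)"
      by (simp add: moment_def sum_distrib_left sum.distrib algebra_simps)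
    also have "\<dots> \<le> d * (K * real n powr (z / a)) + B"
      using K(2)[OF elim(2)] d by (simp add: sum_weight)
    finally have "\<bar>avg g n - \<kappa> * moment z n\<bar> \<le> d * (K * real n powr (z / a)) + B" .
    then have "\<bar>avg g n - \<kappa> * moment z n\<bar> / real n powr (z / a) \<le> (d * (K * real n powr (z / a)) + B) / real n powr (z / a)"
      by (rule divide_right_mono) simp
    also have "\<dots> = d * K + B * real n powr (- (z / a))"
      using elim by (simp add: powr_minus field_simps)
    also have "\<dots> < \<epsilon>" using elim d by linarith
    finally show ?case by (simp add: dist_real_def abs_divide flip: diff_divide_distrib)
  qed
qed

text \<open>Two evaluations of the average of \<open>conv_pow g k\<close> are compared: the
  recurrence makes it \<open>n ^ k\<close> times the average of \<open>g\<close>, and Karamata makes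
  it a multiple of the moment of order \<open>b + k * a\<close>. The average of \<open>g\<close>
  remains as a factor independent of \<open>k\<close>.\<close>

lemma conv_pow_moment_limit:
  assumes g: "laplace_asymp g c b" and b: "b \<ge> 0" and c: "c > 0" and k: "k \<ge> 1"
  shows "(\<lambda>n. moment (b + real k * a) n / real n powr (real k + b / a)
      - avg g n / real n powr (b / a) * (Gamma (b + real k * a + 1) / (c * C ^ k))) \<longlonglongrightarrow> 0"
proof -
  define z where "z = b + real k * a"
  define \<kappa> where "\<kappa> = c * C ^ k / Gamma (z + 1)"
  have z: "z > 0" using b k a_gt_1 by (simp add: z_def add_nonneg_pos)
  have \<kappa>: "\<kappa> > 0" unfolding \<kappa>_def using C_pos c z by (auto intro!: Gamma_real_pos divide_pos_pos)
  have za: "z / a = real k + b / a" using a_gt_1 by (simp add: z_def field_simps)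
  have "(\<lambda>n. avg (conv_pow g k) n / real n powr (z / a) - \<kappa> * (moment z n / real n powr (z / a))) \<longlonglongrightarrow> 0"
    using karamata[OF laplace_asymp_conv_pow[OF g, of k, folded z_def] z] z
    unfolding \<kappa>_def by (intro avg_moment_limit)
  from tendsto_diff[OF avg_conv_pow_limit[OF g b, of k] this]
  have "(\<lambda>n. \<kappa> * (moment z n / real n powr (z / a)) - avg g n / real n powr (b / a)) \<longlonglongrightarrow> 0"
    unfolding za by simp
  from tendsto_mult_left[OF this, of "1 / \<kappa>"]
  have "(\<lambda>n. moment z n / real n powr (z / a) - avg g n / real n powr (b / a) * (1 / \<kappa>)) \<longlonglongrightarrow> 0"
    using \<kappa> by (simp add: right_diff_distrib mult.commute)
  then show ?thesis unfolding za by (simp add: \<kappa>_def z_def)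
qed

text \<open>\<open>\<tau>\<close> is the unknown normalised average and \<open>M\<close> the
  normalised moments. As \<open>0 < b < a\<close>, the orders \<open>k * a\<close> and
  \<open>b + k * a\<close> alternate, so each order of one kind is a convex combination, with
  weights \<open>\<theta>\<close> and \<open>1 - \<theta>\<close>, of its two neighbours of the
  other kind.\<close>

theorem avg_asymptotics:
  assumes g: "laplace_asymp g c b" and b: "0 < b" "b < a" and c: "c > 0"
  shows "(\<lambda>n. avg g n / real n powr (b / a)) \<longlonglongrightarrow> c * C powr (- (b / a))"
proof -
  define \<tau> where "\<tau> n = avg g n / real n powr (b / a)" for n
  define L where "L = c * C powr (- (b / a))"
  define M where "M x n = moment x n / real n powr (x / a)" for x n
  define \<theta> where "\<theta> = b / a"
  have \<theta>: "0 < \<theta>" "\<theta> < 1" using b by (auto simp: \<theta>_def)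
  have a0: "a > 0" using a_gt_1 by simp
  have L: "L > 0" using c C_pos by (simp add: L_def)
  have M_nonneg: "M x n \<ge> 0" for x n by (simp add: M_def moment_nonneg)
  have \<tau>_nonneg: "\<tau> n \<ge> 0" for n
    unfolding \<tau>_def using g by (intro divide_nonneg_nonneg avg_nonneg) (auto simp: laplace_asymp_def)
  have M_holder: "M (t * u + (1 - t) * v) n \<le> M u n powr t * M v n powr (1 - t)"
    if "u > 0" "v > 0" "0 < t" "t < 1" "n \<ge> 1" for u v t n
  proof -
    have "real n powr ((t * u + (1 - t) * v) / a) = (real n powr (u / a)) powr t * (real n powr (v / a)) powr (1 - t)"
      using that by (simp add: powr_powr add_divide_distrib mult.commute flip: powr_add)
    moreover have "moment (t * u + (1 - t) * v) n \<le> moment u n powr t * moment v n powr (1 - t)"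
      by (rule moment_holder) (use that in auto)
    ultimately show ?thesis using that moment_nonneg
      by (simp add: M_def powr_divide divide_right_mono)
  qed
  \<comment> \<open>\<open>X k\<close> is the moment of order \<open>k * a\<close> of an exponential
    variable with rate \<open>C powr (1 / a)\<close>; \<open>Y k\<close> is its moment of order
    \<open>b + k * a\<close>, divided by the expected limit \<open>L\<close> of
    \<open>\<tau>\<close>.\<close>
  define X where "X k = Gamma (real k * a + 1) / C ^ k" for k
  define Y where "Y k = Gamma (b + real k * a + 1) / (c * C ^ k)" for k
  have X_pos: "X k > 0" for k unfolding X_def using C_pos a0 by (auto intro!: divide_pos_pos Gamma_real_pos add_nonneg_pos)
  have Y_pos: "Y k > 0" for k unfolding Y_def using C_pos a0 b c by (auto intro!: divide_pos_pos Gamma_real_pos add_nonneg_pos)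
  have limX: "M (real k * a) \<longlonglongrightarrow> X k" if "k \<ge> 1" for k
  proof -
    have "(\<lambda>n. M (real k * a) n - (avg unit_seq n / real n powr 0) * X k) \<longlonglongrightarrow> 0"
      using conv_pow_moment_limit[OF laplace_asymp_unit_seq _ _ that] a0 by (simp add: M_def X_def)
    moreover have "(\<lambda>n. (avg unit_seq n / real n powr 0) * X k) \<longlonglongrightarrow> X k"
      by (rule tendsto_eventually, use eventually_ge_at_top[of 1] in eventually_elim) (simp add: avg_unit_seq)
    ultimately show ?thesis using tendsto_add by fastforce
  qed
  have limY: "(\<lambda>n. M (b + real k * a) n - \<tau> n * Y k) \<longlonglongrightarrow> 0" if "k \<ge> 1" for k
  proof -
    have "(b + real k * a) / a = real k + b / a" using a0 by (simp add: field_simps)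
    then show ?thesis using conv_pow_moment_limit[OF g _ c that] b by (simp add: M_def \<tau>_def Y_def)
  qed
  have evY: "\<forall>\<^sub>F n in sequentially. \<bar>M (b + real k * a) n - \<tau> n * Y k\<bar> < \<eta> * Y k" if "k \<ge> 1" "\<eta> > 0" for k \<eta>
    using tendstoD[OF limY[OF that(1)], of "\<eta> * Y k"] that(2) Y_pos[of k] by (simp add: dist_real_def)

  \<comment> \<open>In the limit \<open>n\<close> to infinity, log-convexity at the order
    \<open>b + k * a\<close> yields the upper bound \<open>\<gamma> k * L\<close> for
    \<open>\<tau>\<close>, and at the order \<open>(k + 1) * a\<close> it yields the lower bound
    \<open>L / \<delta> k\<close>.\<close>
  define \<gamma> where "\<gamma> k = X k powr (1 - \<theta>) * X (Suc k) powr \<theta> / Y k / L" for k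
  define \<delta> where "\<delta> k = Y k powr \<theta> * Y (Suc k) powr (1 - \<theta>) / X (Suc k) * L" for k
  have zlim: "filterlim (\<lambda>k. real k * a + u) at_top sequentially" for u
    using a0 by real_asymp
  have "(\<lambda>k. Gamma (real k * a + 1) powr (1 - \<theta>) * Gamma (real k * a + 1 + a) powr \<theta> / Gamma (real k * a + 1 + b)) \<longlonglongrightarrow> 1"
    using filterlim_compose[OF Gamma_interpolation[OF a0, of b] zlim[of 1]] b by (simp add: \<theta>_def)
  moreover have "Gamma (real k * a + 1) powr (1 - \<theta>) * Gamma (real k * a + 1 + a) powr \<theta> / Gamma (real k * a + 1 + b) = \<gamma> k" for k
  proof -
    have ka: "real k * a \<ge> 0" using a0 by simp
    have pos: "Gamma (real k * a + 1) > 0" "Gamma (real k * a + 1 + a) > 0" "Gamma (real k * a + 1 + b) > 0"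
      using ka a0 b by (intro Gamma_real_pos; linarith)+
    have e: "real (Suc k) * a + 1 = real k * a + 1 + a" "b + real k * a + 1 = real k * a + 1 + b" by (simp_all add: algebra_simps)
    have "(C ^ k) powr (1 - \<theta>) * (C ^ Suc k) powr \<theta> = C ^ k * C powr \<theta>"
      using C_pos by (simp add: powr_mult powr_diff)
    then show ?thesis unfolding \<gamma>_def X_def Y_def L_def e \<theta>_def[symmetric] using pos C_pos c
      by (simp add: powr_divide powr_minus field_simps)
  qed
  ultimately have \<gamma>: "\<gamma> \<longlonglongrightarrow> 1" by simp
  \<comment> \<open>The same interpolation started at \<open>b + k * a\<close>, from where the
    distance to \<open>(k + 1) * a\<close> is \<open>a - b\<close>.\<close>
  have "(\<lambda>k. Gamma (real k * a + (b + 1)) powr (1 - (a - b) / a) * Gamma (real k * a + (b + 1) + a) powr ((a - b) / a)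
      / Gamma (real k * a + (b + 1) + (a - b))) \<longlonglongrightarrow> 1"
    using filterlim_compose[OF Gamma_interpolation[OF a0, of "a - b"] zlim[of "b + 1"]] b by simp
  moreover have "Gamma (real k * a + (b + 1)) powr (1 - (a - b) / a) * Gamma (real k * a + (b + 1) + a) powr ((a - b) / a)
      / Gamma (real k * a + (b + 1) + (a - b)) = \<delta> k" for k
  proof -
    have e: "1 - (a - b) / a = \<theta>" "(a - b) / a = 1 - \<theta>" using a0 by (auto simp: \<theta>_def field_simps)
    have e': "b + real k * a + 1 = real k * a + (b + 1)" "b + real (Suc k) * a + 1 = real k * a + (b + 1) + a"
      "real (Suc k) * a + 1 = real k * a + (b + 1) + (a - b)" by (simp_all add: algebra_simps)
    have ka: "real k * a \<ge> 0" using a0 by simp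
    have pos: "Gamma (real k * a + (b + 1)) > 0" "Gamma (real k * a + (b + 1) + a) > 0" "Gamma (real k * a + (b + 1) + (a - b)) > 0"
      using ka a0 b by (intro Gamma_real_pos; linarith)+
    have "(c * C ^ k) powr \<theta> * (c * C ^ Suc k) powr (1 - \<theta>) = c * C ^ Suc k * C powr (- \<theta>)"
      using C_pos c by (simp add: powr_mult powr_diff powr_minus field_simps)
    then show ?thesis unfolding \<delta>_def X_def Y_def L_def e e' \<theta>_def[symmetric] using pos C_pos c
      by (simp add: powr_divide field_simps)
  qed
  ultimately have \<delta>: "\<delta> \<longlonglongrightarrow> 1" by simp

  have upper: "\<forall>\<^sub>F n in sequentially. \<tau> n < u" if u: "u > L" for u
  proof -
    have "(\<lambda>k. \<gamma> k * L) \<longlonglongrightarrow> 1 * L" by (intro tendsto_intros \<gamma>)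
    then have "\<forall>\<^sub>F k in sequentially. \<gamma> k * L < u" using u by (intro order_tendstoD(2)) auto
    from eventually_conj[OF this eventually_ge_at_top[of 1]]
    obtain k where k: "\<gamma> k * L < u" "k \<ge> 1" by (auto simp: eventually_sequentially)
    \<comment> \<open>Half of the gap between \<open>u\<close> and the bound
      \<open>\<gamma> k * L\<close> pays for the limits of the moments, the other half for the error
      in \<open>evY\<close>.\<close>
    define \<eta> where "\<eta> = (u - \<gamma> k * L) / 2"
    have \<eta>: "\<eta> > 0" using k by (simp add: \<eta>_def)
    have "(\<lambda>n. M (real k * a) n powr (1 - \<theta>) * M (real (Suc k) * a) n powr \<theta> / Y k)
        \<longlonglongrightarrow> X k powr (1 - \<theta>) * X (Suc k) powr \<theta> / Y k"
      using X_pos[of k] X_pos[of "Suc k"] Y_pos[of k] k by (intro tendsto_intros limX) auto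
    then have "\<forall>\<^sub>F n in sequentially. M (real k * a) n powr (1 - \<theta>) * M (real (Suc k) * a) n powr \<theta> / Y k < u - \<eta>"
    proof (rule order_tendstoD(2))
      have "X k powr (1 - \<theta>) * X (Suc k) powr \<theta> / Y k = \<gamma> k * L" using L by (simp add: \<gamma>_def)
      then show "X k powr (1 - \<theta>) * X (Suc k) powr \<theta> / Y k < u - \<eta>" using k by (simp add: \<eta>_def field_simps)
    qed
    then show ?thesis using evY[OF k(2) \<eta>] eventually_ge_at_top[of 1]
    proof eventually_elim
      case (elim n)
      have "b + real k * a = (1 - \<theta>) * (real k * a) + (1 - (1 - \<theta>)) * (real (Suc k) * a)"
        using a0 by (simp add: \<theta>_def field_simps)
      then have "M (b + real k * a) n \<le> M (real k * a) n powr (1 - \<theta>) * M (real (Suc k) * a) n powr (1 - (1 - \<theta>))"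
        using M_holder[of "real k * a" "real (Suc k) * a" "1 - \<theta>" n] \<theta> a0 k elim by simp
      then have "M (b + real k * a) n / Y k < u - \<eta>"
        using elim Y_pos[of k] by (smt (verit) divide_right_mono)
      moreover have "\<tau> n * Y k - \<eta> * Y k < M (b + real k * a) n" using elim by linarith
      then have "\<tau> n - \<eta> < M (b + real k * a) n / Y k" using Y_pos[of k] by (simp add: pos_less_divide_eq left_diff_distrib)
      ultimately show ?case by linarith
    qed
  qed

  have lower: "\<forall>\<^sub>F n in sequentially. \<tau> n > u" if u: "u < L" for u
  proof (cases "u < 0")
    case True
    then show ?thesis using \<tau>_nonneg by (auto intro!: always_eventually elim: less_le_trans)
  next
    case False
    define u' where "u' = (u + L) / 2"
    have u': "u < u'" "u' < L" "u' > 0" using u False L by (auto simp: u'_def)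
    have "(\<lambda>k. \<delta> k * u') \<longlonglongrightarrow> 1 * u'" by (intro tendsto_intros \<delta>)
    then have "\<forall>\<^sub>F k in sequentially. \<delta> k * u' < L" using u' by (intro order_tendstoD(2)) auto
    from eventually_conj[OF this eventually_ge_at_top[of 1]]
    obtain k where k: "\<delta> k * u' < L" "k \<ge> 1" by (auto simp: eventually_sequentially)
    define \<eta> where "\<eta> = u' - u"
    have \<eta>: "\<eta> > 0" using u' by (simp add: \<eta>_def)
    define W where "W = Y k powr \<theta> * Y (Suc k) powr (1 - \<theta>)"
    have W: "W > 0" using Y_pos[of k] Y_pos[of "Suc k"] by (simp add: W_def)
    have "W * u' < X (Suc k)"
      using k(1) L X_pos[of "Suc k"] by (simp add: \<delta>_def W_def[symmetric] field_simps)
    then have "\<forall>\<^sub>F n in sequentially. M (real (Suc k) * a) n > W * u'"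
      using limX[of "Suc k"] by (intro order_tendstoD(1)) auto
    then show ?thesis using evY[OF k(2) \<eta>] evY[of "Suc k", OF _ \<eta>, simplified] eventually_ge_at_top[of 1]
    proof eventually_elim
      case (elim n)
      have "real (Suc k) * a = \<theta> * (b + real k * a) + (1 - \<theta>) * (b + real (Suc k) * a)"
        using a0 by (simp add: \<theta>_def field_simps)
      then have "M (real (Suc k) * a) n \<le> M (b + real k * a) n powr \<theta> * M (b + real (Suc k) * a) n powr (1 - \<theta>)"
        using M_holder[of "b + real k * a" "b + real (Suc k) * a" \<theta> n] \<theta> a0 b k elim by (simp add: add_pos_nonneg)
      also have "\<dots> \<le> ((\<tau> n + \<eta>) * Y k) powr \<theta> * ((\<tau> n + \<eta>) * Y (Suc k)) powr (1 - \<theta>)"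
        using elim \<theta> M_nonneg by (intro mult_mono powr_mono2) (auto simp: algebra_simps)
      \<comment> \<open>The exponents \<open>\<theta>\<close> and \<open>1 - \<theta>\<close> add up
        to 1, so the unknown leaves both powers as one linear factor.\<close>
      also have "\<dots> = (\<tau> n + \<eta>) * W"
        using \<tau>_nonneg[of n] \<eta> Y_pos[of k] Y_pos[of "Suc k"]
        by (simp add: W_def powr_mult powr_diff)
      finally have "W * u' < W * (\<tau> n + \<eta>)" using elim by (simp add: mult.commute)
      then have "u' < \<tau> n + \<eta>" using W by simp
      then show ?case by (simp add: \<eta>_def)
    qed
  qed
  show ?thesis
    unfolding \<tau>_def[symmetric] L_def[symmetric] by (rule order_tendstoI) (use upper lower in auto)
qed

end

section \<open>Counting partitions\<close>

lemma sum_mset_eq_sum_count: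
  fixes c :: "'a \<Rightarrow> real"
  assumes "finite F" "set_mset M \<subseteq> F"
  shows "(\<Sum>k\<in>#M. c k) = (\<Sum>k\<in>F. real (count M k) * c k)"
  using assms(2)
proof (induction M)
  case (add x M)
  have "(\<Sum>k\<in>F. real (count (add_mset x M) k) * c k)
      = (\<Sum>k\<in>F. real (count M k) * c k + (if k = x then c k else 0))"
    by (intro sum.cong) (auto simp: algebra_simps)
  with add assms(1) show ?case by (simp add: sum.distrib)
qed simp

locale part_sequence =
  fixes \<Lambda> :: "nat \<Rightarrow> nat"
  assumes pos: "\<Lambda> k > 0" and one_mem: "1 \<in> range \<Lambda>"
    and summable_theta: "t > 0 \<Longrightarrow> summable (\<lambda>k. exp (- (real (\<Lambda> k) * t)))"
begin

abbreviation part :: "nat \<Rightarrow> real" where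
  "part \<equiv> (\<lambda>k. real (\<Lambda> k))"

definition partition_sets :: "nat \<Rightarrow> nat multiset set" where
  "partition_sets n = {M. (\<Sum>k\<in>#M. \<Lambda> k) = n}"

definition partition_count :: "nat \<Rightarrow> real" where
  "partition_count n = real (card (partition_sets n))"

text \<open>With \<open>c = part\<close> this is the sequence \<open>s\<close> of the recurrence,
  and with \<open>c = 1\<close> the divisor count \<open>d\<close>. The index 0 is set apart because
  every part divides 0.\<close>

definition divisor_weight :: "(nat \<Rightarrow> real) \<Rightarrow> nat \<Rightarrow> real" where
  "divisor_weight c l = (if l = 0 then 0 else \<Sum>k | \<Lambda> k dvd l. c k)"

lemma finite_parts_le: "finite {k. \<Lambda> k \<le> n}"
proof -
  have "(\<lambda>k. exp (- (part k * 1))) \<longlonglongrightarrow> 0"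
    by (intro summable_LIMSEQ_zero summable_theta) simp
  then have "\<forall>\<^sub>F k in sequentially. exp (- (part k * 1)) < exp (- real n)"
    by (rule order_tendstoD) simp
  then obtain K where K: "\<And>k. k \<ge> K \<Longrightarrow> n < \<Lambda> k"
    by (auto simp: eventually_sequentially)
  then have "{k. \<Lambda> k \<le> n} \<subseteq> {..<K}" by (auto simp: not_le[symmetric])
  then show ?thesis by (rule finite_subset) simp
qed

lemma finite_divisors: "l > 0 \<Longrightarrow> finite {k. \<Lambda> k dvd l}"
  by (rule finite_subset[OF _ finite_parts_le[of l]]) (auto dest: dvd_imp_le)

lemma part_le:
  assumes "M \<in> partition_sets n" "k \<in># M"
  shows "\<Lambda> k \<le> n"
proof -
  have "\<Lambda> k \<le> (\<Sum>k\<in>#M. \<Lambda> k)"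
    using assms(2) by (metis image_eqI set_image_mset sum_mset.remove le_add1)
  then show ?thesis using assms(1) by (simp add: partition_sets_def)
qed

lemma size_le:
  assumes "M \<in> partition_sets n"
  shows "size M \<le> n"
proof -
  have "size M \<le> (\<Sum>k\<in>#M. \<Lambda> k)"
    unfolding size_eq_sum_mset by (intro sum_mset_mono) (use pos in \<open>simp add: Suc_le_eq\<close>)
  then show ?thesis using assms by (simp add: partition_sets_def)
qed

lemma finite_partition_sets: "finite (partition_sets n)"
proof -
  have "partition_sets n \<subseteq> mset ` {xs. set xs \<subseteq> {k. \<Lambda> k \<le> n} \<and> length xs \<le> n}"
  proof
    fix M assume M: "M \<in> partition_sets n"
    obtain xs where "M = mset xs" by (metis ex_mset)
    with part_le[OF M] size_le[OF M] show "M \<in> mset ` {xs. set xs \<subseteq> {k. \<Lambda> k \<le> n} \<and> length xs \<le> n}"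
      by auto
  qed
  then show ?thesis
    by (rule finite_subset) (intro finite_imageI finite_lists_length_le finite_parts_le)
qed

lemma partition_moment_eq: "partition_moment \<Lambda> j n = (\<Sum>M\<in>partition_sets n. real (size M) ^ j)"
proof -
  have eq: "partitions_into \<Lambda> n m = {M \<in> partition_sets n. size M = m}" for m
    by (auto simp: partitions_into_def partition_sets_def)
  have "partition_moment \<Lambda> j n = (\<Sum>m\<le>n. real m ^ j * real (num_partitions \<Lambda> n m))"
    unfolding partition_moment_def
  proof (rule suminf_finite)
    fix m assume "m \<notin> {..n}"
    then have "partitions_into \<Lambda> n m = {}" unfolding eq using size_le by fastforce
    then show "real m ^ j * real (num_partitions \<Lambda> n m) = 0" by (simp add: num_partitions_def)
  qed simp
  also have "\<dots> = (\<Sum>m\<le>n. \<Sum>M | M \<in> partition_sets n \<and> size M = m. real (size M) ^ j)"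
    by (intro sum.cong refl) (simp add: num_partitions_def eq)
  also have "\<dots> = (\<Sum>M\<in>partition_sets n. real (size M) ^ j)"
    by (rule sum.group) (auto simp: finite_partition_sets size_le)
  finally show ?thesis .
qed

lemma partition_moment_0: "partition_moment \<Lambda> 0 n = partition_count n"
  by (simp add: partition_moment_eq partition_count_def)

lemma partition_count_pos: "partition_count n > 0"
proof -
  obtain k where "\<Lambda> k = 1" using one_mem by (metis imageE)
  then have "replicate_mset n k \<in> partition_sets n" by (simp add: partition_sets_def)
  then show ?thesis using finite_partition_sets by (auto simp: partition_count_def card_gt_0_iff)
qed

lemma mono_partition_count: "mono partition_count"
proof (rule incseq_SucI)
  fix n
  obtain k where "\<Lambda> k = 1" using one_mem by (metis imageE)
  then have "add_mset k ` partition_sets n \<subseteq> partition_sets (Suc n)" by (auto simp: partition_sets_def)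
  then have "card (add_mset k ` partition_sets n) \<le> card (partition_sets (Suc n))"
    by (intro card_mono finite_partition_sets)
  then show "partition_count n \<le> partition_count (Suc n)"
    by (simp add: partition_count_def card_image inj_on_def)
qed

text \<open>Removing \<open>j\<close> copies of \<open>k\<close> is a bijection onto the partitions
  of \<open>n - j * \<Lambda> k\<close>; the conditional guards against truncated
  subtraction.\<close>

lemma card_count_ge:
  "real (card {M \<in> partition_sets n. j \<le> count M k}) = (if j * \<Lambda> k \<le> n then partition_count (n - j * \<Lambda> k) else 0)"
proof -
  let ?f = "\<lambda>M. M + replicate_mset j k"
  show ?thesis
  proof (cases "j * \<Lambda> k \<le> n")
    case True
    have "?f ` partition_sets (n - j * \<Lambda> k) = {M \<in> partition_sets n. j \<le> count M k}"
    proof (intro equalityI subsetI)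
      fix M assume "M \<in> {M \<in> partition_sets n. j \<le> count M k}"
      moreover from this obtain N where "M = N + replicate_mset j k"
        by (metis (mono_tags, lifting) count_le_replicate_mset_subset_eq mem_Collect_eq subset_mset.diff_add)
      ultimately show "M \<in> ?f ` partition_sets (n - j * \<Lambda> k)" by (auto simp: partition_sets_def)
    qed (use True in \<open>auto simp: partition_sets_def\<close>)
    then have "bij_betw ?f (partition_sets (n - j * \<Lambda> k)) {M \<in> partition_sets n. j \<le> count M k}"
      by (auto simp: bij_betw_def inj_on_def)
    from bij_betw_same_card[OF this] True show ?thesis by (simp add: partition_count_def)
  next
    case False
    have "j * \<Lambda> k \<le> n" if "M \<in> partition_sets n" "j \<le> count M k" for M
    proof -
      have "replicate_mset j k \<subseteq># M" using that(2) by (simp add: count_le_replicate_mset_subset_eq)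
      then obtain N where "M = replicate_mset j k + N" by (metis subset_mset.add_diff_inverse)
      then show ?thesis using that(1) by (auto simp: partition_sets_def)
    qed
    then have none: "{M \<in> partition_sets n. j \<le> count M k} = {}" using False by blast
    show ?thesis unfolding none using False by simp
  qed
qed

text \<open>The multiplicity of \<open>k\<close> in \<open>M\<close> is the number of
  \<open>j \<ge> 1\<close> with \<open>j \<le> count M k\<close>. Exchanging sums turns this into
  counting the partitions that contain \<open>k\<close> at least \<open>j\<close> times, and
  grouping by \<open>l = j * \<Lambda> k\<close> produces the divisor weights.\<close>

lemma sum_over_partitions:
  "(\<Sum>M\<in>partition_sets n. \<Sum>k\<in>#M. c k) = (\<Sum>l\<le>n. divisor_weight c l * partition_count (n - l))"
proof -
  define F where "F = {k. \<Lambda> k \<le> n}"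
  have F: "finite F" unfolding F_def by (rule finite_parts_le)
  define S where "S = {(k, j). k \<in> F \<and> j \<in> {1..n} \<and> j * \<Lambda> k \<le> n}"
  have S: "finite S" by (rule finite_subset[of _ "F \<times> {1..n}"]) (use F in \<open>auto simp: S_def\<close>)
  have inner: "(\<Sum>k\<in>#M. c k) = (\<Sum>k\<in>F. \<Sum>j=1..n. if j \<le> count M k then c k else 0)" if M: "M \<in> partition_sets n" for M
  proof -
    have "(\<Sum>k\<in>#M. c k) = (\<Sum>k\<in>F. real (count M k) * c k)"
      using part_le[OF M] by (intro sum_mset_eq_sum_count F) (auto simp: F_def)
    also have "\<dots> = (\<Sum>k\<in>F. \<Sum>j=1..n. if j \<le> count M k then c k else 0)"
    proof (intro sum.cong refl)
      fix k
      have "count M k \<le> n" using size_le[OF M] count_le_size[of M k] by linarith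
      then have "{1..n} \<inter> {j. j \<le> count M k} = {1..count M k}" by auto
      then show "real (count M k) * c k = (\<Sum>j=1..n. if j \<le> count M k then c k else 0)"
        by (simp add: sum.If_cases)
    qed
    finally show ?thesis .
  qed
  have "(\<Sum>M\<in>partition_sets n. \<Sum>k\<in>#M. c k)
      = (\<Sum>M\<in>partition_sets n. \<Sum>k\<in>F. \<Sum>j=1..n. if j \<le> count M k then c k else 0)"
    by (intro sum.cong refl inner)
  also have "\<dots> = (\<Sum>k\<in>F. \<Sum>j=1..n. \<Sum>M\<in>partition_sets n. if j \<le> count M k then c k else 0)"
    by (subst sum.swap, intro sum.cong refl sum.swap)
  also have "\<dots> = (\<Sum>k\<in>F. \<Sum>j=1..n. c k * (if j * \<Lambda> k \<le> n then partition_count (n - j * \<Lambda> k) else 0))"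
    by (intro sum.cong refl) (simp add: card_count_ge[symmetric] sum.If_cases finite_partition_sets Collect_conj_eq mult.commute)
  also have "\<dots> = (\<Sum>(k, j)\<in>F \<times> {1..n}. c k * (if j * \<Lambda> k \<le> n then partition_count (n - j * \<Lambda> k) else 0))"
    by (simp add: sum.cartesian_product)
  also have "\<dots> = (\<Sum>(k, j)\<in>S. c k * partition_count (n - j * \<Lambda> k))"
    by (rule sum.mono_neutral_cong_right) (use F in \<open>auto simp: S_def split: if_splits\<close>)
  also have "\<dots> = (\<Sum>l\<in>{1..n}. \<Sum>x | x \<in> S \<and> snd x * \<Lambda> (fst x) = l. c (fst x) * partition_count (n - snd x * \<Lambda> (fst x)))"
    unfolding case_prod_unfold using pos by (intro sum.group[symmetric] S) (auto simp: S_def Suc_le_eq)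
  also have "\<dots> = (\<Sum>l\<in>{1..n}. divisor_weight c l * partition_count (n - l))"
  proof (intro sum.cong refl)
    fix l assume l: "l \<in> {1..n}"
    have "(\<Sum>x | x \<in> S \<and> snd x * \<Lambda> (fst x) = l. c (fst x) * partition_count (n - snd x * \<Lambda> (fst x)))
        = (\<Sum>k | \<Lambda> k dvd l. c k * partition_count (n - l))"
    \<comment> \<open>Once \<open>l\<close> is fixed, \<open>j\<close> is forced to be
      \<open>l div \<Lambda> k\<close>, so a pair amounts to a position whose part divides
      \<open>l\<close>.\<close>
    proof (rule sum.reindex_bij_witness[where i = "\<lambda>k. (k, l div \<Lambda> k)" and j = fst])
      fix x assume "x \<in> {x. x \<in> S \<and> snd x * \<Lambda> (fst x) = l}"
      then show "(fst x, l div \<Lambda> (fst x)) = x" "fst x \<in> {k. \<Lambda> k dvd l}"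
        "c (fst x) * partition_count (n - l) = c (fst x) * partition_count (n - snd x * \<Lambda> (fst x))"
        using pos[of "fst x"] by (auto simp: prod_eq_iff)
    next
      fix k assume k: "k \<in> {k. \<Lambda> k dvd l}"
      then have "\<Lambda> k \<le> l" "l div \<Lambda> k \<le> l" "l div \<Lambda> k > 0" using l pos[of k] by (auto dest: dvd_imp_le simp: div_greater_zero_iff)
      then show "(k, l div \<Lambda> k) \<in> {x. x \<in> S \<and> snd x * \<Lambda> (fst x) = l}" "fst (k, l div \<Lambda> k) = k"
        using k l order.trans[OF div_le_dividend[of l "\<Lambda> k"], of n] by (auto simp: S_def F_def)
    qed
    then show "(\<Sum>x | x \<in> S \<and> snd x * \<Lambda> (fst x) = l. c (fst x) * partition_count (n - snd x * \<Lambda> (fst x)))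
        = divisor_weight c l * partition_count (n - l)"
      using l by (simp add: divisor_weight_def sum_distrib_right)
  qed
  also have "\<dots> = (\<Sum>l\<le>n. divisor_weight c l * partition_count (n - l))"
    by (intro sum.mono_neutral_left) (auto simp: divisor_weight_def)
  finally show ?thesis .
qed

lemma partition_count_recurrence:
  "real n * partition_count n = (\<Sum>l\<le>n. divisor_weight part l * partition_count (n - l))"
proof -
  have "(\<Sum>M\<in>partition_sets n. \<Sum>k\<in>#M. part k) = (\<Sum>M\<in>partition_sets n. real n)"
    by (intro sum.cong refl) (auto simp: partition_sets_def of_nat_sum_mset multiset.map_comp comp_def)
  then show ?thesis unfolding sum_over_partitions by (simp add: partition_count_def mult.commute)
qed

lemma partition_moment_1:
  "partition_moment \<Lambda> 1 n = (\<Sum>l\<le>n. divisor_weight (\<lambda>k. 1) l * partition_count (n - l))"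
  unfolding sum_over_partitions[symmetric] partition_moment_eq by simp

section \<open>Lambert series and their rearrangements\<close>

context
  fixes c :: "nat \<Rightarrow> real" and t :: real
  assumes c: "\<And>k. c k \<ge> 0" and t: "t > 0" and summable_c: "summable (\<lambda>k. c k * exp (- (part k * t)))"
begin

lemma lambert_term_has_sum:
  "((\<lambda>j. c k * exp (- (part k * (real (Suc j) * t)))) has_sum (c k / (exp (t * part k) - 1))) UNIV"
proof -
  define q where "q = exp (- (part k * t))"
  have q: "0 < q" "q < 1" using pos[of k] t by (auto simp: q_def)
  have "(\<lambda>j. c k * q * q ^ j) sums (c k * q * (1 / (1 - q)))"
    using q by (intro sums_mult geometric_sums) auto
  moreover have "c k * q * q ^ j = c k * exp (- (part k * (real (Suc j) * t)))" for j
    by (simp add: q_def algebra_simps flip: exp_of_nat_mult exp_add)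
  moreover have "c k * q * (1 / (1 - q)) = c k / (exp (t * part k) - 1)"
  proof -
    have e: "exp (t * part k) = 1 / q" unfolding q_def by (simp add: exp_minus inverse_eq_divide mult.commute)
    show ?thesis unfolding e using q by (simp add: field_simps)
  qed
  ultimately show ?thesis using c q by (intro sums_nonneg_imp_has_sum) auto
qed

text \<open>Since every part is at least 1, \<open>1 - exp (- (t * part k))\<close> is bounded below
  by \<open>1 - exp (- t)\<close>.\<close>

lemma summable_lambert: "summable (\<lambda>k. c k / (exp (t * part k) - 1))"
proof (rule summable_comparison_test', rule summable_mult[OF summable_c, of "1 / (1 - exp (- t))"])
  fix k
  have "t \<le> t * part k" using t pos[of k] by simp
  then have e: "exp t \<le> exp (t * part k)" by simp
  have t1: "exp t > 1" using t by simp
  have "1 / (exp (t * part k) - 1) \<le> 1 / (1 - exp (- t)) * exp (- (part k * t))"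
    using e t1 by (simp add: exp_minus field_simps)
  from mult_left_mono[OF this c[of k]]
  show "norm (c k / (exp (t * part k) - 1)) \<le> 1 / (1 - exp (- t)) * (c k * exp (- (part k * t)))"
    using e t1 c[of k] by (simp add: mult_ac)
qed

lemma lambert_has_sum:
  "((\<lambda>(k, j). c k * exp (- (part k * (real (Suc j) * t)))) has_sum (\<Sum>k. c k / (exp (t * part k) - 1))) (UNIV \<times> UNIV)"
proof (rule has_sum_SigmaI)
  have nn: "c k / (exp (t * part k) - 1) \<ge> 0" for k using t c by simp
  show hs: "((\<lambda>k. c k / (exp (t * part k) - 1)) has_sum (\<Sum>k. c k / (exp (t * part k) - 1))) UNIV"
    by (intro sums_nonneg_imp_has_sum summable_sums summable_lambert nn)
  show "((\<lambda>j. case (k, j) of (k, j) \<Rightarrow> c k * exp (- (part k * (real (Suc j) * t))))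
      has_sum (c k / (exp (t * part k) - 1))) UNIV" for k
    using lambert_term_has_sum[of k] by simp
  then show "(\<lambda>(k, j). c k * exp (- (part k * (real (Suc j) * t)))) summable_on UNIV \<times> UNIV"
    by (rule summable_on_SigmaI) (use hs c in \<open>auto simp: summable_on_def\<close>)
qed

text \<open>Each Lambert quotient is expanded into a geometric series, and the double sum is
  collected along \<open>l = Suc j * \<Lambda> k\<close>. All terms are nonnegative, so the
  rearrangement is legitimate.\<close>

lemma divisor_weight_sums:
  "(\<lambda>l. divisor_weight c l * exp (- (t * real l))) sums (\<Sum>k. c k / (exp (t * part k) - 1))"
proof -
  define f where "f = (\<lambda>(l, k). c k * exp (- (t * real l)))"
  define B where "B l = (if l = 0 then {} else {k. \<Lambda> k dvd l})" for l
  have *: "m + (k - Suc 0) * m = m * k" if "k > 0" for m k :: nat using that by (cases k) auto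
  have "bij_betw (\<lambda>(k, j). (Suc j * \<Lambda> k, k)) (UNIV \<times> UNIV) (Sigma UNIV B)"
    using pos by (intro bij_betwI[where g = "\<lambda>(l, k). (k, l div \<Lambda> k - 1)"])
      (auto simp: B_def * elim!: dvdE split: if_splits)
  then have "(f has_sum (\<Sum>k. c k / (exp (t * part k) - 1))) (Sigma UNIV B)"
    by (subst has_sum_reindex_bij_betw[symmetric, of _ "UNIV \<times> UNIV"], assumption)
       (use lambert_has_sum in \<open>simp add: f_def case_prod_unfold algebra_simps\<close>)
  then have "((\<lambda>l. divisor_weight c l * exp (- (t * real l))) has_sum (\<Sum>k. c k / (exp (t * part k) - 1))) UNIV"
  proof (rule has_sum_SigmaD)
    fix l
    show "((\<lambda>k. f (l, k)) has_sum (divisor_weight c l * exp (- (t * real l)))) (B l)"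
      by (cases "l = 0") (auto simp: B_def f_def divisor_weight_def sum_distrib_right intro!: has_sum_finiteI finite_divisors)
  qed
  then show ?thesis by (rule has_sum_imp_sums)
qed

text \<open>The same double sum with \<open>k\<close> innermost: the Lambert series is the sum of
  the theta series at the multiples of \<open>t\<close>. This is the origin of the zeta factors in
  the asymptotics.\<close>

lemma theta_multiples_sums:
  "(\<lambda>j. \<Sum>k. c k * exp (- (part k * (real (Suc j) * t)))) sums (\<Sum>k. c k / (exp (t * part k) - 1))"
proof -
  have s: "summable (\<lambda>k. c k * exp (- (part k * (real (Suc j) * t))))" for j
  proof (rule summable_comparison_test'[OF summable_c])
    fix k
    have "exp (- (part k * (real (Suc j) * t))) \<le> exp (- (part k * t))"
      using t by (auto intro!: mult_left_mono)
    then show "norm (c k * exp (- (part k * (real (Suc j) * t)))) \<le> c k * exp (- (part k * t))"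
      using c by (simp add: mult_left_mono)
  qed
  have "((\<lambda>(j, k). c k * exp (- (part k * (real (Suc j) * t)))) has_sum (\<Sum>k. c k / (exp (t * part k) - 1))) (UNIV \<times> UNIV)"
    using lambert_has_sum by (subst has_sum_swap) simp
  then have "((\<lambda>j. \<Sum>k. c k * exp (- (part k * (real (Suc j) * t)))) has_sum (\<Sum>k. c k / (exp (t * part k) - 1))) UNIV"
  proof (rule has_sum_SigmaD)
    fix j
    show "((\<lambda>k. case (j, k) of (j, k) \<Rightarrow> c k * exp (- (part k * (real (Suc j) * t)))) has_sum
        (\<Sum>k. c k * exp (- (part k * (real (Suc j) * t))))) UNIV"
      unfolding prod.case by (intro sums_nonneg_imp_has_sum summable_sums s mult_nonneg_nonneg c) simp
  qed
  then show ?thesis by (rule has_sum_imp_sums)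
qed

end

end

section \<open>Theta series and the saddle point\<close>

lemma riemann_zeta_sums:
  assumes "s > 1"
  shows "(\<lambda>n. 1 / real (Suc n) powr s) sums riemann_zeta s"
proof -
  have "summable (\<lambda>n. 1 / real (Suc n) powr s)"
    using summable_real_powr_iff[of "- s"] assms
    by (subst summable_Suc_iff) (simp add: powr_minus_divide)
  then show ?thesis unfolding riemann_zeta_def by (rule summable_sums)
qed

lemma riemann_zeta_pos: "s > 1 \<Longrightarrow> riemann_zeta s > 0"
  using suminf_pos[OF sums_summable[OF riemann_zeta_sums]] by (simp add: riemann_zeta_def)

context part_sequence
begin

definition theta :: "(nat \<Rightarrow> real) \<Rightarrow> real \<Rightarrow> real" where
  "theta c t = (\<Sum>k. c k * exp (- (part k * t)))"

definition lambert :: "(nat \<Rightarrow> real) \<Rightarrow> real \<Rightarrow> real" where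
  "lambert c t = (\<Sum>k. c k / (exp (t * part k) - 1))"

lemma theta_1: "theta (\<lambda>k. 1) t = theta_sum \<Lambda> t"
  by (simp add: theta_def theta_sum_def)

context
  fixes c :: "nat \<Rightarrow> real"
  assumes c: "\<And>k. c k \<ge> 0" and summable_c: "\<And>t. t > 0 \<Longrightarrow> summable (\<lambda>k. c k * exp (- (part k * t)))"
begin

lemma theta_nonneg: "t > 0 \<Longrightarrow> theta c t \<ge> 0"
  unfolding theta_def by (intro suminf_nonneg summable_c mult_nonneg_nonneg c) auto

text \<open>Every part is at least 1, so moving from \<open>r\<close> to \<open>x\<close> gains at
  least the factor \<open>exp (r - x)\<close> in each term.\<close>

lemma theta_decay:
  assumes "0 < r" "r \<le> x"
  shows "theta c x \<le> exp (r - x) * theta c r"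
  unfolding theta_def
proof (subst suminf_mult[symmetric, OF summable_c[OF assms(1)]], rule suminf_le)
  fix k
  have "(x - r) * 1 \<le> (x - r) * part k" using pos[of k] assms by (intro mult_left_mono) auto
  then have "exp (- (part k * x)) \<le> exp (r - x) * exp (- (part k * r))"
    by (simp add: algebra_simps flip: exp_add)
  from mult_left_mono[OF this c[of k]]
  show "c k * exp (- (part k * x)) \<le> exp (r - x) * (c k * exp (- (part k * r)))" by (simp add: mult_ac)
qed (use assms summable_c in \<open>auto intro!: summable_mult\<close>)

lemma divisor_weight_laplace:
  assumes "t > 0"
  shows "laplace (divisor_weight c) t = lambert c t" "summable (\<lambda>l. divisor_weight c l * exp (- (t * real l)))"
  using divisor_weight_sums[OF c assms summable_c[OF assms]] by (auto simp: laplace_def lambert_def sums_iff)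

lemma divisor_weight_nonneg: "divisor_weight c l \<ge> 0"
  unfolding divisor_weight_def using c by (auto intro: sum_nonneg)

lemma laplace_asymp_divisor_weightI:
  assumes "((\<lambda>t. t powr b * lambert c t) \<longlongrightarrow> B) (at_right 0)"
  shows "laplace_asymp (divisor_weight c) B b"
proof -
  have "((\<lambda>t. t powr b * laplace (divisor_weight c) t) \<longlongrightarrow> B) (at_right 0)"
    by (rule tendsto_at_right_0_cong[OF assms]) (simp add: divisor_weight_laplace)
  then show ?thesis
    using divisor_weight_laplace(2) divisor_weight_nonneg by (auto simp: laplace_asymp_def)
qed

context
  fixes B \<beta> :: real
  assumes lim: "((\<lambda>t. t powr \<beta> * theta c t) \<longlongrightarrow> B) (at_right 0)"
begin

text \<open>The limit at 0 becomes a bound on the whole half-line, as domination at all multiples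
  \<open>Suc j * t\<close> requires. The exponential decay handles large \<open>x\<close>, and in
  the middle range its continuous majorant is bounded by compactness.\<close>

lemma theta_power_bound:
  obtains K where "K \<ge> 0" "\<And>x. x > 0 \<Longrightarrow> x powr \<beta> * theta c x \<le> K"
proof -
  have "\<forall>\<^sub>F t in at_right 0. t powr \<beta> * theta c t < B + 1" using lim by (rule order_tendstoD) simp
  then obtain r where r: "r > 0" "\<And>t. 0 < t \<Longrightarrow> t < r \<Longrightarrow> t powr \<beta> * theta c t < B + 1"
    unfolding eventually_at_right_field by blast
  have "((\<lambda>x. x powr \<beta> * exp (r - x)) \<longlongrightarrow> 0) at_top" by real_asymp
  then have "((\<lambda>x. x powr \<beta> * (exp (r - x) * theta c r)) \<longlongrightarrow> 0) at_top"
    unfolding mult.assoc[symmetric] by (rule tendsto_mult_left_zero)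
  then have "\<forall>\<^sub>F x in at_top. x powr \<beta> * (exp (r - x) * theta c r) < 1" by (rule order_tendstoD) simp
  then obtain R where R: "\<And>x. x \<ge> R \<Longrightarrow> x powr \<beta> * (exp (r - x) * theta c r) < 1"
    by (auto simp: eventually_at_top_linorder)
  have le: "x powr \<beta> * theta c x \<le> x powr \<beta> * (exp (r - x) * theta c r)" if "x \<ge> r" for x
    using theta_decay[OF r(1) that] by (intro mult_left_mono) auto
  have "compact {r..max r R}" by simp
  moreover have "continuous_on {r..max r R} (\<lambda>x. x powr \<beta> * (exp (r - x) * theta c r))"
    using r by (intro continuous_intros) auto
  ultimately have "bounded ((\<lambda>x. x powr \<beta> * (exp (r - x) * theta c r)) ` {r..max r R})"
    by (intro compact_imp_bounded compact_continuous_image)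
  then obtain M where M: "\<And>x. x \<in> {r..max r R} \<Longrightarrow> x powr \<beta> * (exp (r - x) * theta c r) \<le> M"
    unfolding bounded_iff by (fastforce simp: abs_le_iff)
  show ?thesis
  proof (rule that[of "max 1 (max (B + 1) M)"])
    fix x :: real assume x: "x > 0"
    consider "x < r" | "r \<le> x" "x \<le> R" | "r \<le> x" "R \<le> x" by linarith
    then show "x powr \<beta> * theta c x \<le> max 1 (max (B + 1) M)"
    proof cases
      case 1
      then show ?thesis using r(2)[OF x] by linarith
    next
      case 2
      then show ?thesis using le[of x] M[of x] by fastforce
    next
      case 3
      then show ?thesis using le[of x] R[of x] by linarith
    qed
  qed simp
qed

text \<open>Tannery's theorem for the sum over multiples: the term for \<open>Suc j\<close> tends to
  \<open>B / Suc j powr \<beta>\<close> and is dominated by \<open>K / Suc j powr \<beta>\<close>,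
  which is summable because \<open>\<beta> > 1\<close>.\<close>

lemma lambert_asymp:
  assumes "\<beta> > 1"
  shows "((\<lambda>t. t powr \<beta> * lambert c t) \<longlongrightarrow> B * riemann_zeta \<beta>) (at_right 0)"
proof -
  obtain K where K: "K \<ge> 0" "\<And>x. x > 0 \<Longrightarrow> x powr \<beta> * theta c x \<le> K"
    using theta_power_bound by blast
  define a where "a j t = t powr \<beta> * theta c (real (Suc j) * t)" for j t
  have a_eq: "a j t = 1 / real (Suc j) powr \<beta> * ((real (Suc j) * t) powr \<beta> * theta c (real (Suc j) * t))" if "t > 0" for j t
    using that by (simp add: a_def powr_mult)
  have 1: "(a j \<longlongrightarrow> 1 / real (Suc j) powr \<beta> * B) (at_right 0)" for j
    using tendsto_powr_rescale[OF lim, of "real (Suc j)"] by (simp add: a_def[abs_def] powr_minus_divide)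
  have bound: "norm (a j t) \<le> 1 / real (Suc j) powr \<beta> * K" if "t > 0" for j t
  proof -
    have "a j t \<ge> 0" using that theta_nonneg by (simp add: a_def)
    moreover have "a j t \<le> 1 / real (Suc j) powr \<beta> * K"
      unfolding a_eq[OF that] using K(2)[of "real (Suc j) * t"] that by (intro mult_left_mono) auto
    ultimately show ?thesis by simp
  qed
  have "eventually (\<lambda>(j, t). norm (a j t) \<le> 1 / real (Suc j) powr \<beta> * K) (at_top \<times>\<^sub>F at_right 0)"
    unfolding eventually_prod_filter
    by (rule exI[of _ "\<lambda>_. True"], rule exI[of _ "\<lambda>t. t > 0"])
       (use bound eventually_at_right_less[of "0::real"] in auto)
  moreover have "summable (\<lambda>j. 1 / real (Suc j) powr \<beta> * K)"
    using riemann_zeta_sums[OF assms] by (intro summable_mult2) (auto simp: sums_iff)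
  ultimately have "((\<lambda>t. \<Sum>j. a j t) \<longlongrightarrow> (\<Sum>j. 1 / real (Suc j) powr \<beta> * B)) (at_right 0)"
    using tannerys_theorem[where a = a and b = "\<lambda>j. 1 / real (Suc j) powr \<beta> * B" and F = "at_right 0", OF 1] by simp
  moreover have "(\<Sum>j. 1 / real (Suc j) powr \<beta> * B) = B * riemann_zeta \<beta>"
    using sums_mult2[OF riemann_zeta_sums[OF assms], of B] by (simp add: sums_iff)
  ultimately have "((\<lambda>t. \<Sum>j. a j t) \<longlongrightarrow> B * riemann_zeta \<beta>) (at_right 0)" by simp
  moreover have "(\<Sum>j. a j t) = t powr \<beta> * lambert c t" if t: "t > 0" for t
  proof -
    have "(\<lambda>j. theta c (real (Suc j) * t)) sums lambert c t"
      unfolding theta_def lambert_def by (rule theta_multiples_sums[OF c t summable_c[OF t]])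
    from sums_mult[OF this, of "t powr \<beta>"] show ?thesis unfolding a_def by (simp add: sums_iff)
  qed
  ultimately show ?thesis by (rule tendsto_at_right_0_cong)
qed

end

end

text \<open>Half of the exponent pays for the extra factor: \<open>part k\<close> is at most
  \<open>2 / t * exp (part k * t / 2)\<close>.\<close>

lemma summable_theta_deriv:
  assumes "t > 0"
  shows "summable (\<lambda>k. part k * exp (- (part k * t)))"
proof (rule summable_comparison_test', rule summable_mult[OF summable_theta])
  show "t / 2 > 0" using assms by simp
  fix k
  have "part k * t / 2 \<le> exp (part k * t / 2)" using exp_ge_add_one_self[of "part k * t / 2"] by linarith
  then have "part k \<le> 2 / t * exp (part k * t / 2)" using assms by (simp add: field_simps)
  then have "part k * exp (- (part k * t)) \<le> 2 / t * exp (part k * t / 2) * exp (- (part k * t))"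
    by (rule mult_right_mono) simp
  also have "\<dots> = 2 / t * (exp (part k * t / 2) * exp (- (part k * t)))" by simp
  also have "exp (part k * t / 2) * exp (- (part k * t)) = exp (- (part k * (t / 2)))" by (simp flip: exp_add)
  finally show "norm (part k * exp (- (part k * t))) \<le> 2 / t * exp (- (part k * (t / 2)))" by simp
qed

end

locale theta_sequence = part_sequence +
  fixes A \<mu> :: real
  assumes mono: "mono \<Lambda>" and \<mu>_pos: "\<mu> > 0" and A_pos: "A > 0"
    and theta_limit: "((\<lambda>t. t powr \<mu> * theta_sum \<Lambda> t) \<longlongrightarrow> A) (at_right 0)"
begin

text \<open>\<open>theta part\<close> is minus the derivative of the theta series. The termwise
  inequality \<open>1 + x \<le> exp x\<close> places it between the difference quotients of step
  \<open>d * t\<close> to either side, so that no series has to be differentiated.\<close>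

lemma theta_deriv_bounds:
  assumes t: "t > 0" and d: "0 < d" "d < 1"
  shows "theta part t \<le> (theta_sum \<Lambda> ((1 - d) * t) - theta_sum \<Lambda> t) / (d * t)"
    and "(theta_sum \<Lambda> t - theta_sum \<Lambda> ((1 + d) * t)) / (d * t) \<le> theta part t"
proof -
  let ?e = "\<lambda>t k. exp (- (part k * t))"
  have s: "summable (?e t)" "summable (?e ((1 - d) * t))" "summable (?e ((1 + d) * t))"
    using t d by (auto intro!: summable_theta)
  have s1: "summable (\<lambda>k. part k * ?e t k * (d * t))" by (intro summable_mult2 summable_theta_deriv t)
  have eq: "(\<Sum>k. part k * ?e t k * (d * t)) = theta part t * (d * t)"
    unfolding theta_def by (rule suminf_mult2[symmetric, OF summable_theta_deriv[OF t]])
  have "(\<Sum>k. part k * ?e t k * (d * t)) \<le> (\<Sum>k. ?e ((1 - d) * t) k - ?e t k)"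
  proof (intro suminf_le s1 summable_diff s)
    fix k
    have "1 + part k * (d * t) \<le> exp (part k * (d * t))" by (rule exp_ge_add_one_self)
    then have "?e t k * (part k * (d * t)) \<le> ?e t k * (exp (part k * (d * t)) - 1)"
      by (intro mult_left_mono; linarith?) simp
    also have "\<dots> = ?e ((1 - d) * t) k - ?e t k" by (simp add: algebra_simps flip: exp_add)
    finally show "part k * ?e t k * (d * t) \<le> ?e ((1 - d) * t) k - ?e t k" by (simp add: mult_ac)
  qed
  also have "\<dots> = theta_sum \<Lambda> ((1 - d) * t) - theta_sum \<Lambda> t"
    unfolding theta_sum_def by (rule suminf_diff[symmetric]) (use s in auto)
  finally show "theta part t \<le> (theta_sum \<Lambda> ((1 - d) * t) - theta_sum \<Lambda> t) / (d * t)"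
    unfolding eq using t d by (simp add: pos_le_divide_eq)
  have "theta_sum \<Lambda> t - theta_sum \<Lambda> ((1 + d) * t) = (\<Sum>k. ?e t k - ?e ((1 + d) * t) k)"
    unfolding theta_sum_def by (rule suminf_diff) (use s in auto)
  also have "\<dots> \<le> (\<Sum>k. part k * ?e t k * (d * t))"
  proof (intro suminf_le s1 summable_diff s)
    fix k
    have "1 + - (part k * (d * t)) \<le> exp (- (part k * (d * t)))" by (rule exp_ge_add_one_self)
    then have le: "1 - exp (- (part k * (d * t))) \<le> part k * (d * t)" by linarith
    have "?e t k - ?e ((1 + d) * t) k = ?e t k * (1 - exp (- (part k * (d * t))))"
      by (simp add: algebra_simps flip: exp_add)
    also have "\<dots> \<le> ?e t k * (part k * (d * t))" by (rule mult_left_mono[OF le]) simp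
    also have "\<dots> = part k * ?e t k * (d * t)" by (simp only: mult_ac)
    finally show "?e t k - ?e ((1 + d) * t) k \<le> part k * ?e t k * (d * t)" .
  qed
  finally show "(theta_sum \<Lambda> t - theta_sum \<Lambda> ((1 + d) * t)) / (d * t) \<le> theta part t"
    unfolding eq using t d by (simp add: pos_divide_le_eq)
qed

text \<open>Asymptotic relations cannot be differentiated in general, but convexity allows it here.
  As \<open>t\<close> tends to 0 the difference quotients give
  \<open>A * ((1 - d) powr (- \<mu>) - 1) / d\<close> and
  \<open>A * (1 - (1 + d) powr (- \<mu>)) / d\<close>, and both tend to \<open>A * \<mu>\<close>
  with \<open>d\<close>.\<close>

lemma theta_deriv_limit:
  "((\<lambda>t. t powr (\<mu> + 1) * theta part t) \<longlongrightarrow> A * \<mu>) (at_right 0)"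
proof (rule order_tendstoI)
  let ?\<phi> = "\<lambda>t. t powr (\<mu> + 1) * theta part t"
  have small: "\<forall>\<^sub>F d in at_right (0::real). 0 < d \<and> d < 1"
    using eventually_at_right_less[of "0::real"] eventually_at_right_real[of 0 1] by (auto elim: eventually_elim2)
  have resc: "t powr (\<mu> + 1) * (x / (d * t)) = t powr \<mu> * x / d" if "t > 0" for t x d :: real
    using that by (simp add: powr_add)
  {
    fix u assume u: "A * \<mu> < u"
    have "((\<lambda>d. A * (((1 - d) powr (- \<mu>) - 1) / d)) \<longlongrightarrow> A * \<mu>) (at_right 0)"
      by real_asymp
    then have "\<forall>\<^sub>F d in at_right 0. A * (((1 - d) powr (- \<mu>) - 1) / d) < u" using u by (rule order_tendstoD)
    from eventually_happens[OF eventually_conj[OF this small]]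
    obtain d where d: "A * (((1 - d) powr (- \<mu>) - 1) / d) < u" "0 < d" "d < 1" by auto
    have "((\<lambda>t. (t powr \<mu> * theta_sum \<Lambda> ((1 - d) * t) - t powr \<mu> * theta_sum \<Lambda> t) / d) \<longlongrightarrow> ((1 - d) powr (- \<mu>) * A - A) / d) (at_right 0)"
      using d by (intro tendsto_intros tendsto_powr_rescale[OF theta_limit] theta_limit) auto
    then have "\<forall>\<^sub>F t in at_right 0. (t powr \<mu> * theta_sum \<Lambda> ((1 - d) * t) - t powr \<mu> * theta_sum \<Lambda> t) / d < u"
      using d by (intro order_tendstoD(2)) (auto simp: algebra_simps)
    then show "\<forall>\<^sub>F t in at_right 0. ?\<phi> t < u" using eventually_at_right_less[of "0::real"]
    proof eventually_elim
      case (elim t)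
      have "?\<phi> t \<le> t powr (\<mu> + 1) * ((theta_sum \<Lambda> ((1 - d) * t) - theta_sum \<Lambda> t) / (d * t))"
        using theta_deriv_bounds(1)[OF elim(2) d(2,3)] by (intro mult_left_mono) auto
      then show ?case using elim(1) unfolding resc[OF elim(2)] by (simp add: right_diff_distrib)
    qed
  next
    fix u assume u: "u < A * \<mu>"
    have "((\<lambda>d. A * ((1 - (1 + d) powr (- \<mu>)) / d)) \<longlongrightarrow> A * \<mu>) (at_right 0)"
      by real_asymp
    then have "\<forall>\<^sub>F d in at_right 0. u < A * ((1 - (1 + d) powr (- \<mu>)) / d)" using u by (rule order_tendstoD)
    from eventually_happens[OF eventually_conj[OF this small]]
    obtain d where d: "u < A * ((1 - (1 + d) powr (- \<mu>)) / d)" "0 < d" "d < 1" by auto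
    have "((\<lambda>t. (t powr \<mu> * theta_sum \<Lambda> t - t powr \<mu> * theta_sum \<Lambda> ((1 + d) * t)) / d) \<longlongrightarrow> (A - (1 + d) powr (- \<mu>) * A) / d) (at_right 0)"
      using d by (intro tendsto_intros tendsto_powr_rescale[OF theta_limit] theta_limit) auto
    then have "\<forall>\<^sub>F t in at_right 0. u < (t powr \<mu> * theta_sum \<Lambda> t - t powr \<mu> * theta_sum \<Lambda> ((1 + d) * t)) / d"
      using d by (intro order_tendstoD(1)) (auto simp: algebra_simps)
    then show "\<forall>\<^sub>F t in at_right 0. u < ?\<phi> t" using eventually_at_right_less[of "0::real"]
    proof eventually_elim
      case (elim t)
      have "t powr (\<mu> + 1) * ((theta_sum \<Lambda> t - theta_sum \<Lambda> ((1 + d) * t)) / (d * t)) \<le> ?\<phi> t"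
        using theta_deriv_bounds(2)[OF elim(2) d(2,3)] by (intro mult_left_mono) auto
      then show ?case using elim(1) unfolding resc[OF elim(2)] by (simp add: right_diff_distrib)
    qed
  }
qed

definition C :: real where
  "C = A * \<mu> * riemann_zeta (\<mu> + 1)"

lemma C_pos: "C > 0"
  using A_pos \<mu>_pos riemann_zeta_pos[of "\<mu> + 1"] by (simp add: C_def)

lemma lambert_parts_limit: "((\<lambda>t. t powr (\<mu> + 1) * lambert part t) \<longlongrightarrow> C) (at_right 0)"
  unfolding C_def
  by (rule lambert_asymp) (use theta_deriv_limit summable_theta_deriv \<mu>_pos in auto)

sublocale partition_recurrence partition_count "divisor_weight part" C "\<mu> + 1"
proof
  show "laplace_asymp (divisor_weight part) C (\<mu> + 1)"
    by (rule laplace_asymp_divisor_weightI) (use lambert_parts_limit summable_theta_deriv in auto)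
  show "1 < \<mu> + 1" using \<mu>_pos by simp
qed (fact partition_count_pos mono_partition_count partition_count_recurrence C_pos)+

lemma mean_summands_eq: "mean_summands \<Lambda> n = avg (divisor_weight (\<lambda>k. 1)) n"
  unfolding mean_summands_def partition_moment_0 partition_moment_1 avg_def ratio_def
  by (simp add: sum_divide_distrib)

section \<open>Existence, uniqueness and size of the saddle point\<close>

lemma lambert_parts_strict_antimono:
  assumes "0 < u" "u < v"
  shows "lambert part v < lambert part u"
proof -
  have s: "summable (\<lambda>k. part k / (exp (t * part k) - 1))" if "t > 0" for t
    by (rule summable_lambert) (use that summable_theta_deriv in auto)
  have "0 < (\<Sum>k. part k / (exp (u * part k) - 1) - part k / (exp (v * part k) - 1))"
  proof (rule suminf_pos)
    fix k
    have "part k > 0" using pos by simp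
    then show "0 < part k / (exp (u * part k) - 1) - part k / (exp (v * part k) - 1)"
      using assms by (auto intro!: divide_strict_left_mono mult_pos_pos)
  qed (use assms s in \<open>auto intro!: summable_diff\<close>)
  also have "\<dots> = lambert part u - lambert part v"
    unfolding lambert_def by (rule suminf_diff[symmetric]) (use assms s in auto)
  finally show ?thesis by simp
qed

text \<open>In the variable \<open>x = exp (- t)\<close> the Lambert series is a power series, hence
  continuous on \<open>{0..<1}\<close>. It vanishes at 0 because \<open>divisor_weight\<close> does,
  and it exceeds \<open>n\<close> near 1 by \<open>lambert_parts_limit\<close>, so the intermediate
  value theorem applies.\<close>

lemma lambert_parts_surj:
  assumes "n > 0"
  obtains a where "a > 0" "lambert part a = real n"
proof -
  define s where "s = divisor_weight part"
  define G where "G x = (\<Sum>l. s l * x ^ l)" for x :: real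
  have pw: "s l * exp (- t) ^ l = s l * exp (- (t * real l))" for l t
    by (simp add: mult.commute flip: exp_of_nat_mult)
  have GF: "G (exp (- t)) = lambert part t" if "t > 0" for t
    using divisor_weight_laplace(1)[of "\<lambda>k. part k" t] summable_theta_deriv that
    unfolding G_def pw unfolding s_def by (simp add: laplace_def)
  have summ: "summable (\<lambda>l. s l * exp (- t) ^ l)" if "t > 0" for t
    unfolding pw unfolding s_def by (rule divisor_weight_laplace(2)) (use that summable_theta_deriv in auto)
  have cont: "isCont G x" if "0 \<le> x" "x < 1" for x
  proof -
    define y where "y = (x + 1) / 2"
    have y: "0 < y" "y < 1" "x < y" using that by (auto simp: y_def)
    have "summable (\<lambda>l. s l * exp (- (- ln y)) ^ l)" by (rule summ) (use y in auto)
    then have "summable (\<lambda>l. s l * y ^ l)" using y by simp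
    then show ?thesis unfolding G_def by (rule isCont_powser) (use that y in auto)
  qed
  have "\<forall>\<^sub>F t in at_right 0. t powr (\<mu> + 1) * lambert part t > C / 2"
    using lambert_parts_limit C_pos by (intro order_tendstoD(1)) auto
  moreover have "\<forall>\<^sub>F t in at_right 0. t powr (\<mu> + 1) < C / (2 * real n)"
  proof -
    have "((\<lambda>t. t powr (\<mu> + 1)) \<longlongrightarrow> 0) (at_right 0)" using \<mu>_pos by real_asymp
    then show ?thesis using C_pos assms by (intro order_tendstoD(2)) auto
  qed
  ultimately have "\<forall>\<^sub>F t in at_right 0. t > 0 \<and> lambert part t > real n"
    using eventually_at_right_less[of "0::real"]
  proof eventually_elim
    case (elim t)
    have "t powr (\<mu> + 1) * real n < C / 2" using elim(2) assms by (simp add: field_simps)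
    also note elim(1)
    finally show ?case using elim(3) by (simp add: mult_less_cancel_left_pos)
  qed
  from eventually_happens[OF this] obtain t where t: "t > 0" "lambert part t > real n" by auto
  have "G 0 = 0"
    unfolding G_def by (simp add: powser_zero s_def divisor_weight_def)
  then have "\<exists>x\<ge>0. x \<le> exp (- t) \<and> G x = real n"
    using t GF[of t] cont le_less_trans[of _ "exp (- t)" 1] by (intro IVT) auto
  then obtain x where x: "0 \<le> x" "x \<le> exp (- t)" "G x = real n" by blast
  have "x \<noteq> 0" using \<open>G 0 = 0\<close> x assms by auto
  then have "x > 0" using x by simp
  moreover have "x < 1" using x t by (meson exp_less_one_iff le_less_trans neg_less_0_iff_less)
  ultimately show ?thesis using GF[of "- ln x"] x by (intro that[of "- ln x"]) auto
qed

lemma saddle_point: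
  assumes "n > 0"
  shows "saddle_point \<Lambda> n > 0" "lambert part (saddle_point \<Lambda> n) = real n"
proof -
  have sums_iff': "(\<lambda>k. part k / (exp (a * part k) - 1)) sums x \<longleftrightarrow> lambert part a = x" if "a > 0" for a x
    using summable_lambert[of "\<lambda>k. part k" a] that summable_theta_deriv[of a] by (simp add: lambert_def sums_iff)
  have "\<exists>!a. 0 < a \<and> (\<lambda>k. part k / (exp (a * part k) - 1)) sums real n"
  proof (rule ex_ex1I)
    show "\<exists>a. 0 < a \<and> (\<lambda>k. part k / (exp (a * part k) - 1)) sums real n"
      using lambert_parts_surj[OF assms] sums_iff' by metis
    fix a b
    assume "0 < a \<and> (\<lambda>k. part k / (exp (a * part k) - 1)) sums real n"
      "0 < b \<and> (\<lambda>k. part k / (exp (b * part k) - 1)) sums real n"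
    then show "a = b" using lambert_parts_strict_antimono[of a b] lambert_parts_strict_antimono[of b a]
      by (cases a b rule: linorder_cases) (auto simp: sums_iff')
  qed
  from theI'[OF this] show "saddle_point \<Lambda> n > 0" "lambert part (saddle_point \<Lambda> n) = real n"
    by (auto simp: saddle_point_def sums_iff')
qed

lemma saddle_point_tendsto_0: "filterlim (saddle_point \<Lambda>) (at_right 0) sequentially"
  unfolding filterlim_at
proof (intro conjI tendstoI)
  show "\<forall>\<^sub>F n in sequentially. saddle_point \<Lambda> n \<in> {0<..} \<and> saddle_point \<Lambda> n \<noteq> 0"
    using eventually_gt_at_top[of 0]
  proof eventually_elim
    case (elim n)
    then show ?case using saddle_point(1)[of n] by simp
  qed
  fix e :: real assume e: "e > 0"
  obtain m :: nat where m: "lambert part e < real m" using reals_Archimedean2 by blast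
  show "\<forall>\<^sub>F n in sequentially. dist (saddle_point \<Lambda> n) 0 < e"
    using eventually_ge_at_top[of "Suc m"]
  proof eventually_elim
    case (elim n)
    then have n: "n > 0" "real n \<ge> real m" by auto
    have "saddle_point \<Lambda> n < e"
    proof (rule ccontr)
      assume "\<not> saddle_point \<Lambda> n < e"
      then have "e < saddle_point \<Lambda> n \<or> e = saddle_point \<Lambda> n" by linarith
      then have "lambert part (saddle_point \<Lambda> n) \<le> lambert part e"
        using lambert_parts_strict_antimono[OF e] by (auto simp: less_imp_le)
      then show False using saddle_point(2)[OF n(1)] m n(2) by linarith
    qed
    then show ?case using saddle_point(1)[OF n(1)] by simp
  qed
qed

text \<open>The limit is evaluated at the saddle point, where the Lambert series equals
  \<open>n\<close>. It allows powers of \<open>n\<close> to be exchanged for powers of the saddle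
  point.\<close>

lemma saddle_point_asymp: "(\<lambda>n. saddle_point \<Lambda> n powr (\<mu> + 1) * real n) \<longlonglongrightarrow> C"
proof (rule Lim_transform_eventually)
  show "(\<lambda>n. saddle_point \<Lambda> n powr (\<mu> + 1) * lambert part (saddle_point \<Lambda> n)) \<longlonglongrightarrow> C"
    by (rule filterlim_compose[OF lambert_parts_limit saddle_point_tendsto_0])
  show "\<forall>\<^sub>F n in sequentially. saddle_point \<Lambda> n powr (\<mu> + 1) * lambert part (saddle_point \<Lambda> n)
      = saddle_point \<Lambda> n powr (\<mu> + 1) * real n"
    using eventually_gt_at_top[of 0] by eventually_elim (simp add: saddle_point(2))
qed

lemma avg_saddle_asymp:
  assumes "laplace_asymp g c b" "0 < b" "b < \<mu> + 1" "c > 0"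
  shows "(\<lambda>n. avg g n * saddle_point \<Lambda> n powr b) \<longlonglongrightarrow> c"
proof -
  have "(\<lambda>n. (avg g n / real n powr (b / (\<mu> + 1))) * (saddle_point \<Lambda> n powr (\<mu> + 1) * real n) powr (b / (\<mu> + 1)))
      \<longlonglongrightarrow> c * C powr (- (b / (\<mu> + 1))) * C powr (b / (\<mu> + 1))"
    using C_pos by (intro tendsto_mult avg_asymptotics assms tendsto_powr saddle_point_asymp tendsto_const) auto
  also have "c * C powr (- (b / (\<mu> + 1))) * C powr (b / (\<mu> + 1)) = c"
    using C_pos by (simp add: powr_minus)
  finally show ?thesis
  proof (rule Lim_transform_eventually)
    show "\<forall>\<^sub>F n in sequentially. (avg g n / real n powr (b / (\<mu> + 1))) * (saddle_point \<Lambda> n powr (\<mu> + 1) * real n) powr (b / (\<mu> + 1))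
        = avg g n * saddle_point \<Lambda> n powr b"
      using eventually_gt_at_top[of 0]
    proof eventually_elim
      case (elim n)
      then show ?case using saddle_point(1)[OF elim] \<mu>_pos by (simp add: powr_mult powr_powr)
    qed
  qed
qed

theorem mean_summands_large:
  assumes "\<mu> > 1"
  shows "(\<lambda>n. mean_summands \<Lambda> n * saddle_point \<Lambda> n powr \<mu>) \<longlonglongrightarrow> A * riemann_zeta \<mu>"
  unfolding mean_summands_eq
proof (rule avg_saddle_asymp)
  show "laplace_asymp (divisor_weight (\<lambda>k. 1)) (A * riemann_zeta \<mu>) \<mu>"
    by (intro laplace_asymp_divisor_weightI lambert_asymp)
       (use assms theta_limit summable_theta in \<open>auto simp: theta_1\<close>)
qed (use assms A_pos riemann_zeta_pos in auto)

text \<open>The theta series at \<open>1 / part k\<close> counts parts: \<open>\<Lambda>\<close> is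
  nondecreasing, so its first \<open>k + 1\<close> terms are at least \<open>exp (- 1)\<close>, and
  \<open>k + 1\<close> is at most a multiple of \<open>part k powr \<mu>\<close>. The series is then
  dominated by the zeta series at \<open>s / \<mu> > 1\<close>.\<close>

lemma summable_parts_powr:
  assumes "s > \<mu>"
  shows "summable (\<lambda>k. part k powr (- s))"
proof -
  obtain K where K: "K \<ge> 0" "\<And>x. x > 0 \<Longrightarrow> x powr \<mu> * theta (\<lambda>k. 1) x \<le> K"
    using theta_power_bound[of "\<lambda>k. 1" \<mu> A] theta_limit summable_theta by (auto simp: theta_1)
  define K' where "K' = max 1 (exp 1 * K)"
  have count: "real (Suc k) \<le> K' * part k powr \<mu>" for k
  proof -
    define x where "x = 1 / part k"
    have x: "x > 0" using pos by (simp add: x_def)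
    have "real (Suc k) = (\<Sum>i\<le>k. 1)" by simp
    also have "\<dots> \<le> (\<Sum>i\<le>k. exp 1 * exp (- (part i * x)))"
    proof (rule sum_mono)
      fix i assume "i \<in> {..k}"
      then have "part i * x \<le> 1" using monoD[OF mono, of i k] pos[of k] by (simp add: x_def)
      then have "exp 0 \<le> exp (1 + - (part i * x))" by (subst exp_le_cancel_iff) simp
      then show "1 \<le> exp 1 * exp (- (part i * x))" unfolding exp_add by simp
    qed
    also have "\<dots> \<le> exp 1 * theta (\<lambda>k. 1) x"
      unfolding sum_distrib_left[symmetric] theta_def
      by (intro mult_left_mono) (use summable_theta[OF x] in \<open>auto intro!: sum_le_suminf\<close>)
    also have "theta (\<lambda>k. 1) x = part k powr \<mu> * (x powr \<mu> * theta (\<lambda>k. 1) x)"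
      using pos[of k] by (simp add: x_def powr_divide)
    also have "exp 1 * \<dots> \<le> exp 1 * (part k powr \<mu> * K)"
      by (intro mult_left_mono K x) auto
    also have "\<dots> \<le> K' * part k powr \<mu>" unfolding K'_def by (simp add: mult_ac mult_left_mono max_mult_distrib_left)
    finally show ?thesis .
  qed
  have K': "K' > 0" by (simp add: K'_def)
  have s: "s / \<mu> > 1" using assms \<mu>_pos by simp
  show ?thesis
  proof (rule summable_comparison_test', rule summable_mult)
    show "summable (\<lambda>k. 1 / real (Suc k) powr (s / \<mu>))" using riemann_zeta_sums[OF s] by (simp add: sums_iff)
    fix k
    have L: "part k > 0" using pos by simp
    have "real (Suc k) powr (s / \<mu>) \<le> (K' * part k powr \<mu>) powr (s / \<mu>)"
      using s by (intro powr_mono2 count) auto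
    also have "\<dots> = K' powr (s / \<mu>) * part k powr s"
      using K' L \<mu>_pos by (simp add: powr_mult powr_powr)
    finally show "norm (part k powr - s) \<le> K' powr (s / \<mu>) * (1 / real (Suc k) powr (s / \<mu>))"
      using L by (simp add: powr_minus field_simps)
  qed
qed

text \<open>Tannery's theorem with the majorant \<open>1 / part k\<close>, which comes from
  \<open>x \<le> exp x - 1\<close> and is summable because \<open>\<mu> < 1\<close>.\<close>

lemma lambert_small_limit:
  assumes "\<mu> < 1"
  shows "((\<lambda>t. t powr 1 * lambert (\<lambda>k. 1) t) \<longlongrightarrow> (\<Sum>k. 1 / part k)) (at_right 0)"
proof -
  define a where "a k t = t / (exp (t * part k) - 1)" for k t
  have s: "summable (\<lambda>k. 1 / part k)"
    using summable_parts_powr[OF assms] pos by (simp add: powr_minus_divide)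
  have L: "part k > 0" for k using pos by simp
  have 1: "(a k \<longlongrightarrow> 1 / part k) (at_right 0)" for k
  proof -
    have "(a k \<longlongrightarrow> inverse (part k)) (at_right 0)" unfolding a_def using L[of k] by real_asymp
    then show ?thesis by (simp add: inverse_eq_divide)
  qed
  have bound: "norm (a k t) \<le> 1 / part k" if "t > 0" for k t
  proof -
    have "t * part k \<le> exp (t * part k) - 1" using exp_ge_add_one_self[of "t * part k"] by linarith
    moreover have "t * part k > 0" using that L by simp
    ultimately show ?thesis using that L[of k] by (simp add: a_def field_simps)
  qed
  have "eventually (\<lambda>(k, t). norm (a k t) \<le> 1 / part k) (at_top \<times>\<^sub>F at_right 0)"
    unfolding eventually_prod_filter
    by (rule exI[of _ "\<lambda>_. True"], rule exI[of _ "\<lambda>t. t > 0"])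
       (use bound eventually_at_right_less[of "0::real"] in auto)
  then have "((\<lambda>t. \<Sum>k. a k t) \<longlongrightarrow> (\<Sum>k. 1 / part k)) (at_right 0)"
    using tannerys_theorem[where a = a and b = "\<lambda>k. 1 / part k" and F = "at_right 0", OF 1 _ s] by simp
  then show ?thesis
  proof (rule tendsto_at_right_0_cong)
    fix t :: real assume t: "t > 0"
    have "summable (\<lambda>k. 1 / (exp (t * part k) - 1))"
      by (rule summable_lambert) (use t summable_theta in auto)
    from suminf_mult[OF this, of t] show "(\<Sum>k. a k t) = t powr 1 * lambert (\<lambda>k. 1) t"
      using t by (simp add: a_def lambert_def)
  qed
qed

theorem mean_summands_small:
  assumes "\<mu> < 1"
  shows "(\<lambda>n. mean_summands \<Lambda> n * saddle_point \<Lambda> n) \<longlonglongrightarrow> (\<Sum>k. 1 / part k)"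
    and "(\<Sum>k. 1 / part k) > 0"
proof -
  have s: "summable (\<lambda>k. 1 / part k)"
    using summable_parts_powr[OF assms] pos by (simp add: powr_minus_divide)
  show S: "(\<Sum>k. 1 / part k) > 0" using pos by (intro suminf_pos s) auto
  have "(\<lambda>n. mean_summands \<Lambda> n * saddle_point \<Lambda> n powr 1) \<longlonglongrightarrow> (\<Sum>k. 1 / part k)"
    unfolding mean_summands_eq
    by (intro avg_saddle_asymp laplace_asymp_divisor_weightI lambert_small_limit)
       (use assms S \<mu>_pos summable_theta in auto)
  then show "(\<lambda>n. mean_summands \<Lambda> n * saddle_point \<Lambda> n) \<longlonglongrightarrow> (\<Sum>k. 1 / part k)"
  proof (rule Lim_transform_eventually)
    show "\<forall>\<^sub>F n in sequentially. mean_summands \<Lambda> n * saddle_point \<Lambda> n powr 1 = mean_summands \<Lambda> n * saddle_point \<Lambda> n"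
      using eventually_gt_at_top[of 0]
    proof eventually_elim
      case (elim n)
      then show ?case using saddle_point(1)[OF elim] by simp
    qed
  qed
qed

section \<open>The critical exponent 1\<close>

definition counting :: "nat \<Rightarrow> nat" where
  "counting x = card {k. \<Lambda> k \<le> x}"

text \<open>The Laplace transform of the multiplicities \<open>g\<close> is the theta series itself,
  and their partial sums are the counting function.\<close>

lemma counting_limit: "(\<lambda>x. real (counting x) / real x powr \<mu>) \<longlonglongrightarrow> A / Gamma (\<mu> + 1)"
proof -
  define g where "g l = real (card {k. \<Lambda> k = l})" for l
  have fin: "finite {k. \<Lambda> k = l}" for l by (rule finite_subset[OF _ finite_parts_le[of l]]) auto
  have sums: "(\<lambda>l. g l * exp (- (t * real l))) sums theta_sum \<Lambda> t" if t: "t > 0" for t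
  proof -
    have bij: "bij_betw (\<lambda>k. (\<Lambda> k, k)) UNIV (Sigma UNIV (\<lambda>l. {k. \<Lambda> k = l}))"
      by (intro bij_betwI[where g = snd]) auto
    have "((\<lambda>k. exp (- (part k * t))) has_sum theta_sum \<Lambda> t) UNIV"
      unfolding theta_sum_def by (intro sums_nonneg_imp_has_sum summable_sums summable_theta t) simp
    then have "((\<lambda>(l, k). exp (- (t * real l))) has_sum theta_sum \<Lambda> t) (Sigma UNIV (\<lambda>l. {k. \<Lambda> k = l}))"
      unfolding has_sum_reindex_bij_betw[OF bij, symmetric] by (simp add: mult.commute)
    then have "((\<lambda>l. g l * exp (- (t * real l))) has_sum theta_sum \<Lambda> t) UNIV"
      by (rule has_sum_SigmaD) (auto simp: g_def intro!: has_sum_finiteI fin)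
    then show ?thesis by (rule has_sum_imp_sums)
  qed
  have "((\<lambda>t. t powr \<mu> * laplace g t) \<longlongrightarrow> A) (at_right 0)"
    by (rule tendsto_at_right_0_cong[OF theta_limit]) (use sums in \<open>simp add: laplace_def sums_iff\<close>)
  then have "laplace_asymp g A \<mu>" using sums by (auto simp: laplace_asymp_def g_def sums_iff)
  from karamata[OF this \<mu>_pos]
  have "(\<lambda>n. (\<Sum>l\<le>n. g l) / real n powr \<mu>) \<longlonglongrightarrow> A / Gamma (\<mu> + 1)" .
  moreover have "(\<Sum>l\<le>n. g l) = real (counting n)" for n
  proof -
    have "{k. \<Lambda> k \<le> n} = (\<Union>l\<in>{..n}. {k. \<Lambda> k = l})" by auto
    also have "card \<dots> = (\<Sum>l\<in>{..n}. card {k. \<Lambda> k = l})" by (intro card_UN_disjoint) (auto simp: fin)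
    finally show ?thesis by (simp add: g_def counting_def)
  qed
  ultimately show ?thesis by simp
qed

text \<open>Both sides count the pairs of a multiplier \<open>j\<close> and a position
  \<open>k\<close> with \<open>j * \<Lambda> k \<le> x\<close>, on the left by the product
  \<open>l\<close> and on the right by \<open>j\<close>.\<close>

lemma divisor_weight_partial_sum:
  "(\<Sum>l\<le>x. divisor_weight (\<lambda>k. 1) l) = (\<Sum>j=1..x. real (counting (x div j)))"
proof -
  have "(\<Sum>l\<le>x. divisor_weight (\<lambda>k. 1) l) = (\<Sum>l=1..x. real (card {k. \<Lambda> k dvd l}))"
    by (intro sum.mono_neutral_cong_right) (auto simp: divisor_weight_def)
  also have "\<dots> = real (card (Sigma {1..x} (\<lambda>l. {k. \<Lambda> k dvd l})))"
    by (subst card_SigmaI) (auto intro: finite_divisors)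
  also have "card (Sigma {1..x} (\<lambda>l. {k. \<Lambda> k dvd l})) = card (Sigma {1..x} (\<lambda>j. {k. \<Lambda> k \<le> x div j}))"
  proof (intro bij_betw_same_card bij_betwI[where g = "\<lambda>(j, k). (j * \<Lambda> k, k)"])
    have D: "\<Lambda> k > 0" for k by (rule pos)
    show "(\<lambda>(l, k). (l div \<Lambda> k, k)) \<in> Sigma {1..x} (\<lambda>l. {k. \<Lambda> k dvd l}) \<rightarrow> Sigma {1..x} (\<lambda>j. {k. \<Lambda> k \<le> x div j})"
    proof (clarsimp, intro conjI)
      fix l k assume lk: "Suc 0 \<le> l" "l \<le> x" "\<Lambda> k dvd l"
      then obtain j where j: "l = \<Lambda> k * j" by (auto elim: dvdE)
      then have j0: "j > 0" using lk(1) by (cases j) auto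
      show "l div \<Lambda> k \<le> x" using lk(2) by (rule order.trans[OF div_le_dividend])
      show "Suc 0 \<le> l div \<Lambda> k" "\<Lambda> k \<le> x div (l div \<Lambda> k)"
        using j j0 lk(2) D[of k] by (simp_all add: less_eq_div_iff_mult_less_eq Suc_le_eq)
    qed
    show "(\<lambda>(j, k). (j * \<Lambda> k, k)) \<in> Sigma {1..x} (\<lambda>j. {k. \<Lambda> k \<le> x div j}) \<rightarrow> Sigma {1..x} (\<lambda>l. {k. \<Lambda> k dvd l})"
      using D by (auto simp: less_eq_div_iff_mult_less_eq mult.commute Suc_le_eq)
  qed (use pos in \<open>auto elim!: dvdE simp: less_imp_neq\<close>)
  also have "\<dots> = (\<Sum>j=1..x. card {k. \<Lambda> k \<le> x div j})"
    by (subst card_SigmaI) (auto intro: finite_parts_le)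
  finally show ?thesis by (simp add: counting_def)
qed

text \<open>Dropping the floors costs at most 1 for each of the \<open>x\<close> terms, and the
  harmonic number exceeds \<open>ln x\<close> by at most 1.\<close>

lemma sum_div_bounds:
  "\<bar>(\<Sum>j=1..x. real (x div j)) - real x * ln (real x)\<bar> \<le> 2 * real x"
proof (cases "x = 0")
  case False
  define H where "H = (\<Sum>j=1..x. 1 / real j)"
  have H: "H = harm x" by (simp add: H_def harm_def inverse_eq_divide)
  have "ln (real x) \<le> H" using order_trans[of "ln (real x)" "ln (real x + 1)" "harm x"] ln_le_harm[of x] False unfolding H by simp
  moreover have "H \<le> ln (real x) + 1"
  proof -
    have "harm x - ln (real x) \<le> harm 1 - ln (real 1)"
      using decseqD[OF decseq_harm_diff_ln, of 0 "x - 1"] False by simp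
    then show ?thesis by (simp add: H harm_def)
  qed
  ultimately have "\<bar>real x * H - real x * ln (real x)\<bar> \<le> real x"
    by (simp add: abs_mult flip: right_diff_distrib) (simp add: mult_left_le)
  moreover have "\<bar>(\<Sum>j=1..x. real (x div j)) - real x * H\<bar> \<le> real x"
  proof -
    have "(\<Sum>j=1..x. real (x div j)) - real x * H = (\<Sum>j=1..x. real (x div j) - real x / real j)"
      by (simp add: H_def sum_distrib_left sum_subtractf)
    also have "\<bar>\<dots>\<bar> \<le> (\<Sum>j=1..x. 1)"
    proof (rule order_trans[OF sum_abs], rule sum_mono)
      fix j assume "j \<in> {1..x}"
      then have j: "j > 0" by simp
      show "\<bar>real (x div j) - real x / real j\<bar> \<le> 1"
        using floor_correct[of "real x / real j"] unfolding floor_divide_of_nat_eq[of x j] by simp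
    qed
    finally show ?thesis by simp
  qed
  ultimately show ?thesis by linarith
qed simp

text \<open>Growth like \<open>x * ln x\<close> lies outside the power scale of
  \<open>laplace_asymp\<close>, so the partial sums are estimated directly. The counting error
  \<open>\<epsilon> * y + B\<close> at \<open>y = x div j\<close>, summed over \<open>j\<close>, is
  a small multiple of \<open>x * ln x\<close> up to a linear term, and the linear term costs a first
  moment.\<close>

lemma avg_divisor_weight_critical:
  assumes "\<mu> = 1" "\<epsilon> > 0"
  obtains K where "\<And>n. \<bar>avg (divisor_weight (\<lambda>k. 1)) n - A * (\<Sum>l\<le>n. weight n l * (real l * ln (real l)))\<bar>
    \<le> \<epsilon> * (\<Sum>l\<le>n. weight n l * (real l * ln (real l))) + K * moment 1 n"
proof -
  have "(\<lambda>x. real (counting x) / real x powr 1) \<longlonglongrightarrow> A"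
    using counting_limit assms(1) by (simp add: Gamma_numeral)
  from powr_ratio_bound[OF this assms(2)]
  obtain B where bound: "\<And>x. \<bar>real (counting x) - A * real x\<bar> \<le> \<epsilon> * real x + B" by auto
  \<comment> \<open>\<open>B\<close> collects the additive counting errors of \<open>x\<close>
    terms; \<open>2 * A\<close> and \<open>2 * \<epsilon>\<close> come from replacing
    \<open>S\<close> by \<open>x * ln x\<close> in the main term and in the error.\<close>
  define K where "K = B + 2 * A + 2 * \<epsilon>"
  have partial: "\<bar>(\<Sum>l\<le>x. divisor_weight (\<lambda>k. 1) l) - A * (real x * ln (real x))\<bar> \<le> \<epsilon> * (real x * ln (real x)) + K * real x" for x
  proof -
    define S where "S = (\<Sum>j=1..x. real (x div j))"
    have "\<bar>(\<Sum>l\<le>x. divisor_weight (\<lambda>k. 1) l) - A * S\<bar> = \<bar>\<Sum>j=1..x. real (counting (x div j)) - A * real (x div j)\<bar>"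
      by (simp add: divisor_weight_partial_sum S_def sum_distrib_left sum_subtractf)
    also have "\<dots> \<le> (\<Sum>j=1..x. \<epsilon> * real (x div j) + B)"
      by (rule order_trans[OF sum_abs]) (intro sum_mono bound)
    also have "\<dots> = \<epsilon> * S + B * real x" by (simp add: S_def sum.distrib sum_distrib_left)
    finally have 1: "\<bar>(\<Sum>l\<le>x. divisor_weight (\<lambda>k. 1) l) - A * S\<bar> \<le> \<epsilon> * S + B * real x" .
    have S: "\<bar>S - real x * ln (real x)\<bar> \<le> 2 * real x" unfolding S_def by (rule sum_div_bounds)
    have "\<bar>A * S - A * (real x * ln (real x))\<bar> = A * \<bar>S - real x * ln (real x)\<bar>"
      using A_pos by (simp add: abs_mult flip: right_diff_distrib)
    also have "\<dots> \<le> A * (2 * real x)" using S A_pos by (intro mult_left_mono) auto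
    finally have 2: "\<bar>A * S - A * (real x * ln (real x))\<bar> \<le> A * (2 * real x)" .
    have "\<epsilon> * S \<le> \<epsilon> * (real x * ln (real x) + 2 * real x)" using S assms(2) by (intro mult_left_mono) auto
    then show ?thesis using 1 2 unfolding K_def by (simp add: algebra_simps)
  qed
  show ?thesis
  proof (rule that[of K])
    fix n
    have "avg (divisor_weight (\<lambda>k. 1)) n - A * (\<Sum>l\<le>n. weight n l * (real l * ln (real l)))
        = (\<Sum>l\<le>n. weight n l * ((\<Sum>i\<le>l. divisor_weight (\<lambda>k. 1) i) - A * (real l * ln (real l))))"
      unfolding avg_by_parts by (simp add: sum_distrib_left sum_subtractf right_diff_distrib mult_ac)
    also have "\<bar>\<dots>\<bar> \<le> (\<Sum>l\<le>n. weight n l * (\<epsilon> * (real l * ln (real l)) + K * real l))"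
      by (rule order_trans[OF sum_abs], rule sum_mono)
         (simp add: abs_mult weight_nonneg, intro mult_left_mono partial weight_nonneg)
    also have "\<dots> = \<epsilon> * (\<Sum>l\<le>n. weight n l * (real l * ln (real l))) + K * moment 1 n"
      unfolding moment_def distrib_left sum.distrib sum_distrib_left by (simp add: mult_ac)
    finally show "\<bar>avg (divisor_weight (\<lambda>k. 1)) n - A * (\<Sum>l\<le>n. weight n l * (real l * ln (real l)))\<bar>
      \<le> \<epsilon> * (\<Sum>l\<le>n. weight n l * (real l * ln (real l))) + K * moment 1 n" .
  qed
qed

text \<open>The partial sums of the constant sequence are \<open>l + 1\<close>, so
  \<open>avg_saddle_asymp\<close> turns this into the first moment of the index.\<close>

lemma laplace_asymp_one: "laplace_asymp (\<lambda>l. 1) 1 1"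
proof -
  have sums: "(\<lambda>l. 1 * exp (- (t * real l))) sums (1 / (1 - exp (- t)))" if "t > 0" for t
    using geometric_sums[of "exp (- t)"] that by (simp add: mult.commute flip: exp_of_nat_mult)
  have "((\<lambda>t::real. t powr 1 * (1 / (1 - exp (- t)))) \<longlongrightarrow> 1) (at_right 0)" by real_asymp
  then have "((\<lambda>t. t powr 1 * laplace (\<lambda>l. 1) t) \<longlongrightarrow> 1) (at_right 0)"
    by (rule tendsto_at_right_0_cong) (use sums in \<open>simp add: laplace_def sums_iff\<close>)
  then show ?thesis using sums by (auto simp: laplace_asymp_def sums_iff)
qed

text \<open>Relative to \<open>1 / \<alpha> n\<close> the index has bounded second moment. Replacing
  \<open>ln l\<close> by \<open>\<xi> n\<close> therefore changes the mean of
  \<open>l * ln l\<close> by a term of order \<open>1 / \<alpha> n\<close>, whereas the mean itself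
  is of order \<open>\<xi> n / \<alpha> n\<close>.\<close>

theorem mean_summands_critical:
  assumes \<mu>: "\<mu> = 1"
  shows "(\<lambda>n. mean_summands \<Lambda> n * saddle_point \<Lambda> n / ln (1 / saddle_point \<Lambda> n)) \<longlonglongrightarrow> A"
proof -
  define \<alpha> where "\<alpha> = saddle_point \<Lambda>"
  define \<xi> where "\<xi> n = ln (1 / \<alpha> n)" for n
  define Q where "Q n = (\<Sum>l\<le>n. weight n l * (real l * ln (real l)))" for n
  have \<alpha>0: "filterlim \<alpha> (at_right 0) sequentially" unfolding \<alpha>_def by (rule saddle_point_tendsto_0)
  have \<alpha>_lim: "\<alpha> \<longlonglongrightarrow> 0" using \<alpha>0 by (simp add: filterlim_at)
  have \<xi>: "filterlim \<xi> at_top sequentially"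
    unfolding \<xi>_def by (rule filterlim_compose[OF _ \<alpha>0]) real_asymp
  have \<xi>': "(\<lambda>n. c / \<xi> n) \<longlonglongrightarrow> 0" for c
    by (rule real_tendsto_divide_at_top[OF tendsto_const \<xi>])
  \<comment> \<open>The average of the constant sequence is \<open>moment 1 n + 1\<close>; the
    subtracted \<open>\<alpha> n\<close> removes the extra 1 after scaling.\<close>
  have "(\<lambda>n. avg (\<lambda>l. 1) n * \<alpha> n powr 1 - \<alpha> n) \<longlonglongrightarrow> 1 - 0"
    unfolding \<alpha>_def by (intro tendsto_diff avg_saddle_asymp laplace_asymp_one) (use \<mu> \<alpha>_lim[unfolded \<alpha>_def] in auto)
  moreover have "\<forall>\<^sub>F n in sequentially. avg (\<lambda>l. 1) n * \<alpha> n powr 1 - \<alpha> n = moment 1 n * \<alpha> n"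
    using eventually_gt_at_top[of 0]
  proof eventually_elim
    case (elim n)
    have "avg (\<lambda>l. 1) n = moment 1 n + 1"
      unfolding avg_by_parts moment_def using sum_weight[of n] by (simp add: distrib_left sum.distrib)
    then show ?case using saddle_point(1)[OF elim] by (simp add: \<alpha>_def algebra_simps)
  qed
  ultimately have M1: "(\<lambda>n. moment 1 n * \<alpha> n) \<longlonglongrightarrow> 1" using Lim_transform_eventually by fastforce
  obtain K2 where K2: "K2 \<ge> 0" "\<And>n. n \<ge> 1 \<Longrightarrow> moment 2 n \<le> K2 * real n powr (2 / (\<mu> + 1))"
    using moment_bound[of 2] by auto
  have Q: "(\<lambda>n. Q n * \<alpha> n / \<xi> n) \<longlonglongrightarrow> 1"
  proof -
    have "(\<lambda>n. Q n * \<alpha> n / \<xi> n - moment 1 n * \<alpha> n) \<longlonglongrightarrow> 0"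
    proof (rule Lim_null_comparison)
      have "(\<lambda>n. (K2 * (\<alpha> n powr (\<mu> + 1) * real n) + 1) * (1 / \<xi> n)) \<longlonglongrightarrow> (K2 * C + 1) * 0"
        unfolding \<alpha>_def by (intro tendsto_intros saddle_point_asymp \<xi>')
      then show "(\<lambda>n. (K2 * (\<alpha> n powr (\<mu> + 1) * real n) + 1) * (1 / \<xi> n)) \<longlonglongrightarrow> 0" by simp
      have "\<forall>\<^sub>F n in sequentially. \<xi> n > 0" using \<xi> by (rule filterlim_at_top_dense[THEN iffD1, rule_format])
      then show "\<forall>\<^sub>F n in sequentially. norm (Q n * \<alpha> n / \<xi> n - moment 1 n * \<alpha> n) \<le> (K2 * (\<alpha> n powr (\<mu> + 1) * real n) + 1) * (1 / \<xi> n)"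
        using eventually_gt_at_top[of 0]
      proof eventually_elim
        case (elim n)
        have \<alpha>: "\<alpha> n > 0" unfolding \<alpha>_def using elim saddle_point(1) by simp
        \<comment> \<open>With \<open>y = \<alpha> n * l\<close> the difference is
          \<open>y * ln y / \<alpha> n\<close>, and \<open>y * ln y\<close> is at most
          \<open>y ^ 2 + 1\<close> in absolute value both for large and for small
          \<open>y\<close>.\<close>
        have bnd: "\<bar>real l * ln (real l) - real l * \<xi> n\<bar> \<le> \<alpha> n * real l powr 2 + 1 / \<alpha> n" for l
        proof (cases "l = 0")
          case False
          define y where "y = \<alpha> n * real l"
          have y: "y > 0" using False \<alpha> by (simp add: y_def)
          have "ln (real l) - \<xi> n = ln y" using False \<alpha> by (simp add: y_def \<xi>_def ln_mult ln_div)
          then have "\<bar>real l * ln (real l) - real l * \<xi> n\<bar> = 1 / \<alpha> n * (y * \<bar>ln y\<bar>)"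
            using \<alpha> by (simp add: y_def abs_mult flip: right_diff_distrib)
          also have "y * \<bar>ln y\<bar> \<le> y ^ 2 + 1"
          proof (cases "y \<ge> 1")
            case True
            then have "y * ln y \<le> y * y" using ln_bound[of y] y by (intro mult_left_mono) auto
            moreover have "\<bar>ln y\<bar> = ln y" using True by simp
            ultimately show ?thesis unfolding power2_eq_square by linarith
          next
            case False
            have "ln (1 / y) \<le> 1 / y" using ln_bound[of "1 / y"] y by simp
            then have "y * ln (1 / y) \<le> y * (1 / y)" using y by (intro mult_left_mono) auto
            then show ?thesis using False y by (simp add: ln_div add_increasing)
          qed
          then have "1 / \<alpha> n * (y * \<bar>ln y\<bar>) \<le> 1 / \<alpha> n * (y ^ 2 + 1)" using \<alpha> by (intro mult_left_mono) auto
          also have "\<dots> = \<alpha> n * real l powr 2 + 1 / \<alpha> n"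
            using \<alpha> False by (simp add: y_def field_simps power2_eq_square)
          finally show ?thesis .
        qed (use \<alpha> in simp)
        have "Q n - moment 1 n * \<xi> n = (\<Sum>l\<le>n. weight n l * (real l * ln (real l) - real l * \<xi> n))"
          by (simp add: Q_def moment_def sum_distrib_right sum_distrib_left sum_subtractf right_diff_distrib mult_ac)
        also have "\<bar>\<dots>\<bar> \<le> (\<Sum>l\<le>n. weight n l * (\<alpha> n * real l powr 2 + 1 / \<alpha> n))"
          by (rule order_trans[OF sum_abs], rule sum_mono)
             (simp only: abs_mult abs_of_nonneg[OF weight_nonneg], intro mult_left_mono bnd weight_nonneg)
        also have "\<dots> = \<alpha> n * moment 2 n + 1 / \<alpha> n * (\<Sum>l\<le>n. weight n l)"
          unfolding moment_def distrib_left sum.distrib sum_distrib_left by (simp add: mult_ac)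
        \<comment> \<open>For \<open>\<mu> = 1\<close> the exponent \<open>2 / (\<mu> + 1)\<close>
          is 1, so \<open>\<alpha> n ^ 2\<close> times the second moment stays bounded by
          \<open>saddle_point_asymp\<close>.\<close>
        also have "\<dots> \<le> \<alpha> n * (K2 * real n) + 1 / \<alpha> n"
          using K2(2)[of n] elim \<mu> \<alpha> by (simp add: sum_weight)
        finally have "\<bar>Q n - moment 1 n * \<xi> n\<bar> * (\<alpha> n / \<xi> n) \<le> (\<alpha> n * (K2 * real n) + 1 / \<alpha> n) * (\<alpha> n / \<xi> n)"
          using \<alpha> elim by (intro mult_right_mono) auto
        also have "\<dots> = (K2 * (\<alpha> n powr (\<mu> + 1) * real n) + 1) * (1 / \<xi> n)"
          using \<alpha> elim \<mu> by (simp add: field_simps power2_eq_square)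
        also have "\<bar>Q n - moment 1 n * \<xi> n\<bar> * (\<alpha> n / \<xi> n) = \<bar>(Q n - moment 1 n * \<xi> n) * (\<alpha> n / \<xi> n)\<bar>"
          using \<alpha> elim by (simp add: abs_mult)
        also have "(Q n - moment 1 n * \<xi> n) * (\<alpha> n / \<xi> n) = Q n * \<alpha> n / \<xi> n - moment 1 n * \<alpha> n"
          using elim by (simp add: field_simps)
        finally show ?case by simp
      qed
    qed
    from tendsto_add[OF this M1] show ?thesis by simp
  qed
  show ?thesis
    unfolding mean_summands_eq \<alpha>_def[symmetric] \<xi>_def[symmetric]
  proof (rule tendstoI)
    fix \<epsilon> :: real assume \<epsilon>: "\<epsilon> > 0"
    let ?m = "avg (divisor_weight (\<lambda>k. 1))"
    obtain K where K: "\<And>n. \<bar>?m n - A * Q n\<bar> \<le> \<epsilon> / 2 * Q n + K * moment 1 n"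
      using avg_divisor_weight_critical[OF \<mu>, of "\<epsilon> / 2"] \<epsilon> unfolding Q_def by auto
    have "(\<lambda>n. \<bar>A * (Q n * \<alpha> n / \<xi> n) - A\<bar> + \<epsilon> / 2 * (Q n * \<alpha> n / \<xi> n) + (moment 1 n * \<alpha> n) * (K / \<xi> n))
        \<longlonglongrightarrow> \<bar>A * 1 - A\<bar> + \<epsilon> / 2 * 1 + 1 * 0"
      by (intro tendsto_intros Q M1 \<xi>')
    then have "\<forall>\<^sub>F n in sequentially. \<bar>A * (Q n * \<alpha> n / \<xi> n) - A\<bar> + \<epsilon> / 2 * (Q n * \<alpha> n / \<xi> n) + (moment 1 n * \<alpha> n) * (K / \<xi> n) < \<epsilon>"
      by (rule order_tendstoD(2)) (use \<epsilon> in simp)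
    moreover have "\<forall>\<^sub>F n in sequentially. \<xi> n > 0" using \<xi> by (rule filterlim_at_top_dense[THEN iffD1, rule_format])
    ultimately show "\<forall>\<^sub>F n in sequentially. dist (?m n * \<alpha> n / \<xi> n) A < \<epsilon>"
      using eventually_gt_at_top[of 0]
    proof eventually_elim
      case (elim n)
      have \<alpha>: "\<alpha> n > 0" unfolding \<alpha>_def using elim saddle_point(1) by simp
      have "?m n * \<alpha> n / \<xi> n - A * (Q n * \<alpha> n / \<xi> n) = (?m n - A * Q n) * (\<alpha> n / \<xi> n)"
        by (simp add: left_diff_distrib diff_divide_distrib mult.assoc)
      then have "\<bar>?m n * \<alpha> n / \<xi> n - A * (Q n * \<alpha> n / \<xi> n)\<bar> = \<bar>?m n - A * Q n\<bar> * (\<alpha> n / \<xi> n)"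
        using \<alpha> elim by (simp only: abs_mult) simp
      also have "\<dots> \<le> (\<epsilon> / 2 * Q n + K * moment 1 n) * (\<alpha> n / \<xi> n)"
        using \<alpha> elim by (intro mult_right_mono K) auto
      also have "\<dots> = \<epsilon> / 2 * (Q n * \<alpha> n / \<xi> n) + (moment 1 n * \<alpha> n) * (K / \<xi> n)"
        by (simp add: algebra_simps add_divide_distrib)
      finally have "\<bar>?m n * \<alpha> n / \<xi> n - A * (Q n * \<alpha> n / \<xi> n)\<bar>
          \<le> \<epsilon> / 2 * (Q n * \<alpha> n / \<xi> n) + (moment 1 n * \<alpha> n) * (K / \<xi> n)" .
      moreover have "\<bar>x - z\<bar> < w" if "\<bar>x - y\<bar> \<le> u + v" "\<bar>y - z\<bar> + u + v < w" for x y z u v w :: real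
        using that by linarith
      ultimately show ?case using elim(1) unfolding dist_real_def by blast
    qed
  qed
qed

end

section \<open>Continuation of the Dirichlet series\<close>

lemma norm_exp_minus_one_le:
  fixes z :: complex
  shows "norm (exp z - 1) \<le> norm z * exp (norm z)"
proof -
  have "norm (exp z - exp 0) \<le> exp (norm z) * norm (z - 0)"
  proof (rule field_differentiable_bound)
    show "convex (cball (0 :: complex) (norm z))" by (rule convex_cball)
    show "(exp has_field_derivative exp x) (at x within cball 0 (norm z))" for x :: complex
      by (auto intro!: derivative_eq_intros)
    show "norm (exp x) \<le> exp (norm z)" if "x \<in> cball 0 (norm z)" for x :: complex
      using that norm_exp[of x] by (auto intro: order_trans)
  qed auto
  then show ?thesis by (simp add: mult.commute)
qed

text \<open>A majorant for difference quotients built from the exponential family itself: half of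
  the radius absorbs the factor \<open>\<bar>u\<bar>\<close>, the other half the increment of the
  exponent, and \<open>exp (r * \<bar>u\<bar>)\<close> is at most the sum of
  \<open>exp (r * u)\<close> and \<open>exp (- (r * u))\<close>.\<close>

lemma exp_difference_bound:
  fixes z w :: complex and u r :: real
  assumes r: "r > 0" and w: "norm (w - z) \<le> r / 2"
  shows "norm (exp (w * of_real u) - exp (z * of_real u))
    \<le> norm (w - z) * (2 / r * (norm (exp ((z + of_real r) * of_real u)) + norm (exp ((z - of_real r) * of_real u))))"
proof -
  define d where "d = w - z"
  have "exp (w * of_real u) - exp (z * of_real u) = exp (z * of_real u) * (exp (d * of_real u) - 1)"
    by (simp add: d_def algebra_simps flip: exp_add)
  then have "norm (exp (w * of_real u) - exp (z * of_real u)) = exp (Re z * u) * norm (exp (d * of_real u) - 1)"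
    by (simp add: norm_mult)
  also have "\<dots> \<le> exp (Re z * u) * (norm (d * of_real u) * exp (norm (d * of_real u)))"
    by (intro mult_left_mono norm_exp_minus_one_le) simp
  also have "norm (d * of_real u) = norm d * \<bar>u\<bar>" by (simp add: norm_mult)
  also have "exp (Re z * u) * (norm d * \<bar>u\<bar> * exp (norm d * \<bar>u\<bar>))
      \<le> exp (Re z * u) * (norm d * (2 / r * exp (r / 2 * \<bar>u\<bar>)) * exp (r / 2 * \<bar>u\<bar>))"
  proof (intro mult_left_mono mult_mono)
    have "r / 2 * \<bar>u\<bar> \<le> exp (r / 2 * \<bar>u\<bar>)" using exp_ge_add_one_self[of "r / 2 * \<bar>u\<bar>"] by linarith
    then show "\<bar>u\<bar> \<le> 2 / r * exp (r / 2 * \<bar>u\<bar>)" using r by (simp add: field_simps)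
    show "exp (norm d * \<bar>u\<bar>) \<le> exp (r / 2 * \<bar>u\<bar>)" using mult_right_mono[OF w, of "\<bar>u\<bar>"] by (simp add: d_def)
  qed (use r in auto)
  also have "\<dots> = norm d * (2 / r * (exp (Re z * u) * exp (r * \<bar>u\<bar>)))"
    by (simp add: mult_ac flip: exp_add)
  also have "\<dots> \<le> norm d * (2 / r * (exp (Re z * u) * (exp (r * u) + exp (- (r * u)))))"
    using r by (intro mult_left_mono) (auto simp: abs_if)
  also have "exp (Re z * u) * (exp (r * u) + exp (- (r * u)))
      = norm (exp ((z + of_real r) * of_real u)) + norm (exp ((z - of_real r) * of_real u))"
    by (simp add: algebra_simps flip: exp_add)
  finally show ?thesis by (simp add: d_def)
qed

text \<open>Dominated convergence for difference quotients. The majorant is integrable because the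
  integrals exist at \<open>z + r\<close> and \<open>z - r\<close>, so no separate condition on the
  differentiated integrand arises.\<close>

lemma holomorphic_on_exp_integral:
  fixes u :: "real \<Rightarrow> real" and h :: "real \<Rightarrow> complex"
  assumes "open S" and [measurable]: "u \<in> borel_measurable borel" "h \<in> borel_measurable borel"
    and int: "\<And>z. z \<in> S \<Longrightarrow> integrable lborel (\<lambda>x. exp (z * of_real (u x)) * h x)"
  shows "(\<lambda>z. \<integral>x. exp (z * of_real (u x)) * h x \<partial>lborel) holomorphic_on S"
  unfolding holomorphic_on_def
proof
  fix z assume "z \<in> S"
  then obtain r where r: "r > 0" "cball z r \<subseteq> S" using \<open>open S\<close> by (auto simp: open_contains_cball)
  define F where "F z = (\<integral>x. exp (z * of_real (u x)) * h x \<partial>lborel)" for z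
  define B where "B x = 2 / r * (norm (exp ((z + of_real r) * of_real (u x))) + norm (exp ((z - of_real r) * of_real (u x)))) * norm (h x)" for x
  have "integrable lborel (\<lambda>x. 2 / r * (norm (exp ((z + of_real r) * of_real (u x)) * h x) + norm (exp ((z - of_real r) * of_real (u x)) * h x)))"
    using r by (intro integrable_mult_right Bochner_Integration.integrable_add integrable_norm int) (auto simp: dist_norm subset_iff)
  also have "(\<lambda>x. 2 / r * (norm (exp ((z + of_real r) * of_real (u x)) * h x) + norm (exp ((z - of_real r) * of_real (u x)) * h x))) = B"
    by (simp add: B_def fun_eq_iff norm_mult algebra_simps)
  finally have B: "integrable lborel B" .
  have "((\<lambda>w. (F w - F z) / (w - z)) \<longlongrightarrow> (\<integral>x. of_real (u x) * exp (z * of_real (u x)) * h x \<partial>lborel)) (at z)"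
    unfolding tendsto_at_iff_sequentially
  proof (intro allI impI)
    fix X assume X: "\<forall>i. X i \<in> UNIV - {z}" "X \<longlonglongrightarrow> z"
    have "\<forall>\<^sub>F i in sequentially. dist (X i) z < r / 2" using X(2) r by (intro tendstoD) auto
    then obtain N where N: "\<And>i. i \<ge> N \<Longrightarrow> dist (X i) z < r / 2" by (auto simp: eventually_sequentially)
    \<comment> \<open>The shift puts the whole sequence within distance \<open>r / 2\<close> of
      \<open>z\<close>, so the majorant is valid for every index.\<close>
    define Y where "Y i = X (i + N)" for i
    have Y: "norm (Y i - z) \<le> r / 2" "Y i \<noteq> z" for i
      using N[of "i + N"] X(1) by (auto simp: Y_def dist_norm)
    have Y_lim: "Y \<longlonglongrightarrow> z" unfolding Y_def using X(2) by (rule LIMSEQ_ignore_initial_segment)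
    have YS: "Y i \<in> S" for i using Y(1)[of i] r by (auto simp: dist_norm norm_minus_commute subset_iff)
    define s where "s i x = (exp (Y i * of_real (u x)) - exp (z * of_real (u x))) / (Y i - z) * h x" for i x
    have "(\<lambda>i. \<integral>x. s i x \<partial>lborel) \<longlonglongrightarrow> (\<integral>x. of_real (u x) * exp (z * of_real (u x)) * h x \<partial>lborel)"
    proof (rule integral_dominated_convergence)
      show "integrable lborel B" by (rule B)
      show "s i \<in> borel_measurable lborel" for i unfolding s_def by measurable
      show "(\<lambda>x. of_real (u x) * exp (z * of_real (u x)) * h x) \<in> borel_measurable lborel" by measurable
      show "AE x in lborel. (\<lambda>i. s i x) \<longlonglongrightarrow> of_real (u x) * exp (z * of_real (u x)) * h x"
      proof (rule AE_I2)
        fix x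
        have "((\<lambda>w. exp (w * of_real (u x))) has_field_derivative of_real (u x) * exp (z * of_real (u x))) (at z)"
          by (auto intro!: derivative_eq_intros)
        then have "((\<lambda>w. (exp (w * of_real (u x)) - exp (z * of_real (u x))) / (w - z)) \<longlongrightarrow> of_real (u x) * exp (z * of_real (u x))) (at z)"
          by (simp add: has_field_derivative_iff)
        moreover have "filterlim Y (at z) sequentially" using Y_lim Y(2) by (auto simp: filterlim_at)
        ultimately have "(\<lambda>i. (exp (Y i * of_real (u x)) - exp (z * of_real (u x))) / (Y i - z)) \<longlonglongrightarrow> of_real (u x) * exp (z * of_real (u x))"
          by (rule filterlim_compose)
        then show "(\<lambda>i. s i x) \<longlonglongrightarrow> of_real (u x) * exp (z * of_real (u x)) * h x"
          unfolding s_def by (intro tendsto_intros)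
      qed
      show "AE x in lborel. norm (s i x) \<le> B x" for i
      proof (rule AE_I2)
        fix x
        have "norm (exp (Y i * of_real (u x)) - exp (z * of_real (u x))) / norm (Y i - z)
            \<le> 2 / r * (norm (exp ((z + of_real r) * of_real (u x))) + norm (exp ((z - of_real r) * of_real (u x))))"
          using exp_difference_bound[OF r(1) Y(1)[of i], of "u x"] Y(2)[of i] by (simp add: pos_divide_le_eq mult.commute)
        then have "norm (exp (Y i * of_real (u x)) - exp (z * of_real (u x))) / norm (Y i - z) * norm (h x) \<le> B x"
          unfolding B_def by (rule mult_right_mono) simp
        then show "norm (s i x) \<le> B x" by (simp add: s_def norm_mult norm_divide)
      qed
    qed
    moreover have "(\<integral>x. s i x \<partial>lborel) = (F (Y i) - F z) / (Y i - z)" for i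
    proof -
      have "(\<integral>x. s i x \<partial>lborel) = (\<integral>x. (exp (Y i * of_real (u x)) * h x - exp (z * of_real (u x)) * h x) / (Y i - z) \<partial>lborel)"
        unfolding s_def by (intro Bochner_Integration.integral_cong refl) (simp add: left_diff_distrib)
      also have "\<dots> = (F (Y i) - F z) / (Y i - z)"
        unfolding F_def using int[OF YS] int[OF \<open>z \<in> S\<close>] by simp
      finally show ?thesis .
    qed
    ultimately have "(\<lambda>i. (F (Y i) - F z) / (Y i - z)) \<longlonglongrightarrow> (\<integral>x. of_real (u x) * exp (z * of_real (u x)) * h x \<partial>lborel)" by simp
    then have "(\<lambda>i. ((\<lambda>w. (F w - F z) / (w - z)) \<circ> X) (i + N)) \<longlonglongrightarrow> (\<integral>x. of_real (u x) * exp (z * of_real (u x)) * h x \<partial>lborel)"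
      by (simp add: Y_def o_def)
    then show "((\<lambda>w. (F w - F z) / (w - z)) \<circ> X) \<longlonglongrightarrow> (\<integral>x. of_real (u x) * exp (z * of_real (u x)) * h x \<partial>lborel)"
      by (rule LIMSEQ_offset)
  qed
  then have "(F has_field_derivative (\<integral>x. of_real (u x) * exp (z * of_real (u x)) * h x \<partial>lborel)) (at z)"
    by (simp add: has_field_derivative_iff)
  then show "(\<lambda>z. \<integral>x. exp (z * of_real (u x)) * h x \<partial>lborel) field_differentiable at z within S"
    unfolding F_def field_differentiable_def by (meson has_field_derivative_at_within)
qed

text \<open>The difference vanishes off a sparse set or is nonzero off a sparse set, and the open
  set \<open>S\<close> excludes the second. Nice meromorphy then fixes the values at the exceptional
  points, as 0 at poles and as limits elsewhere.\<close>

lemma nicely_meromorphic_eqI: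
  assumes "f nicely_meromorphic_on UNIV" "g nicely_meromorphic_on UNIV"
    and "open S" "S \<noteq> {}" "\<And>z. z \<in> S \<Longrightarrow> f z = g z"
  shows "f = g"
proof
  fix z
  have mf: "f meromorphic_on UNIV" "g meromorphic_on UNIV"
    using assms by (auto simp: nicely_meromorphic_on_def)
  have md: "(\<lambda>z. f z - g z) meromorphic_on UNIV" using mf by (intro meromorphic_intros)
  have "(\<forall>\<^sub>\<approx>z\<in>UNIV. f z - g z = 0) \<or> (\<forall>\<^sub>\<approx>z\<in>UNIV. f z - g z \<noteq> 0)"
    by (rule meromorphic_imp_constant_or_avoid[OF md]) auto
  moreover have "\<not> (\<forall>\<^sub>\<approx>z\<in>UNIV. f z - g z \<noteq> 0)"
  proof
    assume *: "\<forall>\<^sub>\<approx>z\<in>UNIV. f z - g z \<noteq> 0"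
    obtain z0 where z0: "z0 \<in> S" using assms(4) by auto
    have "\<forall>\<^sub>F w in at z0. f w - g w \<noteq> 0" using * by (auto simp: eventually_cosparse_open_eq)
    moreover have "\<forall>\<^sub>F w in at z0. w \<in> S" using assms(3) z0 by (rule eventually_at_in_open')
    ultimately have "\<forall>\<^sub>F w in at z0. False" by eventually_elim (use assms(5) in auto)
    then show False by simp
  qed
  ultimately have ev: "\<forall>\<^sub>F w in at z. f w = g w" by (auto simp: eventually_cosparse_open_eq)
  have pole: "is_pole f z \<longleftrightarrow> is_pole g z" by (rule is_pole_cong) (use ev in auto)
  show "f z = g z"
  proof (cases "is_pole f z")
    case True
    have "\<not> f \<midarrow>z\<rightarrow> f z" "\<not> g \<midarrow>z\<rightarrow> g z"
      using True pole not_tendsto_and_filterlim_at_infinity[of "at z" f] not_tendsto_and_filterlim_at_infinity[of "at z" g]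
      by (auto simp: is_pole_def)
    then show ?thesis using assms(1,2) unfolding nicely_meromorphic_on_def by (metis UNIV_I)
  next
    case False
    then have "f \<midarrow>z\<rightarrow> f z" "g \<midarrow>z\<rightarrow> g z"
      using assms(1,2) pole unfolding nicely_meromorphic_on_def by (metis UNIV_I)+
    moreover from this(1) have "g \<midarrow>z\<rightarrow> f z" using ev by (rule Lim_transform_eventually)
    ultimately show ?thesis using LIM_unique by blast
  qed
qed

text \<open>For positive \<open>t\<close> this is \<open>t powr (s - 1)\<close>, written as an
  exponential in \<open>s\<close> to match \<open>holomorphic_on_exp_integral\<close>.\<close>

definition mellin_kernel :: "complex \<Rightarrow> real \<Rightarrow> complex" where
  "mellin_kernel s t = exp (s * of_real (ln t)) / of_real t"

lemma mellin_kernel_measurable [measurable]: "mellin_kernel s \<in> borel_measurable borel"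
  unfolding mellin_kernel_def by measurable

lemma norm_mellin_kernel: "t > 0 \<Longrightarrow> norm (mellin_kernel s t) = t powr (Re s - 1)"
  by (simp add: mellin_kernel_def norm_divide powr_diff) (simp add: powr_def)

lemma mellin_kernel_powr: "t > 0 \<Longrightarrow> mellin_kernel s t = of_real t powr (s - 1)"
  by (simp add: mellin_kernel_def powr_diff) (simp add: powr_def Ln_of_real)

lemma mellin_kernel_mult: "L > 0 \<Longrightarrow> t > 0 \<Longrightarrow> mellin_kernel s (L * t) = of_real L powr s / of_real L * mellin_kernel s t"
  by (simp add: mellin_kernel_def ln_mult powr_def Ln_of_real distrib_left exp_add)

text \<open>Links gauge integrals, used for the fundamental theorem of calculus and Euler's
  integral, with the Lebesgue integrals used for domination.\<close>

lemma has_bochner_integral_of_has_integral: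
  fixes f :: "real \<Rightarrow> complex"
  assumes "integrable lborel (\<lambda>t. indicator S t *\<^sub>R f t)" "(f has_integral I) S"
  shows "has_bochner_integral lborel (\<lambda>t. indicator S t *\<^sub>R f t) I"
proof -
  have "(\<lambda>t. indicator S t *\<^sub>R f t) = (\<lambda>t. if t \<in> S then f t else 0)" by (auto simp: indicator_def)
  then have "((\<lambda>t. indicator S t *\<^sub>R f t) has_integral I) UNIV" using assms(2) by (simp add: has_integral_restrict_UNIV)
  from has_integral_unique[OF this has_integral_integral_lborel[OF assms(1)]] assms(1)
  show ?thesis by (simp add: has_bochner_integral_iff)
qed

lemma mellin_powr_bound_integrable:
  assumes "Re s + c > 0" and [measurable]: "f \<in> borel_measurable borel"
    and bound: "\<And>t. 0 < t \<Longrightarrow> t < 1 \<Longrightarrow> \<bar>f t\<bar> \<le> K * t powr c"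
  shows "integrable lborel (\<lambda>t. indicator {0<..<1} t *\<^sub>R (mellin_kernel s t * of_real (f t)))"
proof (rule Bochner_Integration.integrable_bound)
  show "integrable lborel (\<lambda>t. K * (indicator {0<..1} t * t powr (Re s + c - 1)))"
    using has_bochner_integral_powr[OF assms(1), of 1] by (intro integrable_mult_right) (auto simp: has_bochner_integral_iff)
  show "AE t in lborel. norm (indicator {0<..<1} t *\<^sub>R (mellin_kernel s t * of_real (f t)))
      \<le> norm (K * (indicator {0<..1} t * t powr (Re s + c - 1)))"
  proof (rule AE_I2)
    fix t :: real
    show "norm (indicator {0<..<1} t *\<^sub>R (mellin_kernel s t * of_real (f t)))
      \<le> norm (K * (indicator {0<..1} t * t powr (Re s + c - 1)))"
    proof (cases "0 < t \<and> t < 1")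
      case True
      have "norm (mellin_kernel s t * of_real (f t)) \<le> t powr (Re s - 1) * (K * t powr c)"
        using True bound[of t] by (simp add: norm_mult norm_mellin_kernel mult_left_mono)
      also have "\<dots> = K * t powr (Re s + c - 1)" by (simp add: powr_add[symmetric] algebra_simps)
      also have "\<dots> \<le> \<bar>K * t powr (Re s + c - 1)\<bar>" by (rule abs_ge_self)
      finally show ?thesis using True by simp
    qed simp
  qed
qed measurable

lemma mellin_unit_interval:
  assumes "Re z > 0"
  shows "has_bochner_integral lborel (\<lambda>t. indicator {0<..<1} t *\<^sub>R mellin_kernel z t) (1 / z)"
proof (rule has_bochner_integral_of_has_integral)
  show "integrable lborel (\<lambda>t. indicator {0<..<1} t *\<^sub>R mellin_kernel z t)"
    using mellin_powr_bound_integrable[of z 0 "\<lambda>_. 1" 1] assms by simp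
  have "((\<lambda>t. of_real t powr (z - 1)) has_integral (of_real 1 powr z / z - of_real 0 powr z / z)) {0..1}"
    using assms by (intro fundamental_theorem_of_calculus_interior)
       (auto intro!: continuous_intros derivative_eq_intros has_vector_derivative_real_field)
  then have "((\<lambda>t. of_real t powr (z - 1)) has_integral (1 / z)) {0<..<1}"
    by (simp add: has_integral_Icc_iff_Ioo)
  then show "(mellin_kernel z has_integral (1 / z)) {0<..<1}"
    by (rule has_integral_eq[rotated]) (simp add: mellin_kernel_powr)
qed

lemma mellin_exp:
  assumes s: "Re s > 0" and L: "L > 0"
  shows "has_bochner_integral lborel (\<lambda>t. indicator {0<..} t *\<^sub>R (mellin_kernel s t * of_real (exp (- (L * t)))))
    (Gamma s * of_real L powr (- s))"
proof -
  define f where "f t = indicator {0<..} t *\<^sub>R (mellin_kernel s t * of_real (exp (- t)))" for t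
  have "has_bochner_integral lborel f (Gamma s)"
    unfolding f_def
  proof (rule has_bochner_integral_of_has_integral)
    show "integrable lborel (\<lambda>t. indicator {0<..} t *\<^sub>R (mellin_kernel s t * of_real (exp (- t))))"
    proof (rule Bochner_Integration.integrable_bound)
      show "integrable lborel (gamma_kernel (Re s))"
        using has_bochner_integral_gamma_kernel[OF s] by (simp add: has_bochner_integral_iff)
      show "AE t in lborel. norm (indicator {0<..} t *\<^sub>R (mellin_kernel s t * of_real (exp (- t)))) \<le> norm (gamma_kernel (Re s) t)"
        by (rule AE_I2) (auto simp: gamma_kernel_def norm_mult norm_mellin_kernel indicator_def)
    qed measurable
    show "((\<lambda>t. mellin_kernel s t * of_real (exp (- t))) has_integral Gamma s) {0<..}"
      by (rule has_integral_eq[OF _ Gamma_integral_complex'[OF s]])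
         (simp add: mellin_kernel_powr exp_minus divide_inverse)
  qed
  then have "has_bochner_integral lborel (\<lambda>t. f (0 + L * t)) (Gamma s /\<^sub>R \<bar>L\<bar>)"
    using L by (subst (asm) lborel_has_bochner_integral_real_affine_iff[of L _ _ 0]) auto
  from has_bochner_integral_mult_right[OF this, of "of_real L * of_real L powr (- s)"]
  have "has_bochner_integral lborel (\<lambda>t. of_real L * of_real L powr (- s) * f (L * t))
      (of_real L * of_real L powr (- s) * (Gamma s /\<^sub>R \<bar>L\<bar>))" by simp
  moreover have "of_real L * of_real L powr (- s) * (Gamma s /\<^sub>R \<bar>L\<bar>) = Gamma s * of_real L powr (- s)"
    using L by (simp add: scaleR_conv_of_real field_simps)
  moreover have "of_real L * of_real L powr (- s) * f (L * t) = indicator {0<..} t *\<^sub>R (mellin_kernel s t * of_real (exp (- (L * t))))" for t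
  proof (cases "t > 0")
    case True
    have "of_real L powr (- s) * of_real L powr s = (1 :: complex)" using L by (simp flip: powr_add)
    then show ?thesis using True L by (simp add: f_def mellin_kernel_mult mult.assoc[symmetric])
  next
    case False
    then show ?thesis using L by (simp add: f_def zero_less_mult_iff)
  qed
  ultimately show ?thesis by simp
qed

section \<open>The Mellin transform of the theta series\<close>

locale admissible_sequence =
  fixes \<Lambda> :: "nat \<Rightarrow> nat" and e :: "nat \<Rightarrow> real" and a :: "real \<Rightarrow> real"
  assumes admissible: "admissible \<Lambda> e a"
begin

definition remainder :: "nat \<Rightarrow> real \<Rightarrow> real" where
  "remainder N t = theta_sum \<Lambda> t - (\<Sum>n\<le>N. a (e n) * t powr e n)"

lemma admissibleD:
  "mono \<Lambda>" "\<forall>k. 0 < \<Lambda> k" "1 \<in> range \<Lambda>" "\<forall>t>0. summable (\<lambda>k. exp (- (real (\<Lambda> k) * t)))"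
  "strict_mono e" "filterlim e at_top sequentially" "e 0 < 0" "a (e 0) \<noteq> 0"
  using admissible unfolding admissible_def by - (elim conjE, assumption)+

lemmas strict_mono_e = admissibleD(5) and e_at_top = admissibleD(6)

lemma remainder_smallo: "remainder N \<in> o[at_right 0](\<lambda>t. t powr e N)"
  using admissible unfolding admissible_def remainder_def[abs_def] by (elim conjE) (erule spec)

lemma remainder_limit: "((\<lambda>t. remainder N t / t powr e N) \<longlongrightarrow> 0) (at_right 0)"
  by (rule smalloD_tendsto[OF remainder_smallo])

sublocale theta_sequence \<Lambda> "a (e 0)" "- e 0"
proof -
  interpret part_sequence \<Lambda>
    by unfold_locales (use admissibleD in blast)+
  have lim: "((\<lambda>t. t powr (- e 0) * theta_sum \<Lambda> t) \<longlongrightarrow> a (e 0)) (at_right 0)"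
  proof -
    have "((\<lambda>t. remainder 0 t / t powr e 0 + a (e 0)) \<longlongrightarrow> 0 + a (e 0)) (at_right 0)"
      by (intro tendsto_intros remainder_limit)
    then have "((\<lambda>t. t powr (- e 0) * theta_sum \<Lambda> t) \<longlongrightarrow> 0 + a (e 0)) (at_right 0)"
      by (rule tendsto_at_right_0_cong) (simp add: remainder_def powr_minus field_simps)
    then show ?thesis by simp
  qed
  \<comment> \<open>The leading coefficient is assumed to be nonzero; its sign comes from the
    positivity of the theta series.\<close>
  have "a (e 0) \<ge> 0"
  proof (rule tendsto_lowerbound[OF lim])
    show "\<forall>\<^sub>F t in at_right 0. 0 \<le> t powr (- e 0) * theta_sum \<Lambda> t"
      using eventually_at_right_less[of "0::real"]
      by eventually_elim (auto simp: theta_sum_def intro!: mult_nonneg_nonneg suminf_nonneg summable_theta)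
  qed simp
  then have "a (e 0) > 0" using admissibleD(8) by (simp add: less_le)
  then show "theta_sequence \<Lambda> (a (e 0)) (- e 0)"
    by unfold_locales (use admissibleD(1,7) lim in auto)
qed

lemma theta_sum_measurable [measurable]: "theta_sum \<Lambda> \<in> borel_measurable borel"
  unfolding theta_sum_def[abs_def] by measurable

lemma remainder_measurable [measurable]: "remainder N \<in> borel_measurable borel"
  unfolding remainder_def[abs_def] by measurable

lemma theta_sum_decay:
  assumes "0 < r" "r \<le> t"
  shows "0 \<le> theta_sum \<Lambda> t" "theta_sum \<Lambda> t \<le> exp (r - t) * theta_sum \<Lambda> r"
  using theta_decay[of "\<lambda>k. 1" r t] theta_nonneg[of "\<lambda>k. 1" t] assms summable_theta by (auto simp: theta_1)

text \<open>The expansion controls the remainder on some interval next to 0. On the rest of the unit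
  interval boundedness gives the same power bound with a larger constant.\<close>

lemma remainder_bound:
  obtains K where "\<And>t. 0 < t \<Longrightarrow> t < 1 \<Longrightarrow> \<bar>remainder N t\<bar> \<le> K * t powr e N"
proof -
  have "\<forall>\<^sub>F t in at_right 0. dist (remainder N t / t powr e N) 0 < 1"
    by (intro tendstoD remainder_limit) simp
  then obtain r where r: "r > 0" "\<And>t. 0 < t \<Longrightarrow> t < r \<Longrightarrow> \<bar>remainder N t / t powr e N\<bar> < 1"
    unfolding eventually_at_right_field by (auto simp: dist_real_def)
  \<comment> \<open>A continuous majorant of the quotient on \<open>{r..1}\<close>: the theta series
    is replaced by its value at \<open>r\<close>, so compactness rests on the continuity of
    powers.\<close>
  define G where "G t = (theta_sum \<Lambda> r + (\<Sum>n\<le>N. \<bar>a (e n)\<bar> * t powr e n)) / t powr e N" for t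
  have "continuous_on {r..1} G" unfolding G_def using r by (intro continuous_intros) auto
  then have "bounded (G ` {r..1})" by (intro compact_imp_bounded compact_continuous_image) auto
  then obtain K where K: "\<And>t. r \<le> t \<Longrightarrow> t \<le> 1 \<Longrightarrow> G t \<le> K"
    unfolding bounded_iff by (fastforce simp: abs_le_iff)
  show ?thesis
  proof (rule that[of "max 1 K"])
    fix t :: real assume t: "0 < t" "t < 1"
    have "\<bar>remainder N t / t powr e N\<bar> \<le> max 1 K"
    proof (cases "t < r")
      case True
      then show ?thesis using r(2)[OF t(1)] by linarith
    next
      case False
      have "exp (r - t) * theta_sum \<Lambda> r \<le> 1 * theta_sum \<Lambda> r"
        by (rule mult_right_mono) (use False r theta_sum_decay(1)[of r r] in auto)
      then have "theta_sum \<Lambda> t \<le> theta_sum \<Lambda> r"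
        using theta_sum_decay(2)[of r t] False r by linarith
      moreover have "\<bar>\<Sum>n\<le>N. a (e n) * t powr e n\<bar> \<le> (\<Sum>n\<le>N. \<bar>a (e n)\<bar> * t powr e n)"
        by (rule order_trans[OF sum_abs]) (simp add: abs_mult)
      ultimately have "\<bar>remainder N t\<bar> \<le> theta_sum \<Lambda> r + (\<Sum>n\<le>N. \<bar>a (e n)\<bar> * t powr e n)"
        using theta_sum_decay(1)[of t t] t unfolding remainder_def by linarith
      then have "\<bar>remainder N t / t powr e N\<bar> \<le> G t" by (simp add: G_def divide_right_mono)
      then show ?thesis using K[of t] False t by linarith
    qed
    then show "\<bar>remainder N t\<bar> \<le> max 1 K * t powr e N" using t by (simp add: pos_divide_le_eq)
  qed
qed

abbreviation mellin_head :: "nat \<Rightarrow> complex \<Rightarrow> real \<Rightarrow> complex" where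
  "mellin_head N s t \<equiv> indicator {0<..<1} t *\<^sub>R (mellin_kernel s t * of_real (remainder N t))"

abbreviation mellin_tail :: "complex \<Rightarrow> real \<Rightarrow> complex" where
  "mellin_tail s t \<equiv> indicator {1..} t *\<^sub>R (mellin_kernel s t * of_real (theta_sum \<Lambda> t))"

lemma mellin_remainder_integrable:
  assumes "Re s > - e N"
  shows "integrable lborel (\<lambda>t. mellin_head N s t)"
proof -
  obtain K where "\<And>t. 0 < t \<Longrightarrow> t < 1 \<Longrightarrow> \<bar>remainder N t\<bar> \<le> K * t powr e N" using remainder_bound by blast
  then show ?thesis using assms by (intro mellin_powr_bound_integrable) auto
qed

lemma mellin_theta_tail_integrable:
  "integrable lborel (\<lambda>t. mellin_tail s t)"
proof (rule Bochner_Integration.integrable_bound)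
  let ?b = "max (Re s) 1"
  show "integrable lborel (\<lambda>t. exp 1 * theta_sum \<Lambda> 1 * gamma_kernel ?b t)"
    using has_bochner_integral_gamma_kernel[of ?b] by (intro integrable_mult_right) (auto simp: has_bochner_integral_iff)
  show "AE t in lborel. norm (mellin_tail s t)
      \<le> norm (exp 1 * theta_sum \<Lambda> 1 * gamma_kernel ?b t)"
  proof (rule AE_I2)
    fix t :: real
    show "norm (mellin_tail s t)
      \<le> norm (exp 1 * theta_sum \<Lambda> 1 * gamma_kernel ?b t)"
    proof (cases "t \<ge> 1")
      case True
      have 1: "t powr (Re s - 1) \<le> t powr (?b - 1)" using True by (intro powr_mono) auto
      have 2: "\<bar>theta_sum \<Lambda> t\<bar> \<le> exp (1 - t) * theta_sum \<Lambda> 1" using theta_sum_decay[of 1 t] True by simp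
      have "t powr (Re s - 1) * \<bar>theta_sum \<Lambda> t\<bar> \<le> t powr (?b - 1) * (exp (1 - t) * theta_sum \<Lambda> 1)"
        by (intro mult_mono 1 2) auto
      also have "\<dots> = exp 1 * theta_sum \<Lambda> 1 * (t powr (?b - 1) * exp (- t))"
        by (simp add: exp_diff exp_minus field_simps)
      finally show ?thesis using True theta_sum_decay(1)[of 1 1]
        by (simp add: norm_mult norm_mellin_kernel gamma_kernel_def abs_mult)
    qed simp
  qed
qed measurable

text \<open>Riemann's splitting of the Mellin integral of the theta series at \<open>t = 1\<close>.
  Each subtracted term of the expansion integrates over the unit interval to a simple fraction, a
  possible pole at \<open>- e n\<close>; the remaining head converges for
  \<open>Re s > - e N\<close>, and the tail is entire.\<close>

definition mellin_cont :: "nat \<Rightarrow> complex \<Rightarrow> complex" where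
  "mellin_cont N s = (\<Sum>n\<le>N. of_real (a (e n)) / (s + of_real (e n)))
     + (\<integral>t. mellin_head N s t \<partial>lborel)
     + (\<integral>t. mellin_tail s t \<partial>lborel)"

lemma mellin_remainder_holomorphic:
  "(\<lambda>s. \<integral>t. mellin_head N s t \<partial>lborel) holomorphic_on {s. Re s > - e N}"
proof -
  have eq: "mellin_head N s t
      = exp (s * of_real (ln t)) * (indicator {0<..<1} t *\<^sub>R of_real (remainder N t / t))" for s t
    by (simp add: mellin_kernel_def indicator_def)
  show ?thesis
    unfolding eq
    by (rule holomorphic_on_exp_integral[OF open_halfspace_Re_gt])
       (use mellin_remainder_integrable[of N, unfolded eq] in auto)
qed

lemma mellin_theta_tail_holomorphic:
  "(\<lambda>s. \<integral>t. mellin_tail s t \<partial>lborel) holomorphic_on UNIV"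
proof -
  have eq: "mellin_tail s t
      = exp (s * of_real (ln t)) * (indicator {1..} t *\<^sub>R of_real (theta_sum \<Lambda> t / t))" for s t
    by (simp add: mellin_kernel_def indicator_def)
  show ?thesis
    unfolding eq
    by (rule holomorphic_on_exp_integral[OF open_UNIV])
       (use mellin_theta_tail_integrable[unfolded eq] in auto)
qed

lemma mellin_cont_meromorphic: "mellin_cont N meromorphic_on {s. Re s > - e N}"
proof -
  have "(\<lambda>s. \<integral>t. mellin_head N s t \<partial>lborel) meromorphic_on {s. Re s > - e N}"
    using mellin_remainder_holomorphic
    by (intro analytic_on_imp_meromorphic_on) (simp add: analytic_on_open open_halfspace_Re_gt)
  moreover have "(\<lambda>s. \<integral>t. mellin_tail s t \<partial>lborel) meromorphic_on {s. Re s > - e N}"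
    using mellin_theta_tail_holomorphic
    by (intro meromorphic_on_subset[OF analytic_on_imp_meromorphic_on subset_UNIV]) (simp add: analytic_on_open)
  ultimately show ?thesis unfolding mellin_cont_def[abs_def] by (intro meromorphic_intros)
qed

lemma mellin_power_unit_interval:
  assumes "Re s > - c"
  shows "has_bochner_integral lborel (\<lambda>t. indicator {0<..<1} t *\<^sub>R (mellin_kernel s t * of_real (t powr c))) (1 / (s + of_real c))"
proof -
  have "indicator {0<..<1} t *\<^sub>R mellin_kernel (s + of_real c) t = indicator {0<..<1} t *\<^sub>R (mellin_kernel s t * of_real (t powr c))" for t :: real
    by (auto simp: indicator_def mellin_kernel_def powr_def distrib_right exp_add simp flip: exp_of_real)
  with mellin_unit_interval[of "s + of_real c"] assms show ?thesis by simp
qed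

text \<open>In the smaller half-plane the new term of the expansion is integrable on the unit
  interval, so what the head loses is exactly the new simple fraction.\<close>

lemma mellin_cont_Suc:
  assumes "Re s > - e N"
  shows "mellin_cont (Suc N) s = mellin_cont N s"
proof -
  have "e N < e (Suc N)" using strict_mono_e by (simp add: strict_mono_less)
  then have s: "Re s > - e (Suc N)" using assms by simp
  note hb = has_bochner_integral_mult_right[OF mellin_power_unit_interval[OF s], of "of_real (a (e (Suc N)))"]
  have "(\<integral>t. mellin_head (Suc N) s t \<partial>lborel)
     = (\<integral>t. mellin_head N s t
          - of_real (a (e (Suc N))) * (indicator {0<..<1} t *\<^sub>R (mellin_kernel s t * of_real (t powr e (Suc N)))) \<partial>lborel)"
    by (intro Bochner_Integration.integral_cong refl) (simp add: remainder_def indicator_def algebra_simps)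
  also have "\<dots> = (\<integral>t. mellin_head N s t \<partial>lborel)
      - of_real (a (e (Suc N))) * (1 / (s + of_real (e (Suc N))))"
    using hb mellin_remainder_integrable[OF assms]
    by (subst Bochner_Integration.integral_diff) (auto simp: has_bochner_integral_iff)
  finally show ?thesis by (simp add: mellin_cont_def)
qed

lemma mellin_cont_eq:
  assumes "Re s > - e N" "N \<le> M"
  shows "mellin_cont M s = mellin_cont N s"
  using assms(2)
proof (induction rule: dec_induct)
  case (step m)
  have "e N \<le> e m" using step strict_mono_e by (simp add: strict_mono_less_eq)
  then show ?case using mellin_cont_Suc[of m s] step assms(1) by simp
qed simp

text \<open>Termwise Mellin transformation. Sum and integral may be exchanged because the integrals
  of the norms are a constant times \<open>part k powr (- Re s)\<close>, which
  \<open>summable_parts_powr\<close> sums.\<close>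

lemma mellin_theta:
  assumes s: "Re s > - e 0"
  shows "(\<lambda>k. Gamma s * of_nat (\<Lambda> k) powr (- s)) sums mellin_cont 0 s"
proof -
  have s0: "Re s > 0" using s \<mu>_pos by simp
  define f where "f s k t = indicator {0<..} t *\<^sub>R (mellin_kernel s t * of_real (exp (- (real (\<Lambda> k) * t))))" for s k t
  have f: "has_bochner_integral lborel (f s k) (Gamma s * of_nat (\<Lambda> k) powr (- s))" if "Re s > 0" for s k
    using mellin_exp[OF that, of "real (\<Lambda> k)"] pos[of k] unfolding f_def by simp
  have int: "integrable lborel (f s k)" for k using f[OF s0] by (simp add: has_bochner_integral_iff)
  \<comment> \<open>The norm of the term at \<open>s\<close> is the term at the real point
    \<open>Re s\<close>, so \<open>mellin_exp\<close> also evaluates the integrals of the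
    norms.\<close>
  have norm_f: "complex_of_real (norm (f s k t)) = f (of_real (Re s)) k t" for k t
  proof (cases "t > 0")
    case True
    have "complex_of_real (norm (mellin_kernel s t)) = mellin_kernel (of_real (Re s)) t"
      unfolding norm_mellin_kernel[OF True]
      using True powr_of_real[of t "Re s - 1"] by (simp add: mellin_kernel_powr)
    then show ?thesis using True by (simp add: f_def norm_mult)
  qed (simp add: f_def)
  have int_norm: "(\<integral>t. norm (f s k t) \<partial>lborel) = Gamma (Re s) * real (\<Lambda> k) powr (- Re s)" for k
  proof -
    have "complex_of_real (\<integral>t. norm (f s k t) \<partial>lborel) = (\<integral>t. complex_of_real (norm (f s k t)) \<partial>lborel)"
      by (rule integral_complex_of_real[symmetric])
    also have "\<dots> = Gamma (of_real (Re s)) * of_nat (\<Lambda> k) powr (- of_real (Re s))"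
      unfolding norm_f using f[of "of_real (Re s)" k] s0 by (simp add: has_bochner_integral_iff)
    also have "\<dots> = complex_of_real (Gamma (Re s) * real (\<Lambda> k) powr (- Re s))"
      using pos[of k] powr_of_real[of "real (\<Lambda> k)" "- Re s"] by (simp add: Gamma_complex_of_real)
    finally show ?thesis by (simp only: of_real_eq_iff)
  qed
  have sum_norm: "summable (\<lambda>k. \<integral>t. norm (f s k t) \<partial>lborel)"
    unfolding int_norm using summable_parts_powr[OF s] by (rule summable_mult)
  have sum_f: "(\<lambda>k. f s k t) sums (indicator {0<..} t *\<^sub>R (mellin_kernel s t * of_real (theta_sum \<Lambda> t)))" for t
  proof (cases "t > 0")
    case True
    then have "(\<lambda>k. complex_of_real (exp (- (real (\<Lambda> k) * t)))) sums of_real (theta_sum \<Lambda> t)"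
      unfolding sums_of_real_iff theta_sum_def by (intro summable_sums summable_theta)
    from sums_mult[OF this, of "mellin_kernel s t"] True show ?thesis by (simp add: f_def)
  qed (simp add: f_def)
  have AE: "AE t in lborel. summable (\<lambda>k. norm (f s k t))"
  proof (rule AE_I2)
    fix t :: real
    show "summable (\<lambda>k. norm (f s k t))"
    proof (cases "t > 0")
      case True
      from summable_mult[OF summable_theta[OF this], of "norm (mellin_kernel s t)"] True
      show ?thesis by (simp add: f_def norm_mult)
    qed (simp add: f_def)
  qed
  define T where "T = (\<lambda>t. indicator {0<..} t *\<^sub>R (mellin_kernel s t * of_real (theta_sum \<Lambda> t)))"
  have T: "T = (\<lambda>t. \<Sum>k. f s k t)" using sum_f by (auto simp: T_def sums_iff)
  have "(\<lambda>k. \<integral>t. f s k t \<partial>lborel) sums (\<integral>t. T t \<partial>lborel)"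
    unfolding T by (rule sums_integral[OF int AE sum_norm])
  moreover have "(\<integral>t. f s k t \<partial>lborel) = Gamma s * of_nat (\<Lambda> k) powr (- s)" for k
    using f[OF s0] by (simp add: has_bochner_integral_iff)
  moreover have "(\<integral>t. T t \<partial>lborel) = mellin_cont 0 s"
  proof -
    note hb = has_bochner_integral_mult_right[OF mellin_power_unit_interval[of "e 0" s], of "of_real (a (e 0))"]
    have "T t = (mellin_head 0 s t
          + of_real (a (e 0)) * (indicator {0<..<1} t *\<^sub>R (mellin_kernel s t * of_real (t powr e 0))))
          + mellin_tail s t" for t
      by (auto simp: T_def remainder_def indicator_def algebra_simps)
    then have "(\<integral>t. T t \<partial>lborel) = (\<integral>t. mellin_head 0 s t \<partial>lborel)
       + of_real (a (e 0)) * (1 / (s + of_real (e 0)))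
       + (\<integral>t. mellin_tail s t \<partial>lborel)"
      using hb s mellin_remainder_integrable[OF s] mellin_theta_tail_integrable[of s]
      by (simp add: has_bochner_integral_iff del: of_real_mult)
    then show ?thesis by (simp add: mellin_cont_def)
  qed
  ultimately show ?thesis by simp
qed

text \<open>Gluing: \<open>mellin_cont N\<close> and \<open>mellin_cont M\<close> agree where both
  integrals converge, and the half-planes exhaust the plane because \<open>e\<close> tends to
  infinity. The least index is just a canonical choice.\<close>

definition mellin_ext :: "complex \<Rightarrow> complex" where
  "mellin_ext s = mellin_cont (LEAST N. Re s > - e N) s"

lemma mellin_ext_eq:
  assumes "Re s > - e N"
  shows "mellin_ext s = mellin_cont N s"
  unfolding mellin_ext_def
  by (rule mellin_cont_eq[symmetric]) (use assms in \<open>auto intro: LeastI Least_le\<close>)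

lemma mellin_ext_meromorphic: "mellin_ext meromorphic_on UNIV"
  unfolding meromorphic_on_meromorphic_at[of _ UNIV]
proof
  fix s :: complex
  have "\<forall>\<^sub>F N in sequentially. e N > - Re s" using e_at_top by (rule filterlim_at_top_dense[THEN iffD1, rule_format])
  from eventually_happens[OF this] obtain N where "- Re s < e N" by auto
  then have N: "Re s > - e N" by linarith
  have "mellin_ext meromorphic_on {s. Re s > - e N} \<longleftrightarrow> mellin_cont N meromorphic_on {s. Re s > - e N}"
    by (rule meromorphic_on_cong')
       (auto simp: eventually_cosparse_open_eq open_halfspace_Re_gt mellin_ext_eq
          intro!: eventually_mono[OF eventually_at_in_open'[OF open_halfspace_Re_gt[of "- e N"]]])
  then have "mellin_ext meromorphic_on {s. Re s > - e N}" using mellin_cont_meromorphic by simp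
  then show "mellin_ext meromorphic_on {s}" by (rule meromorphic_on_subset) (use N in auto)
qed

text \<open>The definite description requires a continuation and its uniqueness. The candidate is
  the Mellin transform divided by \<open>Gamma\<close>; \<open>rGamma\<close> is entire, so this
  creates no poles, and \<open>remove_sings\<close> normalises the remaining values.\<close>

lemma zeta_seq_sums:
  assumes "Re s > - e 0"
  shows "(\<lambda>k. of_nat (\<Lambda> k) powr (- s)) sums zeta_seq \<Lambda> (- e 0) s"
proof -
  define Z where "Z = remove_sings (\<lambda>s. rGamma s * mellin_ext s)"
  have "(\<lambda>s. rGamma s * mellin_ext s) meromorphic_on UNIV"
    by (intro meromorphic_intros mellin_ext_meromorphic analytic_on_imp_meromorphic_on)
       (auto simp: analytic_on_open intro!: holomorphic_intros)
  then have Z: "Z nicely_meromorphic_on UNIV"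
    unfolding Z_def by (rule remove_sings_nicely_meromorphic)
  have hol: "(\<lambda>s. rGamma s * mellin_ext s) holomorphic_on {s. Re s > - e 0}"
  proof (rule holomorphic_transform)
    show "(\<lambda>s. rGamma s * mellin_cont 0 s) holomorphic_on {s. Re s > - e 0}"
      unfolding mellin_cont_def
      by (intro holomorphic_intros mellin_remainder_holomorphic holomorphic_on_subset[OF mellin_theta_tail_holomorphic])
         (auto simp: complex_eq_iff)
  qed (simp add: mellin_ext_eq)
  have sums: "(\<lambda>k. of_nat (\<Lambda> k) powr (- s)) sums Z s" if s: "Re s > - e 0" for s
  proof -
    have "(\<lambda>s. rGamma s * mellin_ext s) analytic_on {s}"
      by (rule analytic_on_subset[of _ "{s. Re s > - e 0}"]) (use hol s in \<open>auto simp: analytic_on_open open_halfspace_Re_gt\<close>)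
    then have "Z s = rGamma s * mellin_cont 0 s"
      unfolding Z_def using s by (simp add: mellin_ext_eq)
    moreover have "Re s > 0" using s \<mu>_pos by simp
    then have "s \<notin> \<int>\<^sub>\<le>\<^sub>0" by (auto elim!: nonpos_Ints_cases)
    then have "rGamma s * Gamma s = 1" by (simp add: rGamma_inverse_Gamma Gamma_eq_zero_iff)
    ultimately show ?thesis using sums_mult[OF mellin_theta[OF s], of "rGamma s"] by (simp flip: mult.assoc)
  qed
  have "zeta_seq \<Lambda> (- e 0) = Z"
    unfolding zeta_seq_def
  proof (rule the_equality)
    show "Z nicely_meromorphic_on UNIV \<and> (\<forall>s. - e 0 < Re s \<longrightarrow> (\<lambda>k. of_nat (\<Lambda> k) powr - s) sums Z s)"
      using Z sums by simp
    fix Z' assume Z': "Z' nicely_meromorphic_on UNIV \<and> (\<forall>s. - e 0 < Re s \<longrightarrow> (\<lambda>k. of_nat (\<Lambda> k) powr - s) sums Z' s)"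
    show "Z' = Z"
    proof (rule nicely_meromorphic_eqI[of _ _ "{s. Re s > - e 0}"])
      have "of_real (1 - e 0) \<in> {s. Re s > - e 0}" by simp
      then show "{s. Re s > - e 0} \<noteq> {}" by blast
      show "Z' s = Z s" if "s \<in> {s. Re s > - e 0}" for s
        using Z' sums[of s] that by (auto intro: sums_unique2)
    qed (use Z Z' open_halfspace_Re_gt in auto)
  qed
  then show ?thesis using sums[OF assms] by simp
qed

end

section \<open>The expected number of summands\<close>

theorem theorem3:
  fixes \<Lambda> :: "nat \<Rightarrow> nat" and e :: "nat \<Rightarrow> real" and A :: "real \<Rightarrow> real"
    and \<mu>\<^sub>0 :: real and \<alpha> :: "nat \<Rightarrow> real"
  assumes "admissible \<Lambda> e A"
    and "\<mu>\<^sub>0 = - e 0"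
    and "\<alpha> = saddle_point \<Lambda>"
  shows "(\<mu>\<^sub>0 < 1 \<longrightarrow>
            (\<lambda>n. complex_of_real (mean_summands \<Lambda> n))
              \<sim>[at_top] (\<lambda>n. zeta_seq \<Lambda> \<mu>\<^sub>0 1 / complex_of_real (\<alpha> n))) \<and>
         (\<mu>\<^sub>0 = 1 \<longrightarrow>
            (\<lambda>n. complex_of_real (mean_summands \<Lambda> n))
              \<sim>[at_top] (\<lambda>n. 1 / complex_of_real (\<alpha> n) *
                (finite_part (zeta_seq \<Lambda> \<mu>\<^sub>0) 1 - complex_of_real (A (-1) * ln (\<alpha> n))))) \<and>
         (\<mu>\<^sub>0 > 1 \<longrightarrow>
            mean_summands \<Lambda>
              \<sim>[at_top] (\<lambda>n. riemann_zeta \<mu>\<^sub>0 * A (- \<mu>\<^sub>0) / \<alpha> n powr \<mu>\<^sub>0))"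
proof -
  interpret admissible_sequence \<Lambda> e A
    by unfold_locales (rule assms(1))
  have \<alpha>_pos: "\<forall>\<^sub>F n in sequentially. \<alpha> n > 0"
    using eventually_gt_at_top[of 0] unfolding assms(3) by eventually_elim (rule saddle_point(1))
  have \<alpha>_lim: "filterlim \<alpha> (at_right 0) sequentially"
    unfolding assms(3) by (rule saddle_point_tendsto_0)
  show ?thesis
  proof (intro conjI impI)
    assume \<mu>: "\<mu>\<^sub>0 < 1"
    define S where "S = (\<Sum>k. 1 / real (\<Lambda> k))"
    \<comment> \<open>For \<open>\<mu>\<^sub>0 < 1\<close> the point 1 lies in the half-plane of
      convergence, so the continuation takes the value of the series there.\<close>
    have "(\<lambda>k. complex_of_nat (\<Lambda> k) powr (- 1)) sums zeta_seq \<Lambda> \<mu>\<^sub>0 1"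
      unfolding assms(2) by (rule zeta_seq_sums) (use \<mu> assms(2) in simp)
    moreover have "complex_of_nat (\<Lambda> k) powr (- 1) = complex_of_real (1 / real (\<Lambda> k))" for k
      using pos[of k] by (simp add: powr_minus_divide)
    moreover have "(\<lambda>k. 1 / real (\<Lambda> k)) sums S"
      unfolding S_def using summable_parts_powr[of 1] \<mu> assms(2) pos
      by (intro summable_sums) (simp add: powr_minus_divide)
    then have "(\<lambda>k. complex_of_real (1 / real (\<Lambda> k))) sums complex_of_real S" by (rule sums_of_real)
    ultimately have Z: "zeta_seq \<Lambda> \<mu>\<^sub>0 1 = complex_of_real S" using sums_unique2 by fastforce
    have S: "S > 0" "(\<lambda>n. mean_summands \<Lambda> n * \<alpha> n) \<longlonglongrightarrow> S"
      unfolding S_def assms(3) using mean_summands_small \<mu> assms(2) by auto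
    show "(\<lambda>n. complex_of_real (mean_summands \<Lambda> n)) \<sim>[at_top] (\<lambda>n. zeta_seq \<Lambda> \<mu>\<^sub>0 1 / complex_of_real (\<alpha> n))"
    proof (rule asymp_equivI')
      have "(\<lambda>n. complex_of_real (mean_summands \<Lambda> n * \<alpha> n / S)) \<longlonglongrightarrow> of_real (S / S)"
        using S by (intro tendsto_of_real tendsto_divide) auto
      then show "(\<lambda>n. complex_of_real (mean_summands \<Lambda> n) / (zeta_seq \<Lambda> \<mu>\<^sub>0 1 / complex_of_real (\<alpha> n))) \<longlonglongrightarrow> 1"
        using S unfolding Z by simp
    qed
  next
    assume \<mu>: "\<mu>\<^sub>0 = 1"
    define c where "c = finite_part (zeta_seq \<Lambda> \<mu>\<^sub>0) 1"
    define l where "l n = ln (1 / \<alpha> n)" for n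
    have A: "A (- 1) = A (e 0)" "A (e 0) > 0" using \<mu> assms(2) A_pos by auto
    have m: "(\<lambda>n. mean_summands \<Lambda> n * \<alpha> n / l n) \<longlonglongrightarrow> A (e 0)"
      unfolding l_def assms(3) using mean_summands_critical \<mu> assms(2) by simp
    have l: "filterlim l at_top sequentially"
      unfolding l_def by (rule filterlim_compose[OF _ \<alpha>_lim]) real_asymp
    have "(\<lambda>n. 1 / l n) \<longlonglongrightarrow> 0" by (rule real_tendsto_divide_at_top[OF tendsto_const l])
    \<comment> \<open>Both sides are compared in units of \<open>l n / \<alpha> n\<close>: the
      constant \<open>c\<close> becomes \<open>c / l n\<close> and vanishes, which leaves the
      nonzero limit \<open>A (e 0)\<close>.\<close>
    then have "(\<lambda>n. c * complex_of_real (1 / l n) + of_real (A (e 0))) \<longlonglongrightarrow> c * of_real 0 + of_real (A (e 0))"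
      by (intro tendsto_intros)
    from tendsto_divide[OF tendsto_of_real[OF m] this] A
    have "(\<lambda>n. complex_of_real (mean_summands \<Lambda> n * \<alpha> n / l n) / (c * complex_of_real (1 / l n) + of_real (A (e 0)))) \<longlonglongrightarrow> 1"
      by simp
    moreover have "\<forall>\<^sub>F n in sequentially. l n > 0" using l by (rule filterlim_at_top_dense[THEN iffD1, rule_format])
    then have "\<forall>\<^sub>F n in sequentially. complex_of_real (mean_summands \<Lambda> n * \<alpha> n / l n) / (c * complex_of_real (1 / l n) + of_real (A (e 0)))
        = complex_of_real (mean_summands \<Lambda> n) / (1 / complex_of_real (\<alpha> n) * (c - complex_of_real (A (- 1) * ln (\<alpha> n))))"
      using \<alpha>_pos
    proof eventually_elim
      case (elim n)
      have "ln (\<alpha> n) = - l n" using elim by (simp add: l_def ln_div)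
      then have "c - complex_of_real (A (- 1) * ln (\<alpha> n)) = (c * complex_of_real (1 / l n) + of_real (A (e 0))) * of_real (l n)"
        using elim A by (simp add: distrib_right)
      then show ?case using elim by simp
    qed
    ultimately have "(\<lambda>n. complex_of_real (mean_summands \<Lambda> n) / (1 / complex_of_real (\<alpha> n) * (c - complex_of_real (A (- 1) * ln (\<alpha> n))))) \<longlonglongrightarrow> 1"
      by (rule Lim_transform_eventually)
    then show "(\<lambda>n. complex_of_real (mean_summands \<Lambda> n))
              \<sim>[at_top] (\<lambda>n. 1 / complex_of_real (\<alpha> n) *
                (finite_part (zeta_seq \<Lambda> \<mu>\<^sub>0) 1 - complex_of_real (A (-1) * ln (\<alpha> n))))"
      unfolding c_def by (rule asymp_equivI')
  next
    assume \<mu>: "\<mu>\<^sub>0 > 1"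
    define c where "c = riemann_zeta \<mu>\<^sub>0 * A (- \<mu>\<^sub>0)"
    have c: "c > 0" using \<mu> riemann_zeta_pos A_pos assms(2) by (simp add: c_def)
    have "(\<lambda>n. mean_summands \<Lambda> n * \<alpha> n powr \<mu>\<^sub>0) \<longlonglongrightarrow> c"
      using mean_summands_large \<mu> assms(2,3) by (simp add: c_def mult.commute)
    then have "(\<lambda>n. mean_summands \<Lambda> n * \<alpha> n powr \<mu>\<^sub>0 / c) \<longlonglongrightarrow> c / c"
      using c by (intro tendsto_divide tendsto_const) auto
    then show "mean_summands \<Lambda> \<sim>[at_top] (\<lambda>n. riemann_zeta \<mu>\<^sub>0 * A (- \<mu>\<^sub>0) / \<alpha> n powr \<mu>\<^sub>0)"
      using c unfolding c_def[symmetric] by (intro asymp_equivI') simp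
  qed
qed

end
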